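(* Let $\alpha\in\mathbb{C}\setminus\{-1,-2,-3,\ldots\}$ and let $n\ge1$ be an integer. The following Riemann-Hilbert problem on $(0,+\infty)$ for a $2\times2$ complex matrix valued function $Y(z)$: (I) $Y$ is analytic on $\mathbb{C}\setminus[0,+\infty)$ and the following limits exist for $x>0$: $$Y^+(x)=\lim_{z\to x;\ \Im z>0}Y(z),\qquad Y^-(x)=\lim_{z\to x;\ \Im z<0}Y(z);$$ (II) $Y^+(x)=Y^-(x)\begin{pmatrix}1& x^\alpha e^{-x}\\0&1\end{pmatrix}$ for $x>0$; (III$_\infty$) $Y(z)=\left(I+O(z^{-1})\right)\begin{pmatrix}z^n&0\\0&z^{-n}\end{pmatrix}$ for $z\to\infty$; (III$_0$) $Y(z)=\begin{pmatrix}O(1)& z^\alpha\mathcal{O}_0+O(1)\\ O(1)& z^\alpha\mathcal{O}_0+O(1)\end{pmatrix}$ for $z\to0$, has the unique solution $$Y=\begin{pmatrix}\pi_n&\mathcal{C}_\alpha[\pi_n]\\ c_n\pi_{n-1}&c_n\mathcal{C}_\alpha[\pi_{n-1}]\end{pmatrix},$$ where $\mathcal{C}_\alpha[p](z)=\dfrac{1}{2\pi i}\,\mathrm{f.p.}\!\displaystyle\int_0^\infty\frac{t^\alpha p(t)e^{-t}}{t-z}\,dt$ (Hadamard finite part), $\pi_m=(-1)^mL_m^{(\alpha)}$ are the monic Laguerre polynomials, and $c_n=-2\pi i\left[(n-1)!\,\Gamma(\alpha+n)\right]^{-1}$.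
   Context: Laguerre polynomials are normalized by $L_m^{(\alpha)}(x)=w(x)^{-1}\frac{d^m}{dx^m}[x^m w(x)]$ with $w(x)=x^\alpha e^{-x}$; they are polynomials of degree $m$ with leading coefficient $(-1)^m$. Hadamard finite part on the half line: let $\alpha\in\mathbb{C}\setminus\{-1,-2,\ldots\}$, let $F$ be analytic on $[0,+\infty)$ with Taylor series $F(t)=\sum_{m\ge0}F_m t^m$ at $0$, and suppose $t^\alpha F(t)$ is integrable near $+\infty$. Then $$\mathrm{f.p.}\!\int_0^\infty t^\alpha F(t)\,dt:=\sum_{m=0}^\infty \frac{F_m}{m+\alpha+1}\,\xi^{m+\alpha+1}+\int_\xi^\infty t^\alpha F(t)\,dt,$$ where $\xi>0$ is any number smaller than the radius of convergence of the Taylor series (the value does not depend on $\xi$) and $t^\alpha=e^{\alpha\ln t}$ for $t>0$. In $\mathcal{C}_\alpha[p](z)$, $z\in\mathbb{C}\setminus[0,+\infty)$ and $F(t)=p(t)e^{-t}/(t-z)$. Notation: $\mathcal{O}_0$ is the set of germs of analytic functions at $0$. One writes $f(z)=z^\alpha\mathcal{O}_0+O(1)$ for $z\to0$ if there is $f_0\in\mathcal{O}_0$ such that $f(z)-z^\alpha f_0(z)=O(1)$ as $z\to0$; here $z\in\mathbb{C}\setminus[0,+\infty)$ and $z^\alpha$ is any fixed analytic branch there (different branches differ by constant factors).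
   Formalization: The value α = 0 is excluded: there z^α𝒪_0 + O(1) in (III_0) just means boundedness, while 𝒞_0[π_n] has a logarithmic singularity at 0 because π_n(0) = (−1)^n n! ≠ 0, so the stated Y is not a solution. *)

theory Defs
  imports "HOL-Complex_Analysis.Complex_Analysis" "HOL-Library.Landau_Symbols"
begin

text \<open>
  For a positive real argument, the principal power used here is
  \<open>t powr a = exp (a * ln t)\<close>.
\<close>

definition laguerre_weight :: "complex \<Rightarrow> complex \<Rightarrow> complex" where
  "laguerre_weight \<alpha> z = z powr \<alpha> * exp (- z)"

text \<open>
  Rodrigues' formula without the customary factor \<open>1 / m!\<close>, so the leading coefficient
  is \<open>(-1) ^ m\<close>. The formula is only imposed on the positive half line, where the power is
  unambiguous; this determines the polynomial (see \<open>laguerre_ex1\<close>).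
\<close>

definition laguerre :: "complex \<Rightarrow> nat \<Rightarrow> complex poly" where
  "laguerre \<alpha> m = (THE p. \<forall>x::real. x > 0 \<longrightarrow>
     poly p (of_real x) =
       inverse (laguerre_weight \<alpha> (of_real x)) *
         (deriv ^^ m) (\<lambda>z. z ^ m * laguerre_weight \<alpha> z) (of_real x))"

definition monic_laguerre :: "complex \<Rightarrow> nat \<Rightarrow> complex poly" where
  "monic_laguerre \<alpha> m = smult ((-1) ^ m) (laguerre \<alpha> m)"

lemma laguerre_deriv_iter:
  assumes "j \<le> m"
  shows "\<exists>q. \<forall>z. Re z > 0 \<longrightarrow>
    (deriv ^^ j) (\<lambda>z. z ^ m * laguerre_weight \<alpha> z) z = z ^ (m - j) * poly q z * laguerre_weight \<alpha> z"
  using assms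
proof (induction j)
  case 0
  show ?case by (rule exI[of _ 1]) simp
next
  case (Suc j)
  then obtain q where q: "\<And>z. Re z > 0 \<Longrightarrow>
    (deriv ^^ j) (\<lambda>z. z ^ m * laguerre_weight \<alpha> z) z = z ^ (m - j) * poly q z * laguerre_weight \<alpha> z"
    by auto
  obtain k where k: "m - j = Suc k" "m - Suc j = k"
    using Suc.prems by (metis Suc_diff_Suc Suc_le_lessD)
  define r where "r = smult (of_nat (Suc k) + \<alpha>) q + [:0, 1:] * pderiv q - [:0, 1:] * q"
  have "(deriv ^^ Suc j) (\<lambda>z. z ^ m * laguerre_weight \<alpha> z) z
      = z ^ (m - Suc j) * poly r z * laguerre_weight \<alpha> z" if z: "Re z > 0" for z
  proof -
    have "open {z. Re z > 0}" by (simp add: open_halfspace_Re_gt)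
    then have "eventually (\<lambda>z. Re z > 0) (nhds z)"
      using z eventually_nhds_in_open by fastforce
    then have ev: "eventually (\<lambda>z. (deriv ^^ j) (\<lambda>z. z ^ m * laguerre_weight \<alpha> z) z
        = z ^ Suc k * poly q z * laguerre_weight \<alpha> z) (nhds z)"
      by eventually_elim (use q k in auto)
    have nz: "z \<noteq> 0" "z \<notin> \<real>\<^sub>\<le>\<^sub>0" using z by (auto simp: complex_nonpos_Reals_iff)
    have pw: "z powr \<alpha> = z * z powr (\<alpha> - 1)"
      using nz by (simp add: powr_diff)
    have "((\<lambda>z. z ^ Suc k * poly q z * laguerre_weight \<alpha> z) has_field_derivative
        z ^ k * poly r z * laguerre_weight \<alpha> z) (at z)"
      unfolding laguerre_weight_def r_def using nz
      by (auto intro!: derivative_eq_intros simp del: power_Suc)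
         (simp add: pw algebra_simps)
    then have "deriv (\<lambda>z. z ^ Suc k * poly q z * laguerre_weight \<alpha> z) z
        = z ^ k * poly r z * laguerre_weight \<alpha> z" by (rule DERIV_imp_deriv)
    with deriv_cong_ev[OF ev refl] k show ?thesis by simp
  qed
  then show ?case by blast
qed

lemma laguerre_ex1:
  "\<exists>!p. \<forall>x::real. x > 0 \<longrightarrow>
     poly p (of_real x) =
       inverse (laguerre_weight \<alpha> (of_real x)) *
         (deriv ^^ m) (\<lambda>z. z ^ m * laguerre_weight \<alpha> z) (of_real x)"
    (is "\<exists>!p. ?P p")
proof -
  obtain q where q: "\<And>z. Re z > 0 \<Longrightarrow>
    (deriv ^^ m) (\<lambda>z. z ^ m * laguerre_weight \<alpha> z) z = poly q z * laguerre_weight \<alpha> z"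
    using laguerre_deriv_iter[OF order_refl] by fastforce
  have "?P q" using q by (auto simp: laguerre_weight_def field_simps)
  moreover have "p = q" if "?P p" for p
  proof -
    have "complex_of_real ` {0<..} \<subseteq> {z. poly (p - q) z = 0}"
      using that \<open>?P q\<close> by auto
    moreover have "infinite (complex_of_real ` {0<..})"
      by (simp add: finite_image_iff inj_on_def infinite_Ioi)
    ultimately have "p - q = 0" using poly_roots_finite finite_subset by blast
    then show ?thesis by simp
  qed
  ultimately show ?thesis by blast
qed

definition taylor_coeff :: "(complex \<Rightarrow> complex) \<Rightarrow> nat \<Rightarrow> complex" where
  "taylor_coeff F m = (deriv ^^ m) F 0 / fact m"

definition fp_split :: "complex \<Rightarrow> (complex \<Rightarrow> complex) \<Rightarrow> real \<Rightarrow> complex" where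
  "fp_split \<alpha> F \<xi> =
     (\<Sum>m. taylor_coeff F m / (of_nat m + \<alpha> + 1) * of_real \<xi> powr (of_nat m + \<alpha> + 1)) +
     (LINT t:{\<xi>..}|lborel. of_real t powr \<alpha> * F (of_real t))"

text \<open>
  The value of \<open>fp_split \<alpha> F \<xi>\<close> does not depend on the admissible \<open>\<xi>\<close>, so the choice of \<open>\<xi>\<close>
  in \<open>fp_integral\<close> is immaterial.
\<close>

definition fp_integral :: "complex \<Rightarrow> (complex \<Rightarrow> complex) \<Rightarrow> complex" where
  "fp_integral \<alpha> F =
     fp_split \<alpha> F (SOME \<xi>. 0 < \<xi> \<and> ereal \<xi> < conv_radius (taylor_coeff F))"

definition fp_cauchy :: "complex \<Rightarrow> complex poly \<Rightarrow> complex \<Rightarrow> complex" where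
  "fp_cauchy \<alpha> p z =
     1 / (2 * of_real pi * \<i>) * fp_integral \<alpha> (\<lambda>t. poly p t * exp (- t) / (t - z))"

abbreviation slit_plane :: "complex set" where
  "slit_plane \<equiv> - \<real>\<^sub>\<ge>\<^sub>0"

text \<open>
  The branch of \<open>z\<^sup>\<alpha>\<close> with \<open>0 < arg z < 2 * pi\<close>, analytic on the complement of the closed
  positive half line. (The principal \<open>powr\<close> has its cut on the other half line.) Any other
  branch there is a constant nonzero multiple, which the germ in \<open>power_germ_bounded\<close> absorbs.
  For \<open>\<alpha> = 0\<close> that condition is plain boundedness, while the Cauchy transform
  of \<open>p(t) * exp (- t)\<close> with \<open>p(0) \<noteq> 0\<close> has a logarithmic singularity at the origin; this is why the
  theorem assumes \<open>\<alpha> \<noteq> 0\<close>.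
\<close>

definition slit_power :: "complex \<Rightarrow> complex \<Rightarrow> complex" where
  "slit_power \<alpha> z = exp (\<alpha> * (of_real (ln (cmod z)) + \<i> * of_real (Arg2pi z)))"

definition bounded_at_0 :: "(complex \<Rightarrow> complex) \<Rightarrow> bool" where
  "bounded_at_0 f \<longleftrightarrow> f \<in> O[at 0 within slit_plane](\<lambda>_. 1)"

definition power_germ_bounded :: "complex \<Rightarrow> (complex \<Rightarrow> complex) \<Rightarrow> bool" where
  "power_germ_bounded \<alpha> f \<longleftrightarrow>
     (\<exists>f0. f0 analytic_on {0} \<and> bounded_at_0 (\<lambda>z. f z - slit_power \<alpha> z * f0 z))"

abbreviation mat2 :: "complex \<Rightarrow> complex \<Rightarrow> complex \<Rightarrow> complex \<Rightarrow> complex^2^2" where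
  "mat2 a b c d \<equiv> vector [vector [a, b], vector [c, d]]"

abbreviation upper_at :: "real \<Rightarrow> complex filter" where
  "upper_at x \<equiv> at (of_real x) within {z. Im z > 0}"

abbreviation lower_at :: "real \<Rightarrow> complex filter" where
  "lower_at x \<equiv> at (of_real x) within {z. Im z < 0}"

abbreviation slit_at_infinity :: "complex filter" where
  "slit_at_infinity \<equiv> inf at_infinity (principal slit_plane)"

definition laguerre_RHP :: "complex \<Rightarrow> nat \<Rightarrow> (complex \<Rightarrow> complex^2^2) \<Rightarrow> bool" where
  "laguerre_RHP \<alpha> n Y \<longleftrightarrow>
     (\<forall>i j. (\<lambda>z. Y z $ i $ j) analytic_on slit_plane) \<and>
     (\<forall>x>0. (\<exists>L. (Y \<longlongrightarrow> L) (upper_at x)) \<and> (\<exists>L. (Y \<longlongrightarrow> L) (lower_at x))) \<and>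
     (\<forall>x>0. Lim (upper_at x) Y =
        Lim (lower_at x) Y ** mat2 1 (of_real x powr \<alpha> * exp (- of_real x)) 0 1) \<and>
     (\<exists>E :: complex \<Rightarrow> complex^2^2.
        (\<forall>i j. (\<lambda>z. E z $ i $ j) \<in> O[slit_at_infinity](\<lambda>z. inverse z)) \<and>
        (\<forall>\<^sub>F z in slit_at_infinity.
           Y z = (mat 1 + E z) ** mat2 (z ^ n) 0 0 (z powi (- int n)))) \<and>
     (\<forall>i. bounded_at_0 (\<lambda>z. Y z $ i $ 1) \<and> power_germ_bounded \<alpha> (\<lambda>z. Y z $ i $ 2))"

definition laguerre_c :: "complex \<Rightarrow> nat \<Rightarrow> complex" where
  "laguerre_c \<alpha> n = - 2 * of_real pi * \<i> * inverse (fact (n - 1) * Gamma (\<alpha> + of_nat n))"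

text \<open>Only the values on the slit plane are meaningful.\<close>

definition laguerre_Y :: "complex \<Rightarrow> nat \<Rightarrow> complex \<Rightarrow> complex^2^2" where
  "laguerre_Y \<alpha> n z = mat2
     (poly (monic_laguerre \<alpha> n) z)
     (fp_cauchy \<alpha> (monic_laguerre \<alpha> n) z)
     (laguerre_c \<alpha> n * poly (monic_laguerre \<alpha> (n - 1)) z)
     (laguerre_c \<alpha> n * fp_cauchy \<alpha> (monic_laguerre \<alpha> (n - 1)) z)"

end

theory Submission
  imports Defs "HOL-Real_Asymp.Real_Asymp"
begin

text \<open>
  Write \<open>K\<^sub>\<alpha>(z)\<close> for the finite part of the integral of \<open>t\<^sup>\<alpha> e\<^sup>-\<^sup>t / (t - z)\<close>. Since \<open>t / (t - z) = 1 + z / (t - z)\<close>,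
  it satisfies \<open>K\<^sub>\<alpha>\<^sub>+\<^sub>1(z) = z K\<^sub>\<alpha>(z) + \<Gamma>(\<alpha> + 1)\<close>, so holomorphy, the jump \<open>2 \<pi> \<i> x\<^sup>\<alpha> e\<^sup>-\<^sup>x\<close> and the bound
  \<open>O(1 / z)\<close> at infinity descend to every admissible exponent from large \<open>Re \<alpha>\<close>, where \<open>K\<^sub>\<alpha>\<close> is the ordinary
  Cauchy transform of a bounded Lipschitz density. For non-integral \<open>\<alpha>\<close> the behaviour at the origin comes from
  the differential equation \<open>z K' = \<alpha> (K - \<Gamma>(\<alpha>)) - z K\<close>, whose solutions are
  \<open>c z\<^sup>\<alpha> e\<^sup>-\<^sup>z + (\<Sum>k. \<Gamma>(\<alpha> - k) z\<^sup>k)\<close>; for integral \<open>\<alpha> \<ge> 1\<close> the function \<open>K\<^sub>\<alpha>\<close> is bounded.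

  The rows of the problem decouple. The difference of two solutions has rows \<open>(u, v)\<close> with \<open>u\<close> free of jumps,
  hence a polynomial of degree less than \<open>n\<close> by Liouville's theorem; then \<open>v - \<C>\<^sub>\<alpha>[u]\<close> is free of jumps, bounded
  at the origin and vanishes at infinity, so \<open>v = \<C>\<^sub>\<alpha>[u]\<close>. The decay \<open>v = O(z\<^sup>-\<^sup>n\<^sup>-\<^sup>1)\<close> says that \<open>u\<close> is
  orthogonal to \<open>1, t, \<dots>, t\<^sup>n\<^sup>-\<^sup>1\<close> for the functional \<open>t\<^sup>j \<mapsto> \<Gamma>(\<alpha> + 1 + j)\<close>, and pairing with the
  Laguerre polynomial of the degree of \<open>u\<close> yields \<open>u = 0\<close>.
\<close>

section \<open>Cauchy transforms of Lipschitz densities\<close>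

text \<open>Two features of the finite part shape the proof. Its splitting point \<xi> comes from a
  choice operator and is known only to lie below a radius of convergence; so the identities are
  proved for every admissible \<xi>, and independence of \<xi> follows by the same descent in the
  exponent. If p(z) = 0, the pole of p(t) exp(-t) / (t - z) disappears and the chosen \<xi> may
  exceed |z|; hence p is divided by t - z before the kernel is treated. Re \<alpha> >= 1 starts the
  descent because t^\<alpha> exp(-t), extended by zero, is then Lipschitz on the whole line, and one
  bound serves the origin, the cut and infinity. For complex \<alpha> there is no positivity;
  nondegeneracy of the moments rests on Gamma(\<alpha> + 1 + m) being nonzero. In the uniqueness
  part the obstacle is a singularity z^\<alpha> with Re \<alpha> very negative: without a jump, its
  germ must vanish at 0 to a compensating order. The constant c_n arises because the Cauchy
  transform of the monic polynomial of degree n - 1 behaves like -h / (2 \<pi> \<i>) z^(-n) at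
  infinity, where h = (n-1)! Gamma(\<alpha> + n).\<close>

lemma dominated_convergence_within:
  fixes s :: "'b::metric_space \<Rightarrow> 'a \<Rightarrow> 'c::{banach, second_countable_topology}"
  assumes meas: "f \<in> borel_measurable M" "\<And>z. s z \<in> borel_measurable M"
    and w: "integrable M w"
    and lim: "AE t in M. ((\<lambda>z. s z t) \<longlongrightarrow> f t) (at a within S)"
    and bound: "\<forall>\<^sub>F z in at a within S. AE t in M. norm (s z t) \<le> w t"
  shows "((\<lambda>z. integral\<^sup>L M (s z)) \<longlongrightarrow> integral\<^sup>L M f) (at a within S)"
  \<comment> \<open>Along a sequence the domination holds only from some index \<open>N\<close> on,
    so the sequence is shifted by \<open>N\<close> before dominated convergence is applied.\<close>
  unfolding tendsto_at_iff_sequentially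
proof (intro allI impI)
  fix X assume X: "\<forall>i. X i \<in> S - {a}" "X \<longlonglongrightarrow> a"
  then have F: "filterlim X (at a within S) sequentially"
    by (auto simp: filterlim_at)
  obtain N where N: "\<And>n. N \<le> n \<Longrightarrow> AE t in M. norm (s (X n) t) \<le> w t"
    using filterlim_iff[THEN iffD1, OF F, rule_format, OF bound] by (auto simp: eventually_sequentially)
  have "(\<lambda>n. integral\<^sup>L M (s (X (n + N)))) \<longlonglongrightarrow> integral\<^sup>L M f"
  proof (rule integral_dominated_convergence[where w = w])
    show "AE t in M. (\<lambda>n. s (X (n + N)) t) \<longlonglongrightarrow> f t"
      using lim
    proof eventually_elim
      case (elim t)
      then have "(\<lambda>n. s (X n) t) \<longlonglongrightarrow> f t" using F by (rule filterlim_compose)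
      then show ?case by (rule LIMSEQ_ignore_initial_segment)
    qed
  qed (use meas w N in auto)
  then show "((\<lambda>z. integral\<^sup>L M (s z)) \<circ> X) \<longlonglongrightarrow> integral\<^sup>L M f"
    unfolding o_def by (rule LIMSEQ_offset)
qed

definition cauchy_transform :: "(real \<Rightarrow> complex) \<Rightarrow> complex \<Rightarrow> complex" where
  "cauchy_transform f z = (LINT t|lborel. f t / (of_real t - z))"

text \<open>The window is symmetric about Re z, so the logarithmic part of the primitive takes equal
  values at both ends and cancels. What remains tends to \<i> \<pi> or -\<i> \<pi> as Im z tends to
  0 from above or below.\<close>

lemma has_bochner_integral_cauchy_kernel_window:
  assumes "Im z \<noteq> 0"
  shows "has_bochner_integral lborel
    (\<lambda>t. indicator {Re z - 1..Re z + 1} t *\<^sub>R (1 / (of_real t - z))) (2 * \<i> * of_real (arctan (1 / Im z)))"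
proof -
  let ?x = "Re z" and ?y = "Im z"
  \<comment> \<open>A logarithm of t - z assembled from the real \<open>ln\<close> and
    \<open>arctan\<close>: for fixed z off the real line it is smooth on all of the line, and no
    branch cut has to be avoided.\<close>
  define G where "G t = of_real (ln ((t - ?x)\<^sup>2 + ?y\<^sup>2) / 2) + \<i> * of_real (arctan ((t - ?x) / ?y))" for t
  have pos: "(t - ?x)\<^sup>2 + ?y\<^sup>2 > 0" for t
    using assms by (simp add: add_nonneg_pos)
  have ne: "of_real t - z \<noteq> 0" for t using assms by (auto simp: complex_eq_iff)
  have 1: "((\<lambda>t. ln ((t - ?x)\<^sup>2 + ?y\<^sup>2) / 2) has_real_derivative ((t - ?x) / ((t - ?x)\<^sup>2 + ?y\<^sup>2))) (at t within T)" for t T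
  proof -
    have "((\<lambda>t. (t - ?x)\<^sup>2 + ?y\<^sup>2) has_real_derivative 2 * (t - ?x)) (at t within T)"
      by (auto intro!: derivative_eq_intros)
    note DERIV_cdivide[OF DERIV_chain2[OF DERIV_ln_divide[OF pos] this], of 2]
    moreover have "1 / q * (2 * a) / 2 = a / q" for a q :: real by simp
    ultimately show ?thesis by (simp only:)
  qed
  have e: "1 + ((t - ?x) / ?y)\<^sup>2 = ((t - ?x)\<^sup>2 + ?y\<^sup>2) / ?y\<^sup>2" for t
    using assms by (simp add: field_simps)
  have 2: "((\<lambda>t. arctan ((t - ?x) / ?y)) has_real_derivative (?y / ((t - ?x)\<^sup>2 + ?y\<^sup>2))) (at t within T)" for t T
    using pos[of t] assms
    by (auto intro!: derivative_eq_intros simp: e field_simps power2_eq_square)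
  have 3: "1 / (of_real t - z) =
      of_real ((t - ?x) / ((t - ?x)\<^sup>2 + ?y\<^sup>2)) + \<i> * of_real (?y / ((t - ?x)\<^sup>2 + ?y\<^sup>2))" for t
    using pos[of t] by (simp add: complex_eq_iff Re_divide Im_divide power2_eq_square[of "(t - ?x)\<^sup>2 + ?y\<^sup>2"])
  have "(G has_vector_derivative (1 / (of_real t - z))) (at t within T)" for t T
    unfolding G_def 3
    by (intro has_vector_derivative_add has_vector_derivative_mult_right
        has_vector_derivative_of_real 1
        2)
  moreover have "continuous_on {?x - 1..?x + 1} (\<lambda>t. 1 / (of_real t - z))"
    by (intro continuous_intros) (use ne in auto)
  ultimately have "has_bochner_integral lborel
      (\<lambda>t. indicator {?x - 1..?x + 1} t *\<^sub>R (1 / (of_real t - z))) (G (?x + 1) - G (?x - 1))"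
    by (intro has_bochner_integral_FTC_Icc) auto
  moreover have "arctan (- (1 / ?y)) = - arctan (1 / ?y)" by (rule arctan_minus)
  then have "G (?x + 1) - G (?x - 1) = 2 * \<i> * of_real (arctan (1 / ?y))"
    by (simp add: G_def algebra_simps)
  ultimately show ?thesis by simp
qed

lemma dist_nonneg_Reals:
  fixes z :: complex
  assumes "z \<notin> \<real>\<^sub>\<ge>\<^sub>0"
  obtains d where "d > 0" "\<And>t. t \<ge> 0 \<Longrightarrow> d \<le> norm (of_real t - z)"
proof -
  obtain d where d: "d > 0" "ball z d \<subseteq> - \<real>\<^sub>\<ge>\<^sub>0"
    using assms open_contains_ball[of "- \<real>\<^sub>\<ge>\<^sub>0 :: complex set"] closed_nonneg_Reals_complex by (metis ComplI open_Compl)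
  have "d \<le> norm (of_real t - z)" if "t \<ge> 0" for t
  proof -
    have "of_real t \<notin> ball z d" using d(2) that by auto
    then show ?thesis by (simp add: dist_norm norm_minus_commute)
  qed
  with d(1) show ?thesis by (rule that)
qed

locale lipschitz_density =
  fixes f :: "real \<Rightarrow> complex" and M :: real
  assumes integrable: "integrable lborel f"
    and lipschitz: "norm (f s - f t) \<le> M * \<bar>s - t\<bar>"
begin

lemma M_nonneg: "M \<ge> 0"
  using order_trans[OF norm_ge_zero lipschitz[of 0 1]] by simp

lemma continuous: "isCont f t"
proof -
  have "((\<lambda>s. M * \<bar>s - t\<bar>) \<longlongrightarrow> M * \<bar>t - t\<bar>) (at t)" by (intro tendsto_intros)
  then have lim: "((\<lambda>s. M * \<bar>s - t\<bar>) \<longlongrightarrow> 0) (at t)" by simp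
  have "((\<lambda>s. f s - f t) \<longlongrightarrow> 0) (at t)"
    by (rule Lim_null_comparison[OF _ lim]) (simp add: lipschitz)
  then show ?thesis by (simp add: isCont_def LIM_zero_iff)
qed

text \<open>
  Removing the value at \<open>Re z\<close> on a unit window makes the Cauchy integrand bounded uniformly in \<open>z\<close>; the
  removed part integrates to an explicit arctangent, which carries the jump.
\<close>

definition flattened :: "complex \<Rightarrow> real \<Rightarrow> complex" where
  "flattened z t = f t - indicator {Re z - 1..Re z + 1} t *\<^sub>R f (Re z)"

lemma measurable_f [measurable]: "f \<in> borel_measurable borel"
  using integrable by (simp add: integrable_iff_bounded)

lemma measurable_flattened [measurable]: "flattened z \<in> borel_measurable borel"
  unfolding flattened_def by measurable

text \<open>Inside the window the Lipschitz bound cancels the pole; outside it, |t - z| >= 1. At t =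
  z the quotient is 0 by the convention on division.\<close>

lemma norm_flattened:
  "norm (flattened z t / (of_real t - z)) \<le> norm (f t) + M * indicator {Re z - 1..Re z + 1} t"
proof (cases "t \<in> {Re z - 1..Re z + 1}")
  case True
  have "\<bar>t - Re z\<bar> \<le> norm (of_real t - z)"
    using abs_Re_le_cmod[of "of_real t - z"] by simp
  then have "norm (f t - f (Re z)) \<le> M * norm (of_real t - z)"
    using lipschitz[of t "Re z"] M_nonneg by (meson mult_left_mono order_trans)
  then have "norm ((f t - f (Re z)) / (of_real t - z)) \<le> M"
    using M_nonneg by (cases "of_real t = z") (auto simp: norm_divide field_simps)
  then show ?thesis using True by (simp add: flattened_def add_increasing)
next
  case False
  then have "1 \<le> \<bar>t - Re z\<bar>" by auto
  also have "\<dots> \<le> norm (of_real t - z)"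
    using abs_Re_le_cmod[of "of_real t - z"] by simp
  finally have "norm (f t) / norm (of_real t - z) \<le> norm (f t) / 1"
    by (intro divide_left_mono) auto
  then show ?thesis using False by (simp add: flattened_def norm_divide)
qed

lemma integrable_flattened: "integrable lborel (\<lambda>t. flattened z t / (of_real t - z))"
proof (rule Bochner_Integration.integrable_bound)
  show "integrable lborel (\<lambda>t. norm (f t) + M * indicator {Re z - 1..Re z + 1} t)"
    using integrable by (intro Bochner_Integration.integrable_add integrable_mult_right) auto
  show "AE t in lborel. norm (flattened z t / (of_real t - z))
      \<le> norm (norm (f t) + M * indicator {Re z - 1..Re z + 1} t)"
    using norm_flattened[of z] by (auto intro: order_trans[OF _ abs_ge_self])
qed simp

abbreviation flattened_transform :: "complex \<Rightarrow> complex" where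
  "flattened_transform z \<equiv> LINT t|lborel. flattened z t / (of_real t - z)"

lemma norm_integral_flattened:
  "norm (flattened_transform z) \<le> (LINT t|lborel. norm (f t)) + 2 * M"
proof -
  have "norm (flattened_transform z)
      \<le> (LINT t|lborel. norm (f t) + M * indicator {Re z - 1..Re z + 1} t)"
    using integrable norm_flattened[of z]
    by (intro Bochner_Integration.integral_norm_bound_integral integrable_flattened)
       (auto intro!: Bochner_Integration.integrable_add integrable_mult_right)
  also have "\<dots> = (LINT t|lborel. norm (f t)) + 2 * M"
    using integrable by (subst Bochner_Integration.integral_add) auto
  finally show ?thesis .
qed

lemma cauchy_transform_eq:
  assumes "Im z \<noteq> 0"
  shows "cauchy_transform f z =
    flattened_transform z + f (Re z) * (2 * \<i> * of_real (arctan (1 / Im z)))"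
proof -
  have "has_bochner_integral lborel
      (\<lambda>t. flattened z t / (of_real t - z)
        + f (Re z) * (indicator {Re z - 1..Re z + 1} t *\<^sub>R (1 / (of_real t - z))))
      (flattened_transform z + f (Re z) * (2 * \<i> * of_real (arctan (1 / Im z))))"
    by (intro has_bochner_integral_add has_bochner_integral_mult_right
        has_bochner_integral_cauchy_kernel_window has_bochner_integral_integrable integrable_flattened assms)
  moreover have "flattened z t / (of_real t - z)
      + f (Re z) * (indicator {Re z - 1..Re z + 1} t *\<^sub>R (1 / (of_real t - z))) = f t / (of_real t - z)" for t
    by (simp add: flattened_def diff_divide_distrib scaleR_conv_of_real)
  ultimately show ?thesis
    unfolding cauchy_transform_def by (simp add: has_bochner_integral_integral_eq)
qed

text \<open>The alternative \<open>f (Re z) = 0\<close> admits real z outside the support: there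
  flattening removes nothing, and the arctangent formula, which needs Im z nonzero, is
  avoided.\<close>

lemma cauchy_transform_bounded:
  assumes B: "\<And>t. norm (f t) \<le> B" and "Im z \<noteq> 0 \<or> f (Re z) = 0"
  shows "norm (cauchy_transform f z) \<le> (LINT t|lborel. norm (f t)) + 2 * M + B * pi"
proof (cases "Im z = 0")
  case True
  then have "cauchy_transform f z = flattened_transform z"
    using assms by (simp add: cauchy_transform_def flattened_def)
  moreover have "0 \<le> B" using B norm_ge_zero order_trans by blast
  then have "B * pi \<ge> 0" by simp
  ultimately show ?thesis using norm_integral_flattened[of z] by simp
next
  case False
  have "2 * \<bar>arctan (1 / Im z)\<bar> \<le> pi"
    using arctan_bounded[of "1 / Im z"] by (auto simp: abs_if)
  then have "norm (f (Re z) * (2 * \<i> * of_real (arctan (1 / Im z)))) \<le> B * pi"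
    using B[of "Re z"] order_trans[OF norm_ge_zero B]
    by (auto simp: norm_mult intro!: mult_mono)
  then show ?thesis
    unfolding cauchy_transform_eq[OF False]
    using norm_integral_flattened[of z] by (intro order_trans[OF norm_triangle_ineq]) linarith
qed

text \<open>The approach set \<open>S\<close> is arbitrary, so the limit is the same from both sides
  and this part contributes nothing to the jump.\<close>

lemma tendsto_integral_flattened:
  "(flattened_transform \<longlongrightarrow>
    flattened_transform (of_real x)) (at (of_real x) within S)"
proof (rule dominated_convergence_within)
  \<comment> \<open>The window moves with z. For |Re z - x| < 1 it stays inside [x - 2, x + 2],
    which makes the dominating function independent of z.\<close>
  show "integrable lborel (\<lambda>t. norm (f t) + M * indicator {x - 2..x + 2} t)"
    using integrable by (intro Bochner_Integration.integrable_add integrable_mult_right) auto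
  have "\<forall>\<^sub>F z in at (of_real x) within S. dist (z::complex) (of_real x) < 1"
    by (rule eventually_at_topological[THEN iffD2], rule exI[of _ "ball (of_real x) 1"])
       (auto simp: dist_commute)
  then show "\<forall>\<^sub>F z in at (of_real x) within S. AE t in lborel.
      norm (flattened z t / (of_real t - z)) \<le> norm (f t) + M * indicator {x - 2..x + 2} t"
  proof eventually_elim
    case (elim z)
    then have "\<bar>Re z - x\<bar> < 1"
      using abs_Re_le_cmod[of "z - of_real x"] by (simp add: dist_norm)
    then have "M * indicator {Re z - 1..Re z + 1} t \<le> M * indicator {x - 2..x + 2} t" for t
      using M_nonneg by (auto simp: indicator_def)
    then have "norm (flattened z t / (of_real t - z)) \<le> norm (f t) + M * indicator {x - 2..x + 2} t" for t
      using norm_flattened[of z t] by (meson add_left_mono order_trans)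
    then show ?case by simp
  qed
  \<comment> \<open>At x - 1 and x + 1 the moving indicator need not converge, and at x the kernel
    is singular.\<close>
  have "AE t in lborel. t \<notin> {x - 1, x, x + 1}"
    by (intro AE_not_in countable_imp_null_set_lborel) auto
  then show "AE t in lborel. ((\<lambda>z. flattened z t / (of_real t - z)) \<longlongrightarrow>
      flattened (of_real x) t / (of_real t - of_real x)) (at (of_real x) within S)"
  proof eventually_elim
    case (elim t)
    have Re: "(Re \<longlongrightarrow> x) (at (of_real x) within S)"
      using tendsto_Re[OF tendsto_ident_at, of "of_real x" S] by simp
    have "\<forall>\<^sub>F z in at (of_real x) within S.
        (indicator {Re z - 1..Re z + 1} t :: real) = indicator {x - 1..x + 1} t"
    proof -
      let ?d = "\<bar>\<bar>t - x\<bar> - 1\<bar>"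
      have "?d > 0" using elim by auto
      then have "\<forall>\<^sub>F z in at (of_real x) within S. \<bar>Re z - x\<bar> < ?d"
        using tendstoD[OF Re] by (simp add: dist_real_def)
      then show ?thesis
        by eventually_elim (auto simp: indicator_def abs_if split: if_splits)
    qed
    then have "((\<lambda>z. indicator {Re z - 1..Re z + 1} t :: real) \<longlongrightarrow> indicator {x - 1..x + 1} t)
        (at (of_real x) within S)" by (rule tendsto_eventually)
    moreover have "((\<lambda>z. f (Re z)) \<longlongrightarrow> f x) (at (of_real x) within S)"
      using isCont_tendsto_compose[OF continuous Re] .
    ultimately have "((\<lambda>z. flattened z t) \<longlongrightarrow> flattened (of_real x) t) (at (of_real x) within S)"
      unfolding flattened_def by (auto intro!: tendsto_intros)
    then show ?case using elim by (intro tendsto_divide tendsto_intros) auto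
  qed
qed auto

text \<open>The Sokhotski-Plemelj formula: the flattened integral at x plays the part of the
  principal value, and the arctangent, tending to \<pi>/2, supplies half of the jump. The lower side
  supplies the other half with the opposite sign.\<close>

lemma tendsto_cauchy_transform_upper:
  "(cauchy_transform f \<longlongrightarrow>
    flattened_transform (of_real x) + f x * (\<i> * of_real pi)) (upper_at x)"
proof -
  have Re: "(Re \<longlongrightarrow> x) (upper_at x)" and Im: "(Im \<longlongrightarrow> 0) (upper_at x)"
    using tendsto_Re[OF tendsto_ident_at, of "of_real x"] tendsto_Im[OF tendsto_ident_at, of "of_real x"]
    by simp_all
  have ev: "\<forall>\<^sub>F z in upper_at x. Im z > 0" by (simp add: eventually_at_filter)
  have "filterlim (\<lambda>z. inverse (Im z)) at_top (upper_at x)"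
    using Im ev by (rule filterlim_inverse_at_top)
  then have "((\<lambda>z. arctan (1 / Im z)) \<longlongrightarrow> pi / 2) (upper_at x)"
    using filterlim_compose[OF tendsto_arctan_at_top] by (simp add: inverse_eq_divide)
  then have lim: "((\<lambda>z. flattened_transform z
      + f (Re z) * (2 * \<i> * of_real (arctan (1 / Im z)))) \<longlongrightarrow>
      flattened_transform (of_real x)
      + f x * (2 * \<i> * of_real (pi / 2))) (upper_at x)"
    by (intro tendsto_intros tendsto_integral_flattened isCont_tendsto_compose[OF continuous Re])
  have "\<forall>\<^sub>F z in upper_at x. flattened_transform z
      + f (Re z) * (2 * \<i> * of_real (arctan (1 / Im z))) = cauchy_transform f z"
    using ev by eventually_elim (simp add: cauchy_transform_eq)
  from Lim_transform_eventually[OF lim this] show ?thesis by simp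
qed

lemma tendsto_cauchy_transform_lower:
  "(cauchy_transform f \<longlongrightarrow>
    flattened_transform (of_real x) - f x * (\<i> * of_real pi)) (lower_at x)"
proof -
  have Re: "(Re \<longlongrightarrow> x) (lower_at x)" and Im: "(Im \<longlongrightarrow> 0) (lower_at x)"
    using tendsto_Re[OF tendsto_ident_at, of "of_real x"] tendsto_Im[OF tendsto_ident_at, of "of_real x"]
    by simp_all
  have ev: "\<forall>\<^sub>F z in lower_at x. Im z < 0" by (simp add: eventually_at_filter)
  have "filterlim (\<lambda>z. inverse (Im z)) at_bot (lower_at x)"
    using Im ev by (rule filterlim_inverse_at_bot)
  then have "((\<lambda>z. arctan (1 / Im z)) \<longlongrightarrow> - pi / 2) (lower_at x)"
    using filterlim_compose[OF tendsto_arctan_at_bot] by (simp add: inverse_eq_divide)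
  then have lim: "((\<lambda>z. flattened_transform z
      + f (Re z) * (2 * \<i> * of_real (arctan (1 / Im z)))) \<longlongrightarrow>
      flattened_transform (of_real x)
      + f x * (2 * \<i> * of_real (- pi / 2))) (lower_at x)"
    by (intro tendsto_intros tendsto_integral_flattened isCont_tendsto_compose[OF continuous Re])
  have "\<forall>\<^sub>F z in lower_at x. flattened_transform z
      + f (Re z) * (2 * \<i> * of_real (arctan (1 / Im z))) = cauchy_transform f z"
    using ev by eventually_elim (simp add: cauchy_transform_eq)
  from Lim_transform_eventually[OF lim this] show ?thesis by simp
qed

text \<open>The difference quotient of the kernel is 1 / ((t - w)(t - z)). With d the distance of z
  from the half line, it is at most 4 / d^2 once |w - z| < d/2. Negative t are harmless because the
  density vanishes there.\<close>

lemma has_field_derivative_cauchy_transform: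
  assumes f0: "\<And>t. t \<le> 0 \<Longrightarrow> f t = 0" and z: "z \<notin> \<real>\<^sub>\<ge>\<^sub>0"
  shows "(cauchy_transform f has_field_derivative (LINT t|lborel. f t / (of_real t - z)\<^sup>2)) (at z)"
proof -
  obtain d where d: "d > 0" "\<And>t. t \<ge> 0 \<Longrightarrow> d \<le> norm (of_real t - z)"
    using dist_nonneg_Reals[OF z] by blast
  have far: "d / 2 \<le> norm (of_real t - w)" if "dist w z < d / 2" "t \<ge> 0" for t w
    using d(2)[OF that(2)] that(1) norm_triangle_ineq[of "of_real t - w" "w - z"] by (simp add: dist_norm)
  have int: "integrable lborel (\<lambda>t. f t / (of_real t - w))" if "dist w z < d / 2" for w
  proof (rule Bochner_Integration.integrable_bound)
    show "integrable lborel (\<lambda>t. f t * of_real (2 / d))" using integrable by simp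
    have "norm (f t / (of_real t - w)) \<le> norm (f t * of_real (2 / d))" for t
    proof (cases "t \<ge> 0")
      case True
      have "norm (f t) / norm (of_real t - w) \<le> norm (f t) / (d / 2)"
        using far[OF that True] d by (intro divide_left_mono mult_pos_pos) auto
      then show ?thesis using d by (simp add: norm_mult norm_divide field_simps)
    qed (use f0 in auto)
    then show "AE t in lborel. norm (f t / (of_real t - w)) \<le> norm (f t * of_real (2 / d))" by simp
  qed simp
  have near: "\<forall>\<^sub>F w in at z. dist w z < d / 2"
    using d by (intro eventually_at[THEN iffD2] exI[of _ "d / 2"]) auto
  have "((\<lambda>w. LINT t|lborel. f t / ((of_real t - w) * (of_real t - z))) \<longlongrightarrow>
      (LINT t|lborel. f t / (of_real t - z)\<^sup>2)) (at z)"
  proof (rule dominated_convergence_within)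
    show "integrable lborel (\<lambda>t. norm (f t) * (4 / d\<^sup>2))"
      using integrable by simp
    show "\<forall>\<^sub>F w in at z. AE t in lborel. norm (f t / ((of_real t - w) * (of_real t - z))) \<le> norm (f t) * (4 / d\<^sup>2)"
      using near
    proof eventually_elim
      case (elim w)
      have "norm (f t / ((of_real t - w) * (of_real t - z))) \<le> norm (f t) * (4 / d\<^sup>2)" for t
      proof (cases "t \<ge> 0")
        case True
        have "d / 2 * (d / 2) \<le> norm ((of_real t - w) * (of_real t - z))"
          unfolding norm_mult using far[OF elim True] far[of z t] True d by (intro mult_mono) auto
        moreover have "d / 2 * (d / 2) > 0" using d by simp
        ultimately have "norm (f t) / norm ((of_real t - w) * (of_real t - z)) \<le> norm (f t) / (d / 2 * (d / 2))"
          by (intro frac_le) auto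
        then show ?thesis by (simp add: norm_divide power2_eq_square)
      qed (use f0 in auto)
      then show ?case by simp
    qed
    have "((\<lambda>w. f t / ((of_real t - w) * (of_real t - z))) \<longlongrightarrow> f t / (of_real t - z)\<^sup>2) (at z)" for t
    proof (cases "t \<ge> 0")
      case True
      then have "of_real t \<noteq> z" using z by auto
      then show ?thesis
        unfolding power2_eq_square by (intro tendsto_intros) auto
    qed (use f0 in auto)
    then show "AE t in lborel. ((\<lambda>w. f t / ((of_real t - w) * (of_real t - z))) \<longlongrightarrow> f t / (of_real t - z)\<^sup>2) (at z)"
      by simp
  qed auto
  moreover have "\<forall>\<^sub>F w in at z. (LINT t|lborel. f t / ((of_real t - w) * (of_real t - z)))
      = (cauchy_transform f w - cauchy_transform f z) / (w - z)"
  proof -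
    have "\<forall>\<^sub>F w in at z. w \<noteq> z" by (simp add: eventually_at_filter)
    with near show ?thesis
    proof eventually_elim
      case (elim w)
      have "f t / ((of_real t - w) * (of_real t - z))
          = (f t / (of_real t - w) - f t / (of_real t - z)) / (w - z)" for t
      proof (cases "t \<ge> 0")
        case True
        then have "of_real t \<noteq> z" "of_real t \<noteq> w" using z far[of w t] elim d by auto
        then have "f t / (of_real t - w) - f t / (of_real t - z) = f t * (w - z) / ((of_real t - w) * (of_real t - z))"
          by (subst diff_frac_eq) (auto simp: right_diff_distrib)
        then show ?thesis using elim by simp
      qed (use f0 in auto)
      then show ?case
        unfolding cauchy_transform_def using int[of w] int[of z] elim d
        by (simp flip: Bochner_Integration.integral_diff)
    qed
  qed
  ultimately show ?thesis
    unfolding has_field_derivative_iff by (rule Lim_transform_eventually)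
qed

end

section \<open>Regular exponents and the Gamma density\<close>

abbreviation regular_exponent :: "complex \<Rightarrow> bool" where
  "regular_exponent \<alpha> \<equiv> \<alpha> \<notin> {- of_nat k | k::nat. k \<ge> 1}"

lemma regular_exponent_nonzero:
  assumes "regular_exponent \<alpha>"
  shows "of_nat m + \<alpha> + 1 \<noteq> 0"
proof
  assume "of_nat m + \<alpha> + 1 = 0"
  then have "\<alpha> + of_nat (Suc m) = 0" by (simp add: add_ac)
  then have "\<alpha> = - of_nat (Suc m)" by (simp only: eq_neg_iff_add_eq_0)
  then have "\<exists>k::nat. \<alpha> = - of_nat k \<and> k \<ge> 1" by (intro exI[of _ "Suc m"]) auto
  then show False using assms by blast
qed

lemma regular_exponent_add_1:
  assumes "regular_exponent \<alpha>"
  shows "regular_exponent (\<alpha> + 1)"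
proof
  assume "\<alpha> + 1 \<in> {- of_nat k | k::nat. k \<ge> 1}"
  then obtain k :: nat where "\<alpha> + 1 = - of_nat k" by blast
  then have "\<alpha> + 1 + of_nat k = 0" by (simp only: left_minus)
  then have "of_nat k + \<alpha> + 1 = 0" by (simp add: add_ac)
  then show False using regular_exponent_nonzero[OF assms] by blast
qed

lemma regular_exponent_nonpos_Ints:
  assumes "regular_exponent \<alpha>"
  shows "\<alpha> + 1 + of_nat j \<notin> \<int>\<^sub>\<le>\<^sub>0"
proof
  assume "\<alpha> + 1 + of_nat j \<in> \<int>\<^sub>\<le>\<^sub>0"
  then obtain k where "\<alpha> + 1 + of_nat j = - of_nat k" by (rule nonpos_Ints_cases')
  then have "\<alpha> + 1 + of_nat j + of_nat k = 0" by (simp only: left_minus)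
  then have "of_nat (j + k) + \<alpha> + 1 = 0" by (simp add: add_ac)
  then show False using regular_exponent_nonzero[OF assms] by blast
qed

lemma Gamma_regular_exponent:
  assumes "regular_exponent \<alpha>"
  shows "Gamma (\<alpha> + 1 + 1) = (\<alpha> + 1) * Gamma (\<alpha> + 1)"
  using regular_exponent_nonpos_Ints[OF assms, of 0] by (intro Gamma_plus1) auto

text \<open>The descent scheme: a property is established for large real part and pulled back from
  \<alpha> + 1 to \<alpha>. Regularity is preserved by adding 1, so every exponent met on the way is
  admissible.\<close>

lemma regular_exponent_induct [consumes 1, case_names base step]:
  assumes "regular_exponent \<alpha>"
    and base: "\<And>\<alpha>. regular_exponent \<alpha> \<Longrightarrow> r \<le> Re \<alpha> \<Longrightarrow> P \<alpha>"
    and step: "\<And>\<alpha>. regular_exponent \<alpha> \<Longrightarrow> P (\<alpha> + 1) \<Longrightarrow> P \<alpha>"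
  shows "P \<alpha>"
proof -
  obtain N :: nat where "r \<le> Re \<alpha> + of_nat N"
    using real_arch_simple[of "r - Re \<alpha>"] by (auto simp: algebra_simps)
  then show ?thesis using assms(1)
  proof (induction N arbitrary: \<alpha>)
    case 0
    then show ?case using base by simp
  next
    case (Suc N)
    then have "P (\<alpha> + 1)"
      by (intro Suc.IH regular_exponent_add_1) (auto simp: algebra_simps)
    then show ?case using step Suc.prems by blast
  qed
qed

definition gamma_density :: "complex \<Rightarrow> real \<Rightarrow> complex" where
  "gamma_density \<beta> t = (if t > 0 then of_real t powr \<beta> * exp (- of_real t) else 0)"

lemma norm_gamma_density:
  "norm (gamma_density \<beta> t) = (if t > 0 then t powr Re \<beta> * exp (- t) else 0)"
  by (simp add: gamma_density_def norm_mult norm_powr_real_powr)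

text \<open>The right side is the maximum of the left, attained at t = r; the estimate is ln s <= s
  - 1 at s = t/r. For r = 0 it reduces to exp(-t) <= 1.\<close>

lemma powr_mult_exp_le:
  fixes r t :: real
  assumes "r \<ge> 0" "t > 0"
  shows "t powr r * exp (- t) \<le> exp (r * ln r - r)"
proof (cases "r = 0")
  case False
  then have r: "r > 0" using assms by simp
  have "ln (t / r) \<le> t / r - 1" using r assms by (intro ln_le_minus_one) auto
  then have "r * (ln t - ln r) \<le> r * (t / r - 1)"
    using r assms by (intro mult_left_mono) (auto simp: ln_div)
  then have "r * ln t - t \<le> r * ln r - r" using r by (simp add: algebra_simps)
  then show ?thesis using assms by (simp add: powr_def flip: exp_add)
qed (use assms in simp)

lemma gamma_density_bounded:
  assumes "Re \<beta> \<ge> 0"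
  obtains C where "\<And>t. norm (gamma_density \<beta> t) \<le> C" "C > 0"
  using powr_mult_exp_le[OF assms] that[of "exp (Re \<beta> * ln (Re \<beta>) - Re \<beta>)"]
  by (auto simp: norm_gamma_density)

lemma measurable_gamma_density [measurable]: "gamma_density \<beta> \<in> borel_measurable borel"
proof -
  have "continuous_on {0<..} (\<lambda>t::real. of_real t powr \<beta> * exp (- of_real t))"
    by (intro continuous_intros) auto
  then have "(\<lambda>t. if t \<in> {0<..} then of_real t powr \<beta> * exp (- of_real t) else 0 :: complex) \<in> borel_measurable borel"
    by (intro borel_measurable_continuous_on_if) auto
  then show ?thesis by (simp add: gamma_density_def[abs_def])
qed

lemma
  assumes "Re \<beta> > - 1"
  shows integrable_gamma_density: "integrable lborel (gamma_density \<beta>)"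
    and integral_gamma_density: "(LINT t|lborel. gamma_density \<beta> t) = Gamma (\<beta> + 1)"
proof -
  have eq: "(if t \<in> {0<..} then of_real t powr (\<beta> + 1 - 1) / of_real (exp t) else 0) = gamma_density \<beta> t" for t
    by (simp add: gamma_density_def exp_minus field_simps exp_of_real)
  have pos: "Re (\<beta> + 1) > 0" using assms by simp
  have "(\<lambda>t. complex_of_real t powr (\<beta> + 1 - 1) / of_real (exp t)) absolutely_integrable_on {0<..}"
    using pos by (rule absolutely_integrable_Gamma_integral')
  then have "integrable lebesgue (\<lambda>t. indicator {0<..} t *\<^sub>R (complex_of_real t powr (\<beta> + 1 - 1) / of_real (exp t)))"
    unfolding set_integrable_def .
  also have "(\<lambda>t. indicator {0<..} t *\<^sub>R (complex_of_real t powr (\<beta> + 1 - 1) / of_real (exp t))) = gamma_density \<beta>"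
    by (auto simp: eq[symmetric] indicator_def)
  finally show int: "integrable lborel (gamma_density \<beta>)"
    by (simp add: integrable_completion)
  have "((\<lambda>t. of_real t powr (\<beta> + 1 - 1) / of_real (exp t)) has_integral Gamma (\<beta> + 1)) {0<..}"
    using pos by (rule Gamma_integral_complex')
  then have "(gamma_density \<beta> has_integral Gamma (\<beta> + 1)) UNIV"
    unfolding eq[symmetric] has_integral_restrict_UNIV .
  moreover have "(gamma_density \<beta> has_integral (LINT t|lborel. gamma_density \<beta> t)) UNIV"
    using int by (rule has_integral_integral_lborel)
  ultimately show "(LINT t|lborel. gamma_density \<beta> t) = Gamma (\<beta> + 1)"
    using has_integral_unique by blast
qed

lemma gamma_density_add_1: "gamma_density (\<beta> + 1) t = of_real t * gamma_density \<beta> t"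
  by (simp add: gamma_density_def powr_add)

lemma has_vector_derivative_gamma_density:
  assumes "t > 0"
  shows "(gamma_density \<beta> has_vector_derivative \<beta> * gamma_density (\<beta> - 1) t - gamma_density \<beta> t) (at t)"
proof -
  have "((\<lambda>z. z powr \<beta> * exp (- z)) has_field_derivative
      \<beta> * gamma_density (\<beta> - 1) t - gamma_density \<beta> t) (at (of_real t))"
    using assms by (auto intro!: derivative_eq_intros simp: gamma_density_def algebra_simps)
  from has_vector_derivative_real_field[OF this]
  have "((\<lambda>t. of_real t powr \<beta> * exp (- of_real t)) has_vector_derivative
      \<beta> * gamma_density (\<beta> - 1) t - gamma_density \<beta> t) (at t)" .
  then show ?thesis
    by (rule has_vector_derivative_transform_within_open[where S = "{0<..}"])
       (use assms in \<open>auto simp: gamma_density_def\<close>)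
qed

text \<open>The derivative \<beta> t^(\<beta>-1) exp(-t) - t^\<beta> exp(-t) is bounded because both
  exponents have nonnegative real part. Across the origin, the factor t in the density gives the
  bound directly.\<close>

lemma lipschitz_gamma_density:
  assumes "Re \<beta> \<ge> 1"
  shows "\<exists>M. lipschitz_density (gamma_density \<beta>) M"
proof -
  obtain C where C: "\<And>t. norm (gamma_density (\<beta> - 1) t) \<le> C" "C > 0"
    using gamma_density_bounded[of "\<beta> - 1"] assms by auto
  obtain D where D: "\<And>t. norm (gamma_density \<beta> t) \<le> D" "D > 0"
    using gamma_density_bounded[of \<beta>] assms by auto
  \<comment> \<open>The first two summands bound the derivative on the positive axis; the last one
    handles pairs of points on different sides of 0.\<close>
  define M where "M = norm \<beta> * C + D + C"
  have M: "norm \<beta> * C + D \<le> M" "C \<le> M" "M \<ge> 0" using C D by (auto simp: M_def)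
  have pos: "norm (gamma_density \<beta> s - gamma_density \<beta> t) \<le> M * norm (s - t)" if "s > 0" "t > 0" for s t
  proof (rule differentiable_bound[where S = "{0<..}"])
    fix x :: real assume "x \<in> {0<..}"
    then show "(gamma_density \<beta> has_derivative
        (\<lambda>h. h *\<^sub>R (\<beta> * gamma_density (\<beta> - 1) x - gamma_density \<beta> x))) (at x within {0<..})"
      using has_vector_derivative_gamma_density[of x \<beta>]
      by (auto simp: has_vector_derivative_def intro: has_derivative_at_withinI)
    have "norm (\<beta> * gamma_density (\<beta> - 1) x - gamma_density \<beta> x) \<le> norm \<beta> * C + D"
      using C(1)[of x] D(1)[of x]
      by (intro order_trans[OF norm_triangle_ineq4] add_mono) (auto simp: norm_mult mult_left_mono)
    also note M(1)
    finally show "onorm (\<lambda>h. h *\<^sub>R (\<beta> * gamma_density (\<beta> - 1) x - gamma_density \<beta> x)) \<le> M"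
      by (intro onorm_le) (simp add: mult.commute[of M] mult_left_mono)
  qed (use that in auto)
  have zero: "norm (gamma_density \<beta> t - gamma_density \<beta> s) \<le> M * norm (t - s)" if "s \<le> 0" "t > 0" for s t
  proof -
    have "norm (gamma_density \<beta> t) = t * norm (gamma_density (\<beta> - 1) t)"
      using that gamma_density_add_1[of "\<beta> - 1" t] by (simp add: norm_mult)
    also have "\<dots> \<le> t * C" using C(1)[of t] that by (intro mult_left_mono) auto
    also have "\<dots> \<le> (t - s) * M" using that M C by (intro mult_mono) auto
    finally show ?thesis using that by (simp add: gamma_density_def mult.commute)
  qed
  have "norm (gamma_density \<beta> s - gamma_density \<beta> t) \<le> M * \<bar>s - t\<bar>" for s t
  proof -
    consider "s > 0" "t > 0" | "s > 0" "t \<le> 0" | "s \<le> 0" "t > 0" | "s \<le> 0" "t \<le> 0" by linarith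
    then show ?thesis
    proof cases
      case 4
      then show ?thesis using M by (simp add: gamma_density_def)
    qed (use pos zero[of t s] zero[of s t] in \<open>auto simp: norm_minus_commute abs_minus_commute\<close>)
  qed
  then have "lipschitz_density (gamma_density \<beta>) M"
    using assms by unfold_locales (auto intro: integrable_gamma_density)
  then show ?thesis ..
qed

lemma integral_FTC_greaterThan:
  fixes F f :: "real \<Rightarrow> complex"
  assumes "\<And>t. t > a \<Longrightarrow> (F has_vector_derivative f t) (at t)"
    and "continuous_on {a<..} f" and "set_integrable lborel {a<..} f"
    and "(F \<longlongrightarrow> A) (at_right a)" and "(F \<longlongrightarrow> B) at_top"
  shows "(LINT t:{a<..}|lborel. f t) = B - A"
proof -
  have "(LBINT x=ereal a..\<infinity>. f x) = B - A"
  proof (rule interval_integral_FTC_integrable)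
    show "isCont f x" if "ereal a < ereal x" for x
      using that assms(2) by (simp add: continuous_on_eq_continuous_at)
    show "((F \<circ> real_of_ereal) \<longlongrightarrow> A) (at_right (ereal a))"
      using assms(4) by (simp add: ereal_tendsto_simps)
    show "((F \<circ> real_of_ereal) \<longlongrightarrow> B) (at_left \<infinity>)"
      using assms(5) by (simp add: ereal_tendsto_simps)
  qed (use assms in auto)
  then show ?thesis by (simp add: interval_integral_to_infinity_eq)
qed

section \<open>Finite parts\<close>

text \<open>One pairing serves two purposes: with constants \<open>c j\<close> it is a moment
  functional, and with \<open>c j\<close> the Stieltjes transform for the exponent \<alpha> + j it
  is the transform of a polynomial density.\<close>

definition coeff_pairing :: "(nat \<Rightarrow> complex) \<Rightarrow> complex poly \<Rightarrow> complex" where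
  "coeff_pairing c p = (\<Sum>j\<le>degree p. coeff p j * c j)"

lemma coeff_pairing_upto:
  assumes "degree p \<le> N"
  shows "coeff_pairing c p = (\<Sum>j\<le>N. coeff p j * c j)"
  unfolding coeff_pairing_def
  by (rule sum.mono_neutral_left) (use assms in \<open>auto simp: coeff_eq_0\<close>)

lemma coeff_pairing_0 [simp]: "coeff_pairing c 0 = 0"
  by (simp add: coeff_pairing_def)

lemma coeff_pairing_pCons: "coeff_pairing c (pCons a p) = a * c 0 + coeff_pairing (\<lambda>j. c (Suc j)) p"
proof -
  have "coeff_pairing c (pCons a p) = (\<Sum>j\<le>Suc (degree p). coeff (pCons a p) j * c j)"
    by (rule coeff_pairing_upto) (simp add: degree_pCons_le)
  then show ?thesis by (simp add: sum.atMost_Suc_shift coeff_pairing_def del: sum.atMost_Suc)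
qed

lemma coeff_pairing_add: "coeff_pairing c (p + q) = coeff_pairing c p + coeff_pairing c q"
  using coeff_pairing_upto[of p "max (degree p) (degree q)" c]
    coeff_pairing_upto[of q "max (degree p) (degree q)" c]
    coeff_pairing_upto[of "p + q" "max (degree p) (degree q)" c] degree_add_le_max[of p q]
  by (simp add: algebra_simps sum.distrib)

lemma coeff_pairing_smult: "coeff_pairing c (smult a p) = a * coeff_pairing c p"
  using coeff_pairing_upto[of "smult a p" "degree p" c] degree_smult_le[of a p]
  by (simp add: coeff_pairing_def sum_distrib_left mult.assoc)

text \<open>The finite part of t^\<alpha> p(t) exp(-t) over the half line, given by its moments;
  \<open>fp_split_poly_exp\<close> justifies this reading.\<close>

definition gamma_functional :: "complex \<Rightarrow> complex poly \<Rightarrow> complex" where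
  "gamma_functional \<alpha> = coeff_pairing (\<lambda>j. Gamma (\<alpha> + 1 + of_nat j))"

lemma gamma_functional_pCons:
  "gamma_functional \<alpha> (pCons a p) = a * Gamma (\<alpha> + 1) + gamma_functional (\<alpha> + 1) p"
  by (simp add: gamma_functional_def coeff_pairing_pCons add_ac)

lemma taylor_coeff_eq_fps_nth: "F has_fps_expansion A \<Longrightarrow> taylor_coeff F = fps_nth A"
  by (auto simp: taylor_coeff_def fps_nth_fps_expansion)

definition fp_series :: "complex \<Rightarrow> (nat \<Rightarrow> complex) \<Rightarrow> real \<Rightarrow> nat \<Rightarrow> complex" where
  "fp_series \<alpha> a \<xi> m = a m / (of_nat m + \<alpha> + 1) * of_real \<xi> powr (of_nat m + \<alpha> + 1)"

lemma fp_split_eq: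
  "fp_split \<alpha> F \<xi> = (\<Sum>m. fp_series \<alpha> (taylor_coeff F) \<xi> m) +
    (LINT t:{\<xi>..}|lborel. of_real t powr \<alpha> * F (of_real t))"
  by (simp add: fp_split_def fp_series_def)

text \<open>The factors 1 / (m + \<alpha> + 1) tend to 0, hence are eventually at most 1 in norm,
  and the terms compare with the absolutely convergent power series at \<xi>.\<close>

lemma summable_fp_series:
  assumes \<xi>: "\<xi> > 0" "ereal \<xi> < conv_radius a"
  shows "summable (fp_series \<alpha> a \<xi>)"
proof (rule summable_comparison_test_ev)
  have "filterlim (\<lambda>m. (\<alpha> + 1) + of_nat m) at_infinity sequentially"
    by (rule tendsto_add_filterlim_at_infinity[OF tendsto_const]) (rule tendsto_of_nat)
  then have "((\<lambda>m. inverse ((\<alpha> + 1) + of_nat m)) \<longlongrightarrow> 0) sequentially"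
    by (rule filterlim_compose[OF tendsto_inverse_0])
  from tendstoD[OF this zero_less_one]
  have "\<forall>\<^sub>F m in sequentially. norm (inverse ((\<alpha> + 1) + of_nat m)) < 1"
    by simp
  then show "\<forall>\<^sub>F m in sequentially. norm (fp_series \<alpha> a \<xi> m)
      \<le> norm (a m * of_real \<xi> ^ m) * norm (of_real \<xi> powr (\<alpha> + 1))"
  proof eventually_elim
    case (elim m)
    have "fp_series \<alpha> a \<xi> m = inverse ((\<alpha> + 1) + of_nat m) * (a m * of_real \<xi> ^ m * of_real \<xi> powr (\<alpha> + 1))"
      using \<xi> by (simp add: fp_series_def powr_add powr_nat' field_simps)
    then have "norm (fp_series \<alpha> a \<xi> m) = norm (inverse ((\<alpha> + 1) + of_nat m)) * norm (a m * of_real \<xi> ^ m * of_real \<xi> powr (\<alpha> + 1))"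
      by (simp only: norm_mult)
    also have "\<dots> \<le> 1 * norm (a m * of_real \<xi> ^ m * of_real \<xi> powr (\<alpha> + 1))"
      using elim by (intro mult_right_mono) auto
    finally show ?case by (simp add: norm_mult)
  qed
  have "summable (\<lambda>m. norm (a m * of_real \<xi> ^ m))"
    using \<xi> by (intro abs_summable_in_conv_radius) simp
  then show "summable (\<lambda>m. norm (a m * of_real \<xi> ^ m) * norm (of_real \<xi> powr (\<alpha> + 1)))"
    by (rule summable_mult2)
qed

text \<open>Convergence is phrased through a formal power series rather than through
  \<open>taylor_coeff\<close>, so that sums and products of expansions yield admissibility of sums
  and products.\<close>

definition fp_admissible :: "complex \<Rightarrow> (complex \<Rightarrow> complex) \<Rightarrow> real \<Rightarrow> bool" where
  "fp_admissible \<alpha> F \<xi> \<longleftrightarrow> \<xi> > 0 \<and> (\<exists>A. F has_fps_expansion A \<and> ereal \<xi> < fps_conv_radius A) \<and>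
    set_integrable lborel {\<xi>..} (\<lambda>t. of_real t powr \<alpha> * F (of_real t))"

lemma fp_admissible_lin:
  assumes "fp_admissible \<alpha> F \<xi>" "fp_admissible \<alpha> G \<xi>"
  shows "fp_admissible \<alpha> (\<lambda>t. a * F t + b * G t) \<xi>"
    and "fp_split \<alpha> (\<lambda>t. a * F t + b * G t) \<xi> = a * fp_split \<alpha> F \<xi> + b * fp_split \<alpha> G \<xi>"
proof -
  obtain A B where A: "F has_fps_expansion A" "ereal \<xi> < fps_conv_radius A"
    and B: "G has_fps_expansion B" "ereal \<xi> < fps_conv_radius B"
    using assms by (auto simp: fp_admissible_def)
  have \<xi>: "\<xi> > 0" using assms by (simp add: fp_admissible_def)
  let ?C = "fps_const a * A + fps_const b * B"
  have C: "(\<lambda>t. a * F t + b * G t) has_fps_expansion ?C"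
    by (intro fps_expansion_intros A B)
  have "ereal \<xi> < min (fps_conv_radius (fps_const a * A)) (fps_conv_radius (fps_const b * B))"
    using A B by (cases "a = 0"; cases "b = 0") (auto simp: fps_conv_radius_cmult_left)
  also have "\<dots> \<le> fps_conv_radius ?C" by (rule fps_conv_radius_add)
  finally have rad: "ereal \<xi> < fps_conv_radius ?C" .
  have i: "set_integrable lborel {\<xi>..} (\<lambda>t. a * (of_real t powr \<alpha> * F (of_real t)))"
    "set_integrable lborel {\<xi>..} (\<lambda>t. b * (of_real t powr \<alpha> * G (of_real t)))"
    using assms by (auto simp: fp_admissible_def)
  have eq: "of_real t powr \<alpha> * (a * F (of_real t) + b * G (of_real t)) =
      a * (of_real t powr \<alpha> * F (of_real t)) + b * (of_real t powr \<alpha> * G (of_real t))" for t :: real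
    by (simp add: algebra_simps)
  show "fp_admissible \<alpha> (\<lambda>t. a * F t + b * G t) \<xi>"
    unfolding fp_admissible_def eq using \<xi> C rad set_integral_add(1)[OF i] by blast
  have s: "summable (fp_series \<alpha> (fps_nth A) \<xi>)" "summable (fp_series \<alpha> (fps_nth B) \<xi>)"
    using A B \<xi> by (auto intro!: summable_fp_series simp: fps_conv_radius_def)
  have "fp_series \<alpha> (fps_nth ?C) \<xi> m = a * fp_series \<alpha> (fps_nth A) \<xi> m + b * fp_series \<alpha> (fps_nth B) \<xi> m" for m
    by (simp add: fp_series_def algebra_simps add_divide_distrib)
  then have "(\<Sum>m. fp_series \<alpha> (fps_nth ?C) \<xi> m) =
      a * (\<Sum>m. fp_series \<alpha> (fps_nth A) \<xi> m) + b * (\<Sum>m. fp_series \<alpha> (fps_nth B) \<xi> m)"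
    using s by (simp add: suminf_mult summable_mult flip: suminf_add)
  moreover have "(LINT t:{\<xi>..}|lborel. a * (of_real t powr \<alpha> * F (of_real t)) + b * (of_real t powr \<alpha> * G (of_real t))) =
      a * (LINT t:{\<xi>..}|lborel. of_real t powr \<alpha> * F (of_real t)) + b * (LINT t:{\<xi>..}|lborel. of_real t powr \<alpha> * G (of_real t))"
    using set_integral_add(2)[OF i] by simp
  ultimately show "fp_split \<alpha> (\<lambda>t. a * F t + b * G t) \<xi> = a * fp_split \<alpha> F \<xi> + b * fp_split \<alpha> G \<xi>"
    unfolding fp_split_eq eq taylor_coeff_eq_fps_nth[OF A(1)] taylor_coeff_eq_fps_nth[OF B(1)] taylor_coeff_eq_fps_nth[OF C]
    by (simp add: algebra_simps)
qed

text \<open>A factor t moves from the function into the weight. Coefficient m of F becomes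
  coefficient m + 1, and (m + 1) + \<alpha> + 1 = m + (\<alpha> + 1) + 1, so the series agree term
  by term after the vanishing zeroth term.\<close>

lemma fp_admissible_mult_X:
  assumes "fp_admissible (\<alpha> + 1) F \<xi>"
  shows "fp_admissible \<alpha> (\<lambda>t. t * F t) \<xi>"
    and "fp_split \<alpha> (\<lambda>t. t * F t) \<xi> = fp_split (\<alpha> + 1) F \<xi>"
proof -
  obtain A where A: "F has_fps_expansion A" "ereal \<xi> < fps_conv_radius A"
    using assms by (auto simp: fp_admissible_def)
  have \<xi>: "\<xi> > 0" using assms by (simp add: fp_admissible_def)
  have C: "(\<lambda>t. t * F t) has_fps_expansion fps_X * A"
    by (intro fps_expansion_intros A)
  have "ereal \<xi> < min (fps_conv_radius (fps_X :: complex fps)) (fps_conv_radius A)" using A by simp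
  also have "\<dots> \<le> fps_conv_radius (fps_X * A)" by (rule fps_conv_radius_mult)
  finally have rad: "ereal \<xi> < fps_conv_radius (fps_X * A)" .
  have eq: "of_real t powr \<alpha> * (of_real t * F (of_real t)) = of_real t powr (\<alpha> + 1) * F (of_real t)"
    if "t \<in> {\<xi>..}" for t :: real
    using that \<xi> by (simp add: powr_add)
  have int: "set_integrable lborel {\<xi>..} (\<lambda>t. of_real t powr \<alpha> * (of_real t * F (of_real t)))
      \<longleftrightarrow> set_integrable lborel {\<xi>..} (\<lambda>t. of_real t powr (\<alpha> + 1) * F (of_real t))"
    by (intro set_integrable_cong) (use eq in auto)
  show "fp_admissible \<alpha> (\<lambda>t. t * F t) \<xi>"
    using \<xi> C rad assms int by (auto simp: fp_admissible_def)
  have "summable (fp_series \<alpha> (fps_nth (fps_X * A)) \<xi>)"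
    using \<xi> rad by (intro summable_fp_series) (auto simp: fps_conv_radius_def)
  from suminf_split_head[OF this]
  have "(\<Sum>m. fp_series \<alpha> (fps_nth (fps_X * A)) \<xi> m) =
      (\<Sum>m. fp_series \<alpha> (fps_nth (fps_X * A)) \<xi> (Suc m)) + fp_series \<alpha> (fps_nth (fps_X * A)) \<xi> 0"
    by simp
  also have "fp_series \<alpha> (fps_nth (fps_X * A)) \<xi> 0 = 0" by (simp add: fp_series_def)
  finally have "(\<Sum>m. fp_series \<alpha> (fps_nth (fps_X * A)) \<xi> m) = (\<Sum>m. fp_series \<alpha> (fps_nth (fps_X * A)) \<xi> (Suc m))"
    by (simp only: add_0_right)
  also have "\<dots> = (\<Sum>m. fp_series (\<alpha> + 1) (fps_nth A) \<xi> m)"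
    by (simp add: fp_series_def add_ac)
  finally have series: "(\<Sum>m. fp_series \<alpha> (fps_nth (fps_X * A)) \<xi> m) = (\<Sum>m. fp_series (\<alpha> + 1) (fps_nth A) \<xi> m)" .
  have tail: "(LINT t:{\<xi>..}|lborel. of_real t powr \<alpha> * (of_real t * F (of_real t))) =
      (LINT t:{\<xi>..}|lborel. of_real t powr (\<alpha> + 1) * F (of_real t))"
    by (intro set_lebesgue_integral_cong) (use eq in auto)
  show "fp_split \<alpha> (\<lambda>t. t * F t) \<xi> = fp_split (\<alpha> + 1) F \<xi>"
    unfolding fp_split_eq taylor_coeff_eq_fps_nth[OF A(1)] taylor_coeff_eq_fps_nth[OF C]
    using series tail by simp
qed

text \<open>The split value sees F only through its germ at 0 and its values from \<xi> on. An
  exceptional point such as t = z, where division by zero yields a meaningless value, may be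
  ignored.\<close>

lemma fp_split_cong:
  assumes "\<forall>\<^sub>F t in nhds 0. F t = G t" and "\<And>t. t \<ge> \<xi> \<Longrightarrow> F (of_real t) = G (of_real t)"
  shows "fp_split \<alpha> F \<xi> = fp_split \<alpha> G \<xi>"
proof -
  have "taylor_coeff F = taylor_coeff G"
    using higher_deriv_cong_ev[OF assms(1) refl] by (auto simp: taylor_coeff_def)
  then show ?thesis
    unfolding fp_split_eq using assms(2) by (simp add: set_lebesgue_integral_def cong: if_cong)
       (intro Bochner_Integration.integral_cong refl, auto simp: indicator_def)
qed

text \<open>Each term is the integral of coefficient m times t^(m+\<alpha>) over [0, \<xi>], since
  the primitive vanishes at 0. Domination by |A_m| \<xi>^m \<xi>^(Re \<alpha>) permits the
  interchange of sum and integral.\<close>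

lemma fp_series_sums_integral:
  assumes \<alpha>: "Re \<alpha> \<ge> 1" and \<xi>: "\<xi> > 0" "ereal \<xi> < fps_conv_radius A"
  shows "(\<Sum>m. fp_series \<alpha> (fps_nth A) \<xi> m) = (LINT t:{0..\<xi>}|lborel. of_real t powr \<alpha> * eval_fps A (of_real t))"
    and "set_integrable lborel {0..\<xi>} (\<lambda>t. of_real t powr \<alpha> * eval_fps A (of_real t))"
proof -
  define u where "u m t = indicator {0..\<xi>} t *\<^sub>R (fps_nth A m * of_real t powr (of_nat m + \<alpha>))" for m t
  have cont: "continuous_on {0..\<xi>} (\<lambda>t. fps_nth A m * of_real t powr (of_nat m + \<alpha>))" for m
    using \<alpha> by (intro continuous_intros) auto
  have int: "integrable lborel (u m)" for m
    using borel_integrable_atLeastAtMost'[OF cont] unfolding u_def set_integrable_def .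
  have val: "integral\<^sup>L lborel (u m) = fp_series \<alpha> (fps_nth A) \<xi> m" for m
  proof -
    define G where "G t = fps_nth A m / (of_nat m + \<alpha> + 1) * of_real t powr (of_nat m + \<alpha> + 1)" for t :: real
    have nz: "of_nat m + \<alpha> + 1 \<noteq> 0" using \<alpha> by (auto simp: complex_eq_iff)
    have "((\<lambda>t. fps_nth A m * of_real t powr (of_nat m + \<alpha>)) has_integral (G \<xi> - G 0)) {0..\<xi>}"
    proof (rule fundamental_theorem_of_calculus_interior)
      show "continuous_on {0..\<xi>} G"
        unfolding G_def using \<alpha> by (intro continuous_intros) auto
      fix t assume t: "t \<in> {0<..<\<xi>}"
      have "((\<lambda>z. fps_nth A m / (of_nat m + \<alpha> + 1) * z powr (of_nat m + \<alpha> + 1)) has_field_derivative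
          fps_nth A m / (of_nat m + \<alpha> + 1) * ((of_nat m + \<alpha> + 1) * of_real t powr (of_nat m + \<alpha>))) (at (of_real t))"
        using t by (auto intro!: derivative_eq_intros)
      from has_vector_derivative_real_field[OF this]
      show "(G has_vector_derivative fps_nth A m * of_real t powr (of_nat m + \<alpha>)) (at t)"
        using nz by (simp add: G_def[abs_def])
    qed (use \<xi> in auto)
    moreover have "set_integrable lborel {0..\<xi>} (\<lambda>t. fps_nth A m * of_real t powr (of_nat m + \<alpha>))"
      by (rule borel_integrable_atLeastAtMost'[OF cont])
    ultimately have "(LINT t:{0..\<xi>}|lborel. fps_nth A m * of_real t powr (of_nat m + \<alpha>)) = G \<xi> - G 0"
      by (metis set_borel_integral_eq_integral(2) integral_unique)
    then have "integral\<^sup>L lborel (u m) = G \<xi> - G 0"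
      by (simp only: u_def[abs_def] set_lebesgue_integral_def)
    then show ?thesis using nz by (simp add: G_def fp_series_def)
  qed
  have summ: "summable (\<lambda>m. norm (fps_nth A m) * \<xi> ^ m)"
    using abs_summable_in_conv_radius[of "complex_of_real \<xi>" "fps_nth A"] \<xi>
    by (simp add: fps_conv_radius_def norm_mult norm_power)
  have bound: "norm (u m t) \<le> norm (fps_nth A m) * \<xi> ^ m * (indicator {0..\<xi>} t * \<xi> powr Re \<alpha>)" for m t
  proof (cases "t \<in> {0<..\<xi>}")
    case True
    then have "norm (u m t) = norm (fps_nth A m) * (t ^ m * t powr Re \<alpha>)"
      by (simp add: u_def norm_mult norm_power norm_powr_real_powr powr_add powr_nat')
    also have "\<dots> \<le> norm (fps_nth A m) * (\<xi> ^ m * \<xi> powr Re \<alpha>)"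
      using True \<alpha> by (intro mult_left_mono mult_mono power_mono powr_mono2) auto
    finally show ?thesis using True by (simp add: mult_ac)
  next
    case False
    then have "u m t = 0" using \<alpha> by (cases "t = 0") (auto simp: u_def)
    then show ?thesis using \<xi> by simp
  qed
  have s1: "AE t in lborel. summable (\<lambda>m. norm (u m t))"
    using bound by (intro AE_I2 summable_comparison_test'[OF summable_mult2[OF summ]]) auto
  have s2: "summable (\<lambda>m. LINT t|lborel. norm (u m t))"
  proof (rule summable_comparison_test')
    show "summable (\<lambda>m. norm (fps_nth A m) * \<xi> ^ m * (\<xi> * \<xi> powr Re \<alpha>))"
      by (rule summable_mult2[OF summ])
    fix m :: nat
    have "integrable lborel (indicator {0..\<xi>} :: real \<Rightarrow> real)"
      using \<xi> by (intro integrable_real_indicator) auto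
    then have "norm (LINT t|lborel. norm (u m t)) \<le> (LINT t|lborel. norm (fps_nth A m) * \<xi> ^ m * (indicator {0..\<xi>} t * \<xi> powr Re \<alpha>))"
      by (intro Bochner_Integration.integral_norm_bound_integral integrable_norm int
          integrable_mult_right integrable_mult_left) (use bound[of m] in auto)
    then show "norm (LINT t|lborel. norm (u m t)) \<le> norm (fps_nth A m) * \<xi> ^ m * (\<xi> * \<xi> powr Re \<alpha>)"
      using \<xi> by simp
  qed
  have sum_u: "(\<Sum>m. u m t) = indicator {0..\<xi>} t *\<^sub>R (of_real t powr \<alpha> * eval_fps A (of_real t))" for t
  proof (cases "t \<in> {0<..\<xi>}")
    case True
    have "ereal (norm (complex_of_real t)) \<le> ereal \<xi>" using True by simp
    also note \<xi>(2)
    finally have "summable (\<lambda>m. fps_nth A m * of_real t ^ m)"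
      unfolding fps_conv_radius_def by (rule summable_in_conv_radius)
    then have "(\<Sum>m. of_real t powr \<alpha> * (fps_nth A m * of_real t ^ m)) = of_real t powr \<alpha> * eval_fps A (of_real t)"
      unfolding eval_fps_def by (rule suminf_mult)
    moreover have "u m t = of_real t powr \<alpha> * (fps_nth A m * of_real t ^ m)" for m
      using True by (simp add: u_def powr_add powr_nat')
    ultimately show ?thesis using True by simp
  next
    case False
    then have "u m t = 0" for m using \<alpha> by (cases "t = 0") (auto simp: u_def)
    moreover have "of_real t powr \<alpha> = (0::complex)" if "t = 0" using that by simp
    ultimately show ?thesis using False by (cases "t = 0") auto
  qed
  show "set_integrable lborel {0..\<xi>} (\<lambda>t. of_real t powr \<alpha> * eval_fps A (of_real t))"
    using integrable_suminf[OF int s1 s2] unfolding sum_u set_integrable_def .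
  show "(\<Sum>m. fp_series \<alpha> (fps_nth A) \<xi> m) = (LINT t:{0..\<xi>}|lborel. of_real t powr \<alpha> * eval_fps A (of_real t))"
    using integral_suminf[OF int s1 s2] unfolding sum_u val set_lebesgue_integral_def by simp
qed

text \<open>An expansion determines F only near 0. Holomorphy on a disc of radius r > \<xi> makes
  the series equal F on all of [0, \<xi>], so that the two halves join to one ordinary
  integral.\<close>

lemma fp_split_convergent:
  assumes \<alpha>: "Re \<alpha> \<ge> 1" and ok: "fp_admissible \<alpha> F \<xi>"
    and hol: "F holomorphic_on eball 0 r" and r: "ereal \<xi> < r"
  shows "fp_split \<alpha> F \<xi> = (LINT t:{0..}|lborel. of_real t powr \<alpha> * F (of_real t))"
proof -
  obtain A where A: "F has_fps_expansion A" "ereal \<xi> < fps_conv_radius A"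
    using ok by (auto simp: fp_admissible_def)
  have \<xi>: "\<xi> > 0" and int: "set_integrable lborel {\<xi>..} (\<lambda>t. of_real t powr \<alpha> * F (of_real t))"
    using ok by (auto simp: fp_admissible_def)
  have eq: "F (of_real t) = eval_fps A (of_real t)" if "t \<in> {0..\<xi>}" for t :: real
  proof -
    have "ereal (norm (complex_of_real t)) \<le> ereal \<xi>" using that by simp
    also note r
    finally have "complex_of_real t \<in> eball 0 r" by simp
    then show ?thesis
      using eval_fps_expansion[OF hol, of "of_real t"] fps_expansion_eqI[OF A(1)] by simp
  qed
  note ser = fp_series_sums_integral[OF \<alpha> \<xi> A(2)]
  have 1: "(LINT t:{0..\<xi>}|lborel. of_real t powr \<alpha> * eval_fps A (of_real t)) = (LINT t:{0..\<xi>}|lborel. of_real t powr \<alpha> * F (of_real t))"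
    using eq by (intro set_lebesgue_integral_cong) auto
  have int0: "set_integrable lborel {0..\<xi>} (\<lambda>t. of_real t powr \<alpha> * F (of_real t))"
    using ser(2) by (rule set_integrable_cong[THEN iffD1, rotated -1]) (use eq in auto)
  have "AE t in lborel. t \<noteq> \<xi>" using AE_lborel_singleton .
  then have "AE t in lborel. \<not> (t \<in> {0..\<xi>} \<and> t \<in> {\<xi>..})" by eventually_elim auto
  from set_integral_Un_AE[OF this _ _ int0 int]
  have "(LINT t:{0..\<xi>} \<union> {\<xi>..}|lborel. of_real t powr \<alpha> * F (of_real t)) = fp_split \<alpha> F \<xi>"
    unfolding fp_split_eq taylor_coeff_eq_fps_nth[OF A(1)] ser(1) 1 by simp
  moreover have "{0..\<xi>} \<union> {\<xi>..} = {0..}" using \<xi> by auto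
  ultimately show ?thesis by simp
qed


text \<open>On the tail t^N / \<xi>^N >= 1, so the exponent may be raised by N until a Gamma density
  with nonnegative real exponent dominates.\<close>

lemma set_integrable_gamma_tail:
  fixes h :: "real \<Rightarrow> complex"
  assumes \<xi>: "\<xi> > 0" and h: "continuous_on {\<xi>..} h" "\<And>t. t \<ge> \<xi> \<Longrightarrow> norm (h t) \<le> C"
  shows "set_integrable lborel {\<xi>..} (\<lambda>t. of_real t powr \<alpha> * (exp (- of_real t) * h t))"
  unfolding set_integrable_def
proof -
  let ?f = "\<lambda>t. of_real t powr \<alpha> * (exp (- of_real t) * h t)"
  obtain N :: nat where "- Re \<alpha> \<le> of_nat N" using real_arch_simple by blast
  then have N: "0 \<le> Re \<alpha> + of_nat N" by simp
  show "integrable lborel (\<lambda>t. indicator {\<xi>..} t *\<^sub>R ?f t)"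
  proof (rule Bochner_Integration.integrable_bound)
    show "integrable lborel (\<lambda>t. norm (gamma_density (\<alpha> + of_nat N) t) * (C / \<xi> ^ N))"
      using N by (intro integrable_mult_left integrable_norm integrable_gamma_density) auto
    have "continuous_on {\<xi>..} ?f"
      using \<xi> by (intro continuous_intros h) auto
    then show "(\<lambda>t. indicator {\<xi>..} t *\<^sub>R ?f t) \<in> borel_measurable lborel"
      using borel_measurable_continuous_on_indicator[of "{\<xi>..}"] by simp
    have bound: "norm (?f t) \<le> norm (gamma_density (\<alpha> + of_nat N) t) * (C / \<xi> ^ N)"
      if t: "t \<ge> \<xi>" for t
    proof -
      have "C \<ge> 0" using h(2)[OF t] norm_ge_zero order_trans by blast
      have "norm (?f t) = t powr Re \<alpha> * exp (- t) * norm (h t)"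
        using t \<xi> by (simp add: norm_mult norm_powr_real_powr)
      also have "\<dots> \<le> t powr Re \<alpha> * exp (- t) * (C * (t ^ N / \<xi> ^ N))"
      proof -
        have "norm (h t) * 1 \<le> C * (t ^ N / \<xi> ^ N)"
          using t \<xi> \<open>C \<ge> 0\<close> by (intro mult_mono h) (auto simp: power_mono)
        then show ?thesis by (intro mult_left_mono) auto
      qed
      also have "\<dots> = norm (gamma_density (\<alpha> + of_nat N) t) * (C / \<xi> ^ N)"
        using t \<xi> by (simp add: norm_gamma_density powr_add powr_realpow)
      finally show ?thesis .
    qed
    have "norm (indicator {\<xi>..} t *\<^sub>R (?f t)) \<le>
        norm (norm (gamma_density (\<alpha> + of_nat N) t) * (C / \<xi> ^ N))" for t
      using order_trans[OF bound[of t] abs_ge_self] by (cases "t \<ge> \<xi>") auto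
    then show "AE t in lborel. norm (indicator {\<xi>..} t *\<^sub>R (?f t)) \<le>
        norm (norm (gamma_density (\<alpha> + of_nat N) t) * (C / \<xi> ^ N))" by simp
  qed
qed

lemma fp_admissible_exp:
  assumes "\<xi> > 0"
  shows "fp_admissible \<alpha> (\<lambda>t. exp (- t)) \<xi>"
  using assms set_integrable_gamma_tail[OF assms continuous_on_const, of 1 1 \<alpha>]
    has_fps_expansion_exp[of "- 1 :: complex"]
  by (auto simp: fp_admissible_def intro!: exI[of _ "fps_exp (-1)"])

text \<open>
  The Gamma recurrence for the finite part: \<open>t powr \<alpha> * ((\<alpha> + 1) - t) * exp (- t)\<close> is the derivative of
  \<open>t powr (\<alpha> + 1) * exp (- t)\<close>, so its finite part vanishes.
\<close>

lemma fp_split_exp_derivative: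
  assumes \<alpha>: "regular_exponent \<alpha>" and \<xi>: "\<xi> > 0"
  shows "fp_split \<alpha> (\<lambda>t. (\<alpha> + 1) * exp (- t) + (- 1) * (t * exp (- t))) \<xi> = 0"
proof -
  let ?A = "fps_const (\<alpha> + 1) * fps_exp (- 1) + fps_const (- 1) * (fps_X * fps_exp (- 1)) :: complex fps"
  let ?F = "\<lambda>t. (\<alpha> + 1) * exp (- t) + (- 1) * (t * exp (- t))"
  let ?V = "of_real \<xi> powr (\<alpha> + 1) * exp (- of_real \<xi>)"
  have "(\<lambda>t. (\<alpha> + 1) * exp ((- 1) * t) + (- 1) * (t * exp ((- 1) * t))) has_fps_expansion ?A"
    by (intro fps_expansion_intros)
  then have A: "?F has_fps_expansion ?A" by simp
  \<comment> \<open>The factor m + \<alpha> + 1 cancels the denominator in the finite part. The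
    Taylor half is then an exponential series with sum \<open>?V\<close>, and the tail contributes
    minus \<open>?V\<close>.\<close>
  have coef: "fps_nth ?A m = (of_nat m + \<alpha> + 1) * ((- 1) ^ m / fact m)" for m
  proof (cases m)
    case (Suc n)
    have e: "(- 1) ^ n / fact n = - of_nat (Suc n) * ((- 1) ^ Suc n / fact (Suc n) :: complex)"
      by (simp only: fact_Suc power_Suc) (simp del: of_nat_Suc)
    define E where "E = (- 1) ^ Suc n / (fact (Suc n) :: complex)"
    have "fps_nth ?A (Suc n) = (\<alpha> + 1) * E - (- 1) ^ n / fact n"
      by (simp add: E_def del: fact_Suc power_Suc)
    also have "\<dots> = (of_nat (Suc n) + \<alpha> + 1) * E"
      unfolding e E_def[symmetric] by (simp add: algebra_simps)
    finally show ?thesis unfolding Suc E_def .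
  qed simp
  have "fp_series \<alpha> (fps_nth ?A) \<xi> m = of_real \<xi> powr (\<alpha> + 1) * ((- of_real \<xi>) ^ m /\<^sub>R fact m)" for m
  proof -
    have "(of_nat m + \<alpha> + 1) * ((- 1) ^ m / fact m) / (of_nat m + \<alpha> + 1) = (- 1) ^ m / fact m"
      using regular_exponent_nonzero[OF \<alpha>, of m] by simp
    moreover have "of_real \<xi> powr (of_nat m + \<alpha> + 1) = of_real \<xi> ^ m * (of_real \<xi> powr (\<alpha> + 1) :: complex)"
      unfolding add.assoc powr_add[of _ "of_nat m"] using \<xi> by (simp add: powr_nat')
    moreover have "(- of_real \<xi>) ^ m = (- 1) ^ m * (of_real \<xi> ^ m :: complex)"
      by (rule power_minus)
    ultimately show ?thesis
      unfolding fp_series_def coef by (simp add: scaleR_conv_of_real divide_inverse mult_ac)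
  qed
  moreover have "(\<lambda>m. of_real \<xi> powr (\<alpha> + 1) * ((- of_real \<xi>) ^ m /\<^sub>R fact m)) sums ?V"
    by (intro sums_mult exp_converges)
  ultimately have ser: "(\<Sum>m. fp_series \<alpha> (fps_nth ?A) \<xi> m) = ?V"
    by (simp add: sums_iff)
  have ok: "fp_admissible \<alpha> ?F \<xi>"
    using \<xi> by (intro fp_admissible_lin fp_admissible_mult_X fp_admissible_exp)
  define f where "f = (\<lambda>t::real. of_real t powr \<alpha> * ?F (of_real t))"
  have eq: "(LINT t:{\<xi><..}|lborel. f t) = (LINT t:{\<xi>..}|lborel. f t)"
  proof (rule set_integral_cong_set)
    have i: "set_integrable lborel {\<xi>..} f" using ok unfolding fp_admissible_def f_def by blast
    then show "set_borel_measurable lborel {\<xi>..} f"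
      by (simp add: set_integrable_def set_borel_measurable_def)
    have "set_integrable lborel {\<xi><..} f" by (rule set_integrable_subset[OF i]) auto
    then show "set_borel_measurable lborel {\<xi><..} f"
      by (simp add: set_integrable_def set_borel_measurable_def)
    show "AE t in lborel. (t \<in> {\<xi>..}) = (t \<in> {\<xi><..})"
      using AE_lborel_singleton[of \<xi>] by eventually_elim auto
  qed
  have "(LINT t:{\<xi><..}|lborel. f t) = 0 - ?V"
  proof (rule integral_FTC_greaterThan)
    let ?G = "\<lambda>t::real. of_real t powr (\<alpha> + 1) * exp (- of_real t) :: complex"
    fix t assume "t > \<xi>"
    then have t: "t > 0" using \<xi> by simp
    have e: "of_real t powr (\<alpha> + 1) = of_real t powr \<alpha> * (of_real t :: complex)"
      using t by (simp add: powr_add)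
    have "((\<lambda>z. z powr (\<alpha> + 1) * exp (- z)) has_field_derivative f t) (at (of_real t))"
      using t by (auto intro!: derivative_eq_intros simp: f_def e ring_distribs mult_ac)
    from has_vector_derivative_real_field[OF this]
    show "(?G has_vector_derivative f t) (at t)" .
  next
    show "continuous_on {\<xi><..} f"
      unfolding f_def using \<xi> by (intro continuous_intros) auto
    have i: "set_integrable lborel {\<xi>..} f" using ok unfolding fp_admissible_def f_def by blast
    then show "set_integrable lborel {\<xi><..} f" by (rule set_integrable_subset) auto
    have "isCont (\<lambda>t::real. of_real t powr (\<alpha> + 1) * exp (- of_real t) :: complex) \<xi>"
      using \<xi> by (intro continuous_intros) auto
    then show "((\<lambda>t::real. of_real t powr (\<alpha> + 1) * exp (- of_real t) :: complex) \<longlongrightarrow> ?V) (at_right \<xi>)"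
      by (simp add: isCont_def filterlim_at_split)
    have "((\<lambda>t::real. t powr (Re \<alpha> + 1) * exp (- t)) \<longlongrightarrow> 0) at_top"
      by real_asymp
    then have "((\<lambda>t::real. norm (of_real t powr (\<alpha> + 1) * exp (- of_real t) :: complex)) \<longlongrightarrow> 0) at_top"
      by (rule Lim_transform_eventually)
         (use eventually_gt_at_top[of 0] in eventually_elim, simp add: norm_mult norm_powr_real_powr)
    then show "((\<lambda>t::real. of_real t powr (\<alpha> + 1) * exp (- of_real t) :: complex) \<longlongrightarrow> 0) at_top"
      by (rule tendsto_norm_zero_cancel)
  qed
  then show ?thesis
    unfolding fp_split_eq taylor_coeff_eq_fps_nth[OF A] ser f_def[symmetric] by (simp add: eq)
qed

text \<open>The finite part reproduces the analytic continuation of Euler's integral: the base case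
  is that integral, and the step divides the recurrence by \<alpha> + 1, which is nonzero for a
  regular exponent.\<close>

lemma fp_split_exp:
  assumes "regular_exponent \<alpha>" and \<xi>: "\<xi> > 0"
  shows "fp_split \<alpha> (\<lambda>t. exp (- t)) \<xi> = Gamma (\<alpha> + 1)"
  using assms(1)
proof (induction \<alpha> rule: regular_exponent_induct[where r = 1])
  case (base \<alpha>)
  have "fp_split \<alpha> (\<lambda>t. exp (- t)) \<xi> = (LINT t:{0..}|lborel. of_real t powr \<alpha> * exp (- of_real t))"
    using base \<xi> by (intro fp_split_convergent[where r = \<infinity>] fp_admissible_exp) (auto intro!: holomorphic_intros)
  also have "\<dots> = (LINT t|lborel. gamma_density \<alpha> t)"
    unfolding set_lebesgue_integral_def
    by (intro Bochner_Integration.integral_cong refl) (auto simp: gamma_density_def indicator_def)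
  finally show ?case using base by (simp add: integral_gamma_density)
next
  case (step \<alpha>)
  have "(\<alpha> + 1) * fp_split \<alpha> (\<lambda>t. exp (- t)) \<xi> + (- 1) * fp_split (\<alpha> + 1) (\<lambda>t. exp (- t)) \<xi> = 0"
    using fp_split_exp_derivative[OF step(1) \<xi>] \<xi>
    by (simp only: fp_admissible_lin(2) fp_admissible_mult_X fp_admissible_exp)
  then have "(\<alpha> + 1) * fp_split \<alpha> (\<lambda>t. exp (- t)) \<xi> = (\<alpha> + 1) * Gamma (\<alpha> + 1)"
    using step Gamma_regular_exponent[OF step(1)] by simp
  moreover have "\<alpha> + 1 \<noteq> 0" using regular_exponent_nonzero[OF step(1), of 0] by simp
  ultimately show ?case by simp
qed

lemma fp_split_poly_exp:
  assumes "regular_exponent \<alpha>" and \<xi>: "\<xi> > 0"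
  shows "fp_admissible \<alpha> (\<lambda>t. poly q t * exp (- t)) \<xi> \<and>
    fp_split \<alpha> (\<lambda>t. poly q t * exp (- t)) \<xi> = gamma_functional \<alpha> q"
  using assms(1)
proof (induction q arbitrary: \<alpha>)
  case 0
  \<comment> \<open>The zero function is written as a two-term combination to bring it under
    \<open>fp_admissible_lin\<close>.\<close>
  have eq: "(\<lambda>t. poly 0 t * exp (- t)) = (\<lambda>t::complex. 0 * exp (- t) + 0 * exp (- t))" by auto
  show ?case
    unfolding eq using fp_admissible_lin[OF fp_admissible_exp[OF \<xi>] fp_admissible_exp[OF \<xi>], of \<alpha> 0 0]
    by (simp add: gamma_functional_def)
next
  case (pCons a q)
  have eq: "(\<lambda>t. poly (pCons a q) t * exp (- t)) = (\<lambda>t. a * exp (- t) + 1 * (t * (poly q t * exp (- t))))"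
    by (auto simp: algebra_simps)
  note IH = pCons.IH[OF regular_exponent_add_1[OF pCons.prems]]
  note X = fp_admissible_mult_X[OF conjunct1[OF IH]]
  show ?case
    unfolding eq using fp_admissible_lin[OF fp_admissible_exp[OF \<xi>] X(1), of a 1] X(2) IH
      fp_split_exp[OF pCons.prems \<xi>]
    by (simp add: gamma_functional_pCons)
qed


section \<open>Finite part of the kernel exp(-t) / (t - z)\<close>

lemma fp_admissible_kernel:
  assumes z: "z \<notin> \<real>\<^sub>\<ge>\<^sub>0" and \<xi>: "0 < \<xi>" "\<xi> < norm z"
  shows "fp_admissible \<alpha> (\<lambda>t. exp (- t) / (t - z)) \<xi>"
proof -
  have hol: "(\<lambda>t. exp (- t) / (t - z)) holomorphic_on eball 0 (ereal (norm z))"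
    by (intro holomorphic_intros) auto
  have "(\<lambda>t. exp (- t) / (t - z)) has_fps_expansion fps_expansion (\<lambda>t. exp (- t) / (t - z)) 0"
    using \<xi> by (intro has_fps_expansion_fps_expansion[OF _ _ hol]) auto
  note A = this holomorphic_on_imp_fps_conv_radius_ge[OF this hol]
  obtain d where d: "d > 0" "\<And>t. t \<ge> 0 \<Longrightarrow> d \<le> norm (of_real t - z)"
    using dist_nonneg_Reals[OF z] by blast
  have "set_integrable lborel {\<xi>..} (\<lambda>t. of_real t powr \<alpha> * (exp (- of_real t) * (1 / (of_real t - z))))"
  proof (rule set_integrable_gamma_tail[OF \<xi>(1)])
    show "continuous_on {\<xi>..} (\<lambda>t. 1 / (of_real t - z))"
      using z \<xi> by (intro continuous_intros) auto
    show "norm (1 / (of_real t - z)) \<le> 1 / d" if "\<xi> \<le> t" for t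
      using d(2)[of t] d(1) that \<xi> by (simp add: norm_divide frac_le)
  qed
  moreover have "ereal \<xi> < fps_conv_radius (fps_expansion (\<lambda>t. exp (- t) / (t - z)) 0)"
    using \<xi>(2) A(2) by (intro less_le_trans[OF _ A(2)]) simp
  ultimately show ?thesis using A(1) \<xi> by (auto simp: fp_admissible_def)
qed

lemma fp_split_kernel_shift:
  assumes \<alpha>: "regular_exponent \<alpha>" and z: "z \<notin> \<real>\<^sub>\<ge>\<^sub>0" and \<xi>: "0 < \<xi>" "\<xi> < norm z"
  shows "z * fp_split \<alpha> (\<lambda>t. exp (- t) / (t - z)) \<xi> =
    fp_split (\<alpha> + 1) (\<lambda>t. exp (- t) / (t - z)) \<xi> - Gamma (\<alpha> + 1)"
proof -
  let ?K = "\<lambda>t. exp (- t) / (t - z)"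
  note K = fp_admissible_kernel[OF z \<xi>]
  note X = fp_admissible_mult_X[OF K[of "\<alpha> + 1"]]
  \<comment> \<open>The summand with factor 0 only fits the scalar multiple to the two-term form of
    \<open>fp_admissible_lin\<close>.\<close>
  have "z * fp_split \<alpha> ?K \<xi> = fp_split \<alpha> (\<lambda>t. z * ?K t + 0 * ?K t) \<xi>"
    using fp_admissible_lin(2)[OF K K, of \<alpha> z 0] by simp
  also have "\<dots> = fp_split \<alpha> (\<lambda>t. 1 * (t * ?K t) + (- 1) * exp (- t)) \<xi>"
  proof (rule fp_split_cong)
    have "z \<noteq> 0" using z by auto
    then have "\<forall>\<^sub>F t in nhds 0. t \<noteq> z" by (intro t1_space_nhds) auto
    then show "\<forall>\<^sub>F t in nhds 0. z * ?K t + 0 * ?K t = 1 * (t * ?K t) + (- 1) * exp (- t)"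
      by eventually_elim (simp add: field_simps)
    fix t assume "t \<ge> \<xi>"
    then have "of_real t \<noteq> z" using z \<xi> by auto
    then show "z * ?K (of_real t) + 0 * ?K (of_real t) = 1 * (of_real t * ?K (of_real t)) + (- 1) * exp (- of_real t)"
      by (simp add: field_simps)
  qed
  also have "\<dots> = fp_split (\<alpha> + 1) ?K \<xi> - Gamma (\<alpha> + 1)"
    using fp_admissible_lin(2)[OF X(1) fp_admissible_exp[OF \<xi>(1)], of 1 "- 1"] X(2) fp_split_exp[OF \<alpha> \<xi>(1)]
    by simp
  finally show ?thesis .
qed

lemma fp_split_kernel_convergent:
  assumes \<alpha>: "Re \<alpha> \<ge> 1" and z: "z \<notin> \<real>\<^sub>\<ge>\<^sub>0" and \<xi>: "0 < \<xi>" "\<xi> < norm z"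
  shows "fp_split \<alpha> (\<lambda>t. exp (- t) / (t - z)) \<xi> = cauchy_transform (gamma_density \<alpha>) z"
proof -
  have "fp_split \<alpha> (\<lambda>t. exp (- t) / (t - z)) \<xi> =
      (LINT t:{0..}|lborel. of_real t powr \<alpha> * (exp (- of_real t) / (of_real t - z)))"
    using \<xi> by (intro fp_split_convergent[OF \<alpha> fp_admissible_kernel[OF z \<xi>], of "ereal (norm z)"] holomorphic_intros) auto
  also have "\<dots> = cauchy_transform (gamma_density \<alpha>) z"
    unfolding set_lebesgue_integral_def cauchy_transform_def
    by (intro Bochner_Integration.integral_cong refl) (auto simp: gamma_density_def indicator_def)
  finally show ?thesis .
qed

text \<open>The point |z|/2 is merely one explicit choice below the pole at z;
  \<open>fp_stieltjes_eq\<close> shows that every other one gives the same value.\<close>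

definition fp_stieltjes :: "complex \<Rightarrow> complex \<Rightarrow> complex" where
  "fp_stieltjes \<alpha> z = fp_split \<alpha> (\<lambda>t. exp (- t) / (t - z)) (norm z / 2)"

text \<open>For Re \<alpha> >= 1 both sides are the same ordinary integral. In the descent both
  satisfy the same shift relation, and z is nonzero, so equality at \<alpha> + 1 gives equality at
  \<alpha>.\<close>

lemma fp_stieltjes_eq:
  assumes "regular_exponent \<alpha>" and z: "z \<notin> \<real>\<^sub>\<ge>\<^sub>0" and \<xi>: "0 < \<xi>" "\<xi> < norm z"
  shows "fp_split \<alpha> (\<lambda>t. exp (- t) / (t - z)) \<xi> = fp_stieltjes \<alpha> z"
  using assms(1)
proof (induction \<alpha> rule: regular_exponent_induct[where r = 1])
  case (base \<alpha>)
  have "z \<noteq> 0" using z by auto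
  with base show ?case
    using \<xi> fp_split_kernel_convergent[OF _ z \<xi>, of \<alpha>] fp_split_kernel_convergent[OF _ z, of \<alpha> "norm z / 2"]
    by (simp add: fp_stieltjes_def)
next
  case (step \<alpha>)
  have "z \<noteq> 0" using z by auto
  have "z * fp_split \<alpha> (\<lambda>t. exp (- t) / (t - z)) \<xi> = z * fp_stieltjes \<alpha> z"
    using step(2) \<xi> \<open>z \<noteq> 0\<close> fp_split_kernel_shift[OF step(1) z \<xi>] fp_split_kernel_shift[OF step(1) z, of "norm z / 2"]
    by (simp add: fp_stieltjes_def)
  then show ?case using \<open>z \<noteq> 0\<close> by simp
qed

lemma fp_stieltjes_shift:
  assumes "regular_exponent \<alpha>" and z: "z \<notin> \<real>\<^sub>\<ge>\<^sub>0"
  shows "fp_stieltjes (\<alpha> + 1) z = z * fp_stieltjes \<alpha> z + Gamma (\<alpha> + 1)"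
proof -
  have "z \<noteq> 0" using z by auto
  then show ?thesis
    unfolding fp_stieltjes_def using fp_split_kernel_shift[OF assms, of "norm z / 2"] by simp
qed

lemma fp_stieltjes_convergent:
  assumes "Re \<alpha> \<ge> 1" and z: "z \<notin> \<real>\<^sub>\<ge>\<^sub>0"
  shows "fp_stieltjes \<alpha> z = cauchy_transform (gamma_density \<alpha>) z"
proof -
  have "z \<noteq> 0" using z by auto
  then show ?thesis
    unfolding fp_stieltjes_def by (intro fp_split_kernel_convergent assms) auto
qed

text \<open>Reconciles two computations of one transform: monomial by monomial on the left, and
  through p(t) / (t - z) = q(t) + p(z) / (t - z) with the synthetic quotient q on the right.\<close>

lemma coeff_pairing_fp_stieltjes:
  assumes "regular_exponent \<alpha>" and z: "z \<notin> \<real>\<^sub>\<ge>\<^sub>0"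
  shows "coeff_pairing (\<lambda>j. fp_stieltjes (\<alpha> + of_nat j) z) p =
    gamma_functional \<alpha> (synthetic_div p z) + poly p z * fp_stieltjes \<alpha> z"
  using assms(1)
proof (induction p arbitrary: \<alpha>)
  case 0
  then show ?case by (simp add: gamma_functional_def)
next
  case (pCons a p)
  have "coeff_pairing (\<lambda>j. fp_stieltjes (\<alpha> + of_nat j) z) (pCons a p) =
      a * fp_stieltjes \<alpha> z + coeff_pairing (\<lambda>j. fp_stieltjes (\<alpha> + 1 + of_nat j) z) p"
    by (simp add: coeff_pairing_pCons add_ac)
  also have "\<dots> = a * fp_stieltjes \<alpha> z + gamma_functional (\<alpha> + 1) (synthetic_div p z)
      + poly p z * (z * fp_stieltjes \<alpha> z + Gamma (\<alpha> + 1))"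
    using pCons.IH[OF regular_exponent_add_1[OF pCons.prems]] fp_stieltjes_shift[OF pCons.prems z] by simp
  finally show ?case
    by (simp add: gamma_functional_pCons algebra_simps)
qed

text \<open>Eliminates the choice operator in \<open>fp_integral\<close>. The chosen \<xi> need not
  be below |z| when p(z) = 0; then the integrand is q(t) exp(-t) away from t = z and any \<xi> will
  do. Otherwise the pole at z forces \<xi> < |z|.\<close>

lemma fp_cauchy_eq:
  assumes \<alpha>: "regular_exponent \<alpha>" and z: "z \<notin> \<real>\<^sub>\<ge>\<^sub>0"
  shows "fp_cauchy \<alpha> p z = 1 / (2 * of_real pi * \<i>) * coeff_pairing (\<lambda>j. fp_stieltjes (\<alpha> + of_nat j) z) p"
proof -
  define F where "F t = poly p t * exp (- t) / (t - z)" for t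
  define q where "q = synthetic_div p z"
  define \<xi> where "\<xi> = (SOME \<xi>. 0 < \<xi> \<and> ereal \<xi> < conv_radius (taylor_coeff F))"
  have z0: "z \<noteq> 0" using z by auto
  have p: "poly p t = (t - z) * poly q t + poly p z" for t
    using arg_cong[OF synthetic_div_correct'[of z p], of "\<lambda>r. poly r t", symmetric]
    by (simp add: q_def algebra_simps)
  have "F holomorphic_on ball 0 (norm z)"
    unfolding F_def[abs_def] by (intro holomorphic_intros) auto
  then have A: "F has_fps_expansion fps_expansion F 0" (is "_ has_fps_expansion ?A")
    using z0 by (intro has_fps_expansion_fps_expansion) auto
  note tc = taylor_coeff_eq_fps_nth[OF A]
  have "0 < conv_radius (taylor_coeff F)"
    using A unfolding tc by (simp add: has_fps_expansion_def fps_conv_radius_def)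
  then obtain x where "0 < ereal x" "ereal x < conv_radius (taylor_coeff F)"
    by (metis ereal_dense2 zero_ereal_def)
  then have \<xi>: "0 < \<xi>" "ereal \<xi> < fps_conv_radius ?A"
    using someI[of "\<lambda>\<xi>. 0 < \<xi> \<and> ereal \<xi> < conv_radius (taylor_coeff F)" x]
    unfolding \<xi>_def[symmetric] by (auto simp: tc fps_conv_radius_def)
  have near: "\<forall>\<^sub>F t in nhds 0. t \<noteq> z" using z0 by (intro t1_space_nhds) auto
  have far: "of_real t \<noteq> z" if "t \<ge> \<xi>" for t using z \<xi> that by auto
  have "fp_split \<alpha> F \<xi> = gamma_functional \<alpha> q + poly p z * fp_stieltjes \<alpha> z"
  proof (cases "poly p z = 0")
    case True
    have "fp_split \<alpha> F \<xi> = fp_split \<alpha> (\<lambda>t. poly q t * exp (- t)) \<xi>"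
    proof (rule fp_split_cong)
      have eq: "F t = poly q t * exp (- t)" if "t \<noteq> z" for t
        using that p[of t] True by (simp add: F_def)
      show "\<forall>\<^sub>F t in nhds 0. F t = poly q t * exp (- t)"
        using near by eventually_elim (rule eq)
      show "F (of_real t) = poly q (of_real t) * exp (- of_real t)" if "\<xi> \<le> t" for t
        using far[OF that] by (rule eq)
    qed
    then show ?thesis using fp_split_poly_exp[OF \<alpha> \<xi>(1), of q] True by simp
  next
    case False
    have "\<xi> < norm z"
    \<comment> \<open>If the expansion of F converged beyond |z|, its product with t - z would
      represent p(t) exp(-t) and vanish at z, contradicting p(z) nonzero.\<close>
    proof (rule ccontr)
      assume "\<not> \<xi> < norm z"
      then have "ereal (norm z) \<le> ereal \<xi>" by simp
      also note \<xi>(2)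
      finally have rad: "ereal (norm z) < fps_conv_radius ?A" .
      have 1: "(\<lambda>t. (t - z) * F t) has_fps_expansion (fps_X - fps_const z) * ?A"
        by (intro fps_expansion_intros A)
      have 2: "(\<lambda>t. poly p t * exp ((- 1) * t)) has_fps_expansion fps_of_poly p * fps_exp (- 1)"
        by (intro fps_expansion_intros) (simp add: has_fps_expansion_def)
      have ev: "\<forall>\<^sub>F t in nhds 0. (t - z) * F t = poly p t * exp ((- 1) * t)"
        using near by eventually_elim (simp add: F_def)
      from 1 have "(\<lambda>t. poly p t * exp ((- 1) * t)) has_fps_expansion (fps_X - fps_const z) * ?A"
        using has_fps_expansion_cong[OF ev refl] by (rule iffD1[rotated])
      then have "(fps_X - fps_const z) * ?A = fps_of_poly p * fps_exp (- 1)"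
        using fps_expansion_eqI 2 by metis
      moreover have "eval_fps ((fps_X - fps_const z) * ?A) z = 0"
        using rad less_le_trans[OF _ fps_conv_radius_diff, of "ereal (norm z)" fps_X "fps_const z"]
        by (subst eval_fps_mult) (auto simp: eval_fps_diff)
      moreover have "eval_fps (fps_of_poly p * fps_exp (- 1)) z = poly p z * exp (- z)"
        by (subst eval_fps_mult) auto
      ultimately show False using False by simp
    qed
    note adm = conjunct1[OF fp_split_poly_exp[OF \<alpha> \<xi>(1)], of q] fp_admissible_kernel[OF z \<xi>(1) this, of \<alpha>]
    have "fp_split \<alpha> F \<xi> = fp_split \<alpha> (\<lambda>t. 1 * (poly q t * exp (- t)) + poly p z * (exp (- t) / (t - z))) \<xi>"
    proof (rule fp_split_cong)
      have eq: "F t = 1 * (poly q t * exp (- t)) + poly p z * (exp (- t) / (t - z))" if "t \<noteq> z" for t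
        using that p[of t] by (simp add: F_def add_divide_distrib distrib_right)
      show "\<forall>\<^sub>F t in nhds 0. F t = 1 * (poly q t * exp (- t)) + poly p z * (exp (- t) / (t - z))"
        using near by eventually_elim (rule eq)
      show "F (of_real t) = 1 * (poly q (of_real t) * exp (- of_real t)) + poly p z * (exp (- of_real t) / (of_real t - z))"
        if "\<xi> \<le> t" for t using far[OF that] by (rule eq)
    qed
    also have "\<dots> = gamma_functional \<alpha> q + poly p z * fp_stieltjes \<alpha> z"
      using fp_admissible_lin(2)[OF adm, of 1 "poly p z"] fp_split_poly_exp[OF \<alpha> \<xi>(1), of q]
        fp_stieltjes_eq[OF \<alpha> z \<xi>(1) \<open>\<xi> < norm z\<close>] by simp
    finally show ?thesis .
  qed
  moreover have "fp_cauchy \<alpha> p z = 1 / (2 * of_real pi * \<i>) * fp_split \<alpha> F \<xi>"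
    by (simp add: fp_cauchy_def fp_integral_def \<xi>_def F_def[abs_def])
  ultimately show ?thesis by (simp add: coeff_pairing_fp_stieltjes[OF \<alpha> z] q_def)
qed

section \<open>The finite-part Stieltjes transform\<close>

abbreviation real_weight :: "complex \<Rightarrow> real \<Rightarrow> complex" where
  "real_weight \<alpha> x \<equiv> of_real x powr \<alpha> * exp (- of_real x)"

text \<open>Ln(-z) has its cut exactly on the nonnegative reals, and adding \<i> \<pi> moves its
  argument to the range between 0 and 2 \<pi>. This form gives holomorphy on the slit plane.\<close>

lemma slit_power_eq:
  assumes "z \<notin> \<real>\<^sub>\<ge>\<^sub>0"
  shows "slit_power \<alpha> z = exp (\<alpha> * (Ln (- z) + \<i> * of_real pi))"
proof -
  have z0: "z \<noteq> 0" using assms by auto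
  have "Arg2pi z \<noteq> 0"
    using assms by (auto simp: Arg2pi_eq_0 complex_nonneg_Reals_iff complex_is_Real_iff)
  then have "Arg2pi z = Im (Ln (- z)) + pi"
    using Arg2pi_ge_0[of z] by (intro Arg2pi_Ln) simp
  moreover have "Re (Ln (- z)) = ln (norm z)" using z0 by (subst Re_Ln) auto
  ultimately have "of_real (ln (cmod z)) + \<i> * of_real (Arg2pi z) = Ln (- z) + \<i> * of_real pi"
    by (simp add: complex_eq_iff)
  then show ?thesis by (simp add: slit_power_def)
qed

lemma slit_power_nonzero: "slit_power \<alpha> z \<noteq> 0"
  by (simp add: slit_power_def)

lemma slit_power_minus: "slit_power (- \<alpha>) z = inverse (slit_power \<alpha> z)"
  by (simp add: slit_power_def exp_minus)

lemma slit_power_add_1: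
  assumes "z \<notin> \<real>\<^sub>\<ge>\<^sub>0"
  shows "slit_power (\<alpha> + 1) z = slit_power \<alpha> z * z"
proof -
  have "z \<noteq> 0" using assms by auto
  then have "exp (Ln (- z) + \<i> * of_real pi) = z" by (simp add: exp_add)
  moreover have "(\<alpha> + 1) * (Ln (- z) + \<i> * of_real pi) =
      \<alpha> * (Ln (- z) + \<i> * of_real pi) + (Ln (- z) + \<i> * of_real pi)"
    by (simp add: algebra_simps)
  ultimately show ?thesis by (simp only: slit_power_eq[OF assms] exp_add)
qed

lemma has_field_derivative_slit_power:
  assumes "z \<notin> \<real>\<^sub>\<ge>\<^sub>0"
  shows "(slit_power \<alpha> has_field_derivative \<alpha> / z * slit_power \<alpha> z) (at z)"
proof -
  have z: "- z \<notin> \<real>\<^sub>\<le>\<^sub>0" "z \<noteq> 0"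
    using assms by (auto simp: complex_nonneg_Reals_iff complex_nonpos_Reals_iff)
  have "((\<lambda>z. exp (\<alpha> * (Ln (- z) + \<i> * of_real pi))) has_field_derivative \<alpha> / z * slit_power \<alpha> z) (at z)"
    using z by (auto intro!: derivative_eq_intros simp: slit_power_eq[OF assms] divide_inverse mult_ac)
  moreover have "open (- \<real>\<^sub>\<ge>\<^sub>0 :: complex set)" using closed_nonneg_Reals_complex by auto
  ultimately show ?thesis
    by (rule has_field_derivative_transform_within_open[where S = slit_plane]) (use assms slit_power_eq in auto)
qed

lemma norm_slit_power:
  assumes "z \<noteq> 0"
  shows "norm (slit_power \<alpha> z) = norm z powr Re \<alpha> * exp (- (Im \<alpha> * Arg2pi z))"
  using assms by (simp add: slit_power_def powr_def exp_diff exp_minus field_simps)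

lemma norm_slit_power_le:
  obtains C where "C > 0" "\<And>z. z \<noteq> 0 \<Longrightarrow> norm (slit_power \<alpha> z) \<le> C * norm z powr Re \<alpha>"
proof -
  have "norm (slit_power \<alpha> z) \<le> exp (\<bar>Im \<alpha>\<bar> * (2 * pi)) * norm z powr Re \<alpha>" if "z \<noteq> 0" for z
  proof -
    have "- (Im \<alpha> * Arg2pi z) \<le> \<bar>Im \<alpha> * Arg2pi z\<bar>" by simp
    also have "\<dots> \<le> \<bar>Im \<alpha>\<bar> * (2 * pi)"
      unfolding abs_mult using Arg2pi_ge_0[of z] Arg2pi_lt_2pi[of z] by (intro mult_left_mono) auto
    finally show ?thesis using that by (simp add: norm_slit_power mult.commute mult_right_mono)
  qed
  then show ?thesis by (rule that[rotated]) auto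
qed

lemma slit_power_upper: "Im z > 0 \<Longrightarrow> slit_power \<alpha> z = z powr \<alpha>"
  by (subst slit_power_eq) (auto simp: Ln_minus powr_def complex_nonneg_Reals_iff)

text \<open>Below the axis the argument exceeds the principal one by 2 \<pi>. This monodromy factor
  later separates z^\<alpha> from functions without a jump.\<close>

lemma slit_power_lower: "Im z < 0 \<Longrightarrow> slit_power \<alpha> z = exp (2 * of_real pi * \<i> * \<alpha>) * z powr \<alpha>"
  by (subst slit_power_eq) (auto simp: Ln_minus powr_def complex_nonneg_Reals_iff algebra_simps simp flip: exp_add)

text \<open>Existence of both one-sided limits is part of the notion, so jump 0 provides a common
  limit, which is what extension across the cut requires.\<close>

definition has_jump :: "(complex \<Rightarrow> complex) \<Rightarrow> real \<Rightarrow> complex \<Rightarrow> bool" where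
  "has_jump f x j \<longleftrightarrow> (\<exists>u l. (f \<longlongrightarrow> u) (upper_at x) \<and> (f \<longlongrightarrow> l) (lower_at x) \<and> u - l = j)"

lemma has_jumpI: "(f \<longlongrightarrow> u) (upper_at x) \<Longrightarrow> (f \<longlongrightarrow> l) (lower_at x) \<Longrightarrow> u - l = j \<Longrightarrow> has_jump f x j"
  unfolding has_jump_def by blast

lemma has_jump_add:
  assumes "has_jump f x j" "has_jump g x k"
  shows "has_jump (\<lambda>z. f z + g z) x (j + k)"
proof -
  obtain u l where "(f \<longlongrightarrow> u) (upper_at x)" "(f \<longlongrightarrow> l) (lower_at x)" "u - l = j"
    using assms by (auto simp: has_jump_def)
  moreover obtain v m where "(g \<longlongrightarrow> v) (upper_at x)" "(g \<longlongrightarrow> m) (lower_at x)" "v - m = k"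
    using assms by (auto simp: has_jump_def)
  ultimately show ?thesis
    unfolding has_jump_def by (intro exI[of _ "u + v"] exI[of _ "l + m"]) (auto intro!: tendsto_add)
qed

lemma has_jump_mult:
  assumes "has_jump f x j" "isCont g (of_real x)"
  shows "has_jump (\<lambda>z. g z * f z) x (g (of_real x) * j)"
proof -
  obtain u l where "(f \<longlongrightarrow> u) (upper_at x)" "(f \<longlongrightarrow> l) (lower_at x)" "u - l = j"
    using assms by (auto simp: has_jump_def)
  moreover have g: "(g \<longlongrightarrow> g (of_real x)) (at (of_real x) within S)" for S
    using assms(2) continuous_at_imp_continuous_at_within continuous_within by blast
  ultimately show ?thesis
    by (intro has_jumpI[OF tendsto_mult[OF g] tendsto_mult[OF g]]) (auto simp flip: right_diff_distrib)
qed

lemma has_jump_isCont: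
  assumes "isCont g (of_real x)"
  shows "has_jump g x 0"
proof -
  have "(g \<longlongrightarrow> g (of_real x)) (at (of_real x) within S)" for S
    using assms continuous_at_imp_continuous_at_within continuous_within by blast
  then show ?thesis unfolding has_jump_def by auto
qed

lemma has_jump_cong:
  assumes "has_jump f x j" "\<And>z. Im z \<noteq> 0 \<Longrightarrow> f z = g z"
  shows "has_jump g x j"
proof -
  obtain u l where 1: "(f \<longlongrightarrow> u) (upper_at x)" "(f \<longlongrightarrow> l) (lower_at x)" "u - l = j"
    using assms by (auto simp: has_jump_def)
  have "(g \<longlongrightarrow> u) (upper_at x)" "(g \<longlongrightarrow> l) (lower_at x)"
    using Lim_transform_eventually[OF 1(1), of g] Lim_transform_eventually[OF 1(2), of g] assms(2)
    by (auto simp: eventually_at_filter)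
  then show ?thesis using 1 by (auto simp: has_jump_def)
qed

section \<open>Holomorphy, jump and growth of the Stieltjes transform by descent\<close>

lemma nonreal_in_slit_plane: "Im z \<noteq> 0 \<Longrightarrow> z \<notin> \<real>\<^sub>\<ge>\<^sub>0"
  by (auto simp: complex_nonneg_Reals_iff)

lemma open_slit_plane: "open slit_plane"
  using closed_nonneg_Reals_complex by auto

text \<open>The descent step: off the cut, inverse z is holomorphic and the subtracted constant has
  no jump, so properties of \<open>fp_stieltjes (\<alpha> + 1)\<close> pass to
  \<open>fp_stieltjes \<alpha>\<close>.\<close>

lemma fp_stieltjes_unshift:
  assumes "regular_exponent \<alpha>" "z \<notin> \<real>\<^sub>\<ge>\<^sub>0"
  shows "fp_stieltjes \<alpha> z = inverse z * (fp_stieltjes (\<alpha> + 1) z - Gamma (\<alpha> + 1))"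
proof -
  have "z \<noteq> 0" using assms by auto
  then show ?thesis using fp_stieltjes_shift[OF assms] by simp
qed

lemma gamma_density_nonpos: "t \<le> 0 \<Longrightarrow> gamma_density \<beta> t = 0"
  by (simp add: gamma_density_def)

lemma has_field_derivative_fp_stieltjes_convergent:
  assumes "Re \<alpha> \<ge> 1" "z \<notin> \<real>\<^sub>\<ge>\<^sub>0"
  shows "(fp_stieltjes \<alpha> has_field_derivative (LINT t|lborel. gamma_density \<alpha> t / (of_real t - z)\<^sup>2)) (at z)"
proof -
  obtain M where "lipschitz_density (gamma_density \<alpha>) M"
    using lipschitz_gamma_density assms by blast
  from lipschitz_density.has_field_derivative_cauchy_transform[OF this gamma_density_nonpos assms(2)]
  show ?thesis
    by (rule has_field_derivative_transform_within_open[OF _ open_slit_plane])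
       (use assms fp_stieltjes_convergent in auto)
qed

lemma holomorphic_fp_stieltjes:
  assumes "regular_exponent \<alpha>"
  shows "fp_stieltjes \<alpha> holomorphic_on slit_plane"
  using assms
proof (induction \<alpha> rule: regular_exponent_induct[where r = 1])
  case (base \<alpha>)
  then show ?case
    using has_field_derivative_fp_stieltjes_convergent[of \<alpha>] open_slit_plane
    by (auto simp: holomorphic_on_open)
next
  case (step \<alpha>)
  have "(\<lambda>z. inverse z * (fp_stieltjes (\<alpha> + 1) z - Gamma (\<alpha> + 1))) holomorphic_on slit_plane"
    by (intro holomorphic_intros step) auto
  then show ?case
    by (rule holomorphic_transform) (use fp_stieltjes_unshift[OF step(1)] in auto)
qed

lemma has_jump_fp_stieltjes:
  assumes "regular_exponent \<alpha>" "x > 0"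
  shows "has_jump (fp_stieltjes \<alpha>) x (2 * of_real pi * \<i> * (real_weight \<alpha> x))"
  using assms(1)
proof (induction \<alpha> rule: regular_exponent_induct[where r = 1])
  case (base \<alpha>)
  obtain M where "lipschitz_density (gamma_density \<alpha>) M"
    using lipschitz_gamma_density base by blast
  then interpret lipschitz_density "gamma_density \<alpha>" M .
  have "has_jump (cauchy_transform (gamma_density \<alpha>)) x (2 * of_real pi * \<i> * gamma_density \<alpha> x)"
    by (rule has_jumpI[OF tendsto_cauchy_transform_upper tendsto_cauchy_transform_lower]) simp
  then have "has_jump (fp_stieltjes \<alpha>) x (2 * of_real pi * \<i> * gamma_density \<alpha> x)"
    by (rule has_jump_cong) (use base fp_stieltjes_convergent nonreal_in_slit_plane in auto)
  then show ?case using assms(2) by (simp add: gamma_density_def)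
next
  case (step \<alpha>)
  \<comment> \<open>The constant contributes jump 0, and the factor 1/x turns the weight with
    exponent \<alpha> + 1 into the one with exponent \<alpha>.\<close>
  have jump: "has_jump (\<lambda>z. inverse z * (fp_stieltjes (\<alpha> + 1) z + - Gamma (\<alpha> + 1))) x
      (inverse (of_real x) * (2 * of_real pi * \<i> * (real_weight (\<alpha> + 1) x) + 0))"
    using assms(2) by (intro has_jump_mult has_jump_add step has_jump_isCont continuous_intros) auto
  have eq: "inverse (of_real x) * (2 * of_real pi * \<i> * (real_weight (\<alpha> + 1) x) + 0) =
      2 * of_real pi * \<i> * (real_weight \<alpha> x)"
    using assms(2) by (simp add: powr_add)
  show ?case
    by (rule has_jump_cong[OF jump[unfolded eq]]) (use fp_stieltjes_unshift[OF step(1)] nonreal_in_slit_plane in auto)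
qed

lemma fp_stieltjes_bounded:
  assumes "Re \<alpha> \<ge> 1"
  obtains C where "\<And>z. z \<in> slit_plane \<Longrightarrow> norm (fp_stieltjes \<alpha> z) \<le> C"
proof -
  obtain M where "lipschitz_density (gamma_density \<alpha>) M"
    using lipschitz_gamma_density assms by blast
  then interpret lipschitz_density "gamma_density \<alpha>" M .
  obtain B where B: "\<And>t. norm (gamma_density \<alpha> t) \<le> B"
    using gamma_density_bounded[of \<alpha>] assms by (metis order_trans zero_le_one)
  have "norm (fp_stieltjes \<alpha> z) \<le> (LINT t|lborel. norm (gamma_density \<alpha> t)) + 2 * M + B * pi" if "z \<in> slit_plane" for z
  proof -
    have "Im z \<noteq> 0 \<or> gamma_density \<alpha> (Re z) = 0"
      using that by (cases "Im z = 0") (auto simp: complex_nonneg_Reals_iff gamma_density_def)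
    from cauchy_transform_bounded[OF B this] show ?thesis
      using that assms by (simp add: fp_stieltjes_convergent)
  qed
  then show ?thesis by (rule that)
qed

lemma eventually_slit_at_infinity:
  "(\<forall>\<^sub>F z in slit_at_infinity. P z) \<longleftrightarrow> (\<exists>R. \<forall>z\<in>slit_plane. R \<le> norm z \<longrightarrow> P z)"
  by (auto simp: eventually_inf_principal eventually_at_infinity)

lemma eventually_in_slit: "\<forall>\<^sub>F z in slit_at_infinity. z \<in> slit_plane"
  by (simp add: eventually_inf_principal)

lemma inverse_bigo_1: "inverse \<in> O[slit_at_infinity](\<lambda>_. 1 :: complex)"
proof (rule bigoI[where c = 1])
  show "\<forall>\<^sub>F z in slit_at_infinity. norm (inverse z) \<le> 1 * norm (1 :: complex)"
    unfolding eventually_slit_at_infinity by (intro exI[of _ 1]) (auto simp: norm_inverse inverse_le_1_iff simp del: inverse_eq_divide)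
qed

lemma fp_stieltjes_bigo_1:
  assumes "regular_exponent \<alpha>"
  shows "fp_stieltjes \<alpha> \<in> O[slit_at_infinity](\<lambda>_. 1)"
  using assms
proof (induction \<alpha> rule: regular_exponent_induct[where r = 1])
  case (base \<alpha>)
  obtain C where "\<And>z. z \<in> slit_plane \<Longrightarrow> norm (fp_stieltjes \<alpha> z) \<le> C"
    using fp_stieltjes_bounded base by blast
  then show ?case
    by (intro bigoI[where c = C]) (auto simp: eventually_slit_at_infinity)
next
  case (step \<alpha>)
  have "(\<lambda>z. inverse z * (fp_stieltjes (\<alpha> + 1) z - Gamma (\<alpha> + 1))) \<in> O[slit_at_infinity](\<lambda>_. 1 * 1)"
    by (intro landau_o.big.mult inverse_bigo_1 sum_in_bigo step) auto
  moreover have ev: "\<forall>\<^sub>F z in slit_at_infinity. fp_stieltjes \<alpha> z = inverse z * (fp_stieltjes (\<alpha> + 1) z - Gamma (\<alpha> + 1))"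
    using eventually_in_slit by eventually_elim (use fp_stieltjes_unshift[OF step(1)] in auto)
  ultimately show ?case using landau_o.big.in_cong[OF ev, of "\<lambda>_. 1"] by simp
qed

text \<open>One more use of the shift, now on the bounded transform with exponent \<alpha> + 1,
  gains the factor 1/z without another induction.\<close>

lemma fp_stieltjes_bigo_inverse:
  assumes "regular_exponent \<alpha>"
  shows "fp_stieltjes \<alpha> \<in> O[slit_at_infinity](inverse)"
proof -
  have "(\<lambda>z. inverse z * (fp_stieltjes (\<alpha> + 1) z - Gamma (\<alpha> + 1))) \<in> O[slit_at_infinity](\<lambda>z. inverse z * 1)"
    by (intro landau_o.big.mult sum_in_bigo fp_stieltjes_bigo_1 regular_exponent_add_1 assms) auto
  moreover have ev: "\<forall>\<^sub>F z in slit_at_infinity. fp_stieltjes \<alpha> z = inverse z * (fp_stieltjes (\<alpha> + 1) z - Gamma (\<alpha> + 1))"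
    using eventually_in_slit by eventually_elim (use fp_stieltjes_unshift[OF assms] in auto)
  ultimately show ?thesis using landau_o.big.in_cong[OF ev, of "inverse"] by simp
qed

section \<open>The differential equation of the Stieltjes transform\<close>

lemma integrable_gamma_density_kernel:
  assumes "Re \<alpha> > - 1" "z \<notin> \<real>\<^sub>\<ge>\<^sub>0"
  shows "integrable lborel (\<lambda>t. gamma_density \<alpha> t / (of_real t - z) ^ k)"
proof -
  obtain d where d: "d > 0" "\<And>t. t \<ge> 0 \<Longrightarrow> d \<le> norm (of_real t - z)"
    using dist_nonneg_Reals assms by blast
  show ?thesis
  proof (rule Bochner_Integration.integrable_bound)
    show "integrable lborel (\<lambda>t. gamma_density \<alpha> t * of_real (1 / d ^ k))"
      using integrable_gamma_density assms by (intro integrable_mult_left) auto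
    have "norm (gamma_density \<alpha> t / (of_real t - z) ^ k) \<le> norm (gamma_density \<alpha> t * of_real (1 / d ^ k))" for t
    proof (cases "t \<ge> 0")
      case True
      then have "norm (gamma_density \<alpha> t) / norm (of_real t - z) ^ k \<le> norm (gamma_density \<alpha> t) / d ^ k"
        using d by (intro frac_le power_mono) auto
      then show ?thesis using d by (simp add: norm_divide norm_power norm_mult)
    qed (simp add: gamma_density_nonpos)
    then show "AE t in lborel. norm (gamma_density \<alpha> t / (of_real t - z) ^ k) \<le> norm (gamma_density \<alpha> t * of_real (1 / d ^ k))"
      by simp
  qed simp
qed

lemma continuous_gamma_density: "t > 0 \<Longrightarrow> isCont (gamma_density \<beta>) t"
  using has_vector_derivative_continuous has_vector_derivative_gamma_density by blast

text \<open>Integration by parts: \<open>f\<close> is the derivative of t^\<alpha> exp(-t) / (t -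
  z), which vanishes at both ends. Re \<alpha> >= 2 keeps \<alpha> - 1 in the range where the
  transform is an ordinary integral.\<close>

lemma integral_gamma_density_kernel_square:
  assumes \<alpha>: "Re \<alpha> \<ge> 2" and z: "z \<notin> \<real>\<^sub>\<ge>\<^sub>0"
  shows "(LINT t|lborel. gamma_density \<alpha> t / (of_real t - z)\<^sup>2) = \<alpha> * fp_stieltjes (\<alpha> - 1) z - fp_stieltjes \<alpha> z"
proof -
  define f where "f t = \<alpha> * (gamma_density (\<alpha> - 1) t / (of_real t - z)) - gamma_density \<alpha> t / (of_real t - z)
    - gamma_density \<alpha> t / (of_real t - z)\<^sup>2" for t
  have ne: "of_real t - z \<noteq> 0" if "t > 0" for t using that z by auto
  have i: "integrable lborel (\<lambda>t. gamma_density (\<alpha> - 1) t / (of_real t - z))"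
      "integrable lborel (\<lambda>t. gamma_density \<alpha> t / (of_real t - z))"
      "integrable lborel (\<lambda>t. gamma_density \<alpha> t / (of_real t - z)\<^sup>2)"
    using integrable_gamma_density_kernel[of "\<alpha> - 1" z 1] integrable_gamma_density_kernel[of \<alpha> z 1]
      integrable_gamma_density_kernel[of \<alpha> z 2] \<alpha> z by auto
  have int: "integrable lborel f"
    unfolding f_def using i by (intro Bochner_Integration.integrable_diff integrable_mult_right) auto
  have ind: "indicator {0<..} t *\<^sub>R f t = f t" for t
    by (cases "t > 0") (auto simp: f_def gamma_density_nonpos)
  have "(LINT t:{0<..}|lborel. f t) = 0 - 0"
  proof (rule integral_FTC_greaterThan)
    fix t :: real assume t: "t > 0"
    have "((\<lambda>t. inverse (of_real t - z)) has_vector_derivative - (inverse ((of_real t - z)\<^sup>2))) (at t)"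
    proof -
      have "((\<lambda>w. inverse (w - z)) has_field_derivative - (inverse ((of_real t - z)\<^sup>2))) (at (of_real t))"
        using ne[OF t] by (auto intro!: derivative_eq_intros simp: power2_eq_square)
      from has_vector_derivative_real_field[OF this] show ?thesis .
    qed
    from has_vector_derivative_mult[OF has_vector_derivative_gamma_density[OF t] this, of \<alpha>]
    show "((\<lambda>t. gamma_density \<alpha> t * inverse (of_real t - z)) has_vector_derivative f t) (at t)"
      by (simp add: f_def divide_inverse algebra_simps)
  next
    have "isCont f t" if "t > 0" for t
      unfolding f_def using ne[OF that] continuous_gamma_density[OF that] by (intro continuous_intros) auto
    then show "continuous_on {0<..} f" by (auto intro: continuous_at_imp_continuous_on)
    show "set_integrable lborel {0<..} f" using int by (simp add: set_integrable_def ind)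
    obtain M where "lipschitz_density (gamma_density \<alpha>) M"
      using lipschitz_gamma_density \<alpha> by fastforce
    then interpret lipschitz_density "gamma_density \<alpha>" M .
    have z0: "z \<noteq> 0" using z by auto
    then have "isCont (\<lambda>t. gamma_density \<alpha> t * inverse (of_real t - z)) 0"
      using continuous[of 0] by (intro continuous_intros) auto
    then show "((\<lambda>t. gamma_density \<alpha> t * inverse (of_real t - z)) \<longlongrightarrow> 0) (at_right 0)"
      by (simp add: isCont_def filterlim_at_split gamma_density_nonpos)
    obtain d where d: "d > 0" "\<And>t. t \<ge> 0 \<Longrightarrow> d \<le> norm (of_real t - z)"
      using dist_nonneg_Reals z by blast
    show "((\<lambda>t. gamma_density \<alpha> t * inverse (of_real t - z)) \<longlongrightarrow> 0) at_top"
    proof (rule Lim_null_comparison)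
      have "((\<lambda>t::real. t powr (Re \<alpha>) * exp (- t)) \<longlongrightarrow> 0) at_top" by real_asymp
      then show "((\<lambda>t::real. t powr (Re \<alpha>) * exp (- t) * (1 / d)) \<longlongrightarrow> 0) at_top"
        by (rule tendsto_mult_left_zero)
      show "\<forall>\<^sub>F t in at_top. norm (gamma_density \<alpha> t * inverse (of_real t - z)) \<le> t powr (Re \<alpha>) * exp (- t) * (1 / d)"
        using eventually_gt_at_top[of 0]
      proof eventually_elim
        case (elim t)
        then have "inverse (norm (of_real t - z)) \<le> 1 / d"
          using le_imp_inverse_le[OF d(2)[of t] d(1)] by (simp add: inverse_eq_divide)
        then show ?case
          unfolding norm_mult norm_inverse using elim
          by (intro mult_mono) (auto simp: norm_gamma_density)
      qed
    qed
  qed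
  then have "(LINT t|lborel. f t) = 0" by (simp add: set_lebesgue_integral_def ind)
  moreover have "has_bochner_integral lborel f (\<alpha> * cauchy_transform (gamma_density (\<alpha> - 1)) z
      - cauchy_transform (gamma_density \<alpha>) z - (LINT t|lborel. gamma_density \<alpha> t / (of_real t - z)\<^sup>2))"
    unfolding f_def[abs_def] cauchy_transform_def
    by (intro has_bochner_integral_diff has_bochner_integral_mult_right has_bochner_integral_integrable i)
  then have "(LINT t|lborel. f t) = \<alpha> * cauchy_transform (gamma_density (\<alpha> - 1)) z
      - cauchy_transform (gamma_density \<alpha>) z - (LINT t|lborel. gamma_density \<alpha> t / (of_real t - z)\<^sup>2)"
    by (rule has_bochner_integral_integral_eq)
  ultimately show ?thesis using \<alpha> z by (simp add: fp_stieltjes_convergent)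
qed

text \<open>Multiplying the derivative by z lets the shift relation at \<alpha> - 1 replace the
  transform of the lower exponent by the one at \<alpha>.\<close>

lemma fp_stieltjes_ode:
  assumes \<alpha>: "Re \<alpha> \<ge> 2" and z: "z \<notin> \<real>\<^sub>\<ge>\<^sub>0"
  obtains J' where "(fp_stieltjes \<alpha> has_field_derivative J') (at z)"
    "z * J' = \<alpha> * (fp_stieltjes \<alpha> z - Gamma \<alpha>) - z * fp_stieltjes \<alpha> z"
proof
  show "(fp_stieltjes \<alpha> has_field_derivative (\<alpha> * fp_stieltjes (\<alpha> - 1) z - fp_stieltjes \<alpha> z)) (at z)"
    using has_field_derivative_fp_stieltjes_convergent[of \<alpha> z] integral_gamma_density_kernel_square[OF \<alpha> z] \<alpha> z
    by simp
  have "regular_exponent (\<alpha> - 1)" using \<alpha> by (auto simp: complex_eq_iff)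
  from fp_stieltjes_shift[OF this z]
  show "z * (\<alpha> * fp_stieltjes (\<alpha> - 1) z - fp_stieltjes \<alpha> z) = \<alpha> * (fp_stieltjes \<alpha> z - Gamma \<alpha>) - z * fp_stieltjes \<alpha> z"
    by (simp add: algebra_simps)
qed


text \<open>Obtained formally by expanding 1 / (t - z) as the sum of z^k / t^(k+1) under the finite
  part, where t^(\<alpha>-1-k) exp(-t) contributes Gamma(\<alpha> - k).\<close>

definition gamma_fps :: "complex \<Rightarrow> complex fps" where
  "gamma_fps \<alpha> = Abs_fps (\<lambda>k. Gamma (\<alpha> - of_nat k))"

lemma Gamma_minus_of_nat:
  assumes "\<alpha> \<notin> \<int>"
  shows "Gamma (\<alpha> - of_nat k) = (\<alpha> - of_nat (Suc k)) * Gamma (\<alpha> - of_nat (Suc k))"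
    and "Gamma (\<alpha> - of_nat k) \<noteq> 0"
proof -
  have ni: "\<alpha> - of_nat k \<notin> \<int>" for k
    using assms Ints_add[of "\<alpha> - of_nat k" "of_nat k"] by auto
  have "\<alpha> - of_nat k \<notin> \<int>\<^sub>\<le>\<^sub>0" for k
    using ni[of k] nonpos_Ints_Int by blast
  then show "Gamma (\<alpha> - of_nat k) \<noteq> 0" by (simp add: Gamma_eq_zero_iff)
  show "Gamma (\<alpha> - of_nat k) = (\<alpha> - of_nat (Suc k)) * Gamma (\<alpha> - of_nat (Suc k))"
    using Gamma_plus1[of "\<alpha> - of_nat (Suc k)"] \<open>\<And>k. \<alpha> - of_nat k \<notin> \<int>\<^sub>\<le>\<^sub>0\<close>[of "Suc k"] by (simp add: add_ac)
qed

text \<open>By the functional equation of Gamma, the ratio of consecutive coefficients is |\<alpha>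
  - k - 1|, which is unbounded; the series is therefore entire.\<close>

lemma fps_conv_radius_gamma_fps:
  assumes "\<alpha> \<notin> \<int>"
  shows "fps_conv_radius (gamma_fps \<alpha>) = \<infinity>"
  unfolding fps_conv_radius_def
proof (rule conv_radius_ratio_limit_ereal_nonzero)
  have "norm (fps_nth (gamma_fps \<alpha>) k) / norm (fps_nth (gamma_fps \<alpha>) (Suc k)) = norm ((1 - \<alpha>) + of_nat k)" for k
  proof -
    have "norm (fps_nth (gamma_fps \<alpha>) k) / norm (fps_nth (gamma_fps \<alpha>) (Suc k)) = norm (\<alpha> - of_nat (Suc k))"
      unfolding gamma_fps_def fps_nth_Abs_fps Gamma_minus_of_nat(1)[OF assms, of k]
      using Gamma_minus_of_nat(2)[OF assms, of "Suc k"] by (simp add: norm_mult del: of_nat_Suc)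
    also have "\<dots> = norm ((1 - \<alpha>) + of_nat k)"
      by (subst norm_minus_commute) (simp add: algebra_simps)
    finally show ?thesis .
  qed
  moreover have "filterlim (\<lambda>k. (1 - \<alpha>) + of_nat k) at_infinity sequentially"
    by (rule tendsto_add_filterlim_at_infinity[OF tendsto_const tendsto_of_nat])
  then have "filterlim (\<lambda>k. norm ((1 - \<alpha>) + of_nat k)) at_top sequentially"
    by (rule filterlim_at_infinity_imp_norm_at_top)
  ultimately show "(\<lambda>k. ereal (norm (fps_nth (gamma_fps \<alpha>) k) / norm (fps_nth (gamma_fps \<alpha>) (Suc k)))) \<longlonglongrightarrow> \<infinity>"
    by (simp add: tendsto_PInfty_eq_at_top)
qed simp

lemma gamma_fps_add_1: "gamma_fps (\<alpha> + 1) = fps_const (Gamma (\<alpha> + 1)) + fps_X * gamma_fps \<alpha>"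
proof (rule fps_ext)
  show "fps_nth (gamma_fps (\<alpha> + 1)) k = fps_nth (fps_const (Gamma (\<alpha> + 1)) + fps_X * gamma_fps \<alpha>) k" for k
    by (cases k) (auto simp: gamma_fps_def)
qed

text \<open>Compared coefficient by coefficient, the equation is the functional equation of Gamma at
  \<alpha> - k; the constant terms match because Gamma(\<alpha>) is subtracted.\<close>

lemma gamma_fps_ode:
  assumes "\<alpha> \<notin> \<int>"
  shows "fps_X * fps_deriv (gamma_fps \<alpha>) =
    fps_const \<alpha> * (gamma_fps \<alpha> - fps_const (Gamma \<alpha>)) - fps_X * gamma_fps \<alpha>"
proof (rule fps_ext)
  show "fps_nth (fps_X * fps_deriv (gamma_fps \<alpha>)) k =
    fps_nth (fps_const \<alpha> * (gamma_fps \<alpha> - fps_const (Gamma \<alpha>)) - fps_X * gamma_fps \<alpha>) k" for k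
  proof (cases k)
    case (Suc j)
    show ?thesis
      unfolding Suc using Gamma_minus_of_nat(1)[OF assms, of j]
      by (simp add: gamma_fps_def algebra_simps)
  qed (simp add: gamma_fps_def)
qed

lemma eval_gamma_fps:
  assumes "\<alpha> \<notin> \<int>"
  shows "eval_fps (gamma_fps (\<alpha> + 1)) z = Gamma (\<alpha> + 1) + z * eval_fps (gamma_fps \<alpha>) z"
    and "\<exists>g'. (eval_fps (gamma_fps \<alpha>) has_field_derivative g') (at z) \<and>
      z * g' = \<alpha> * (eval_fps (gamma_fps \<alpha>) z - Gamma \<alpha>) - z * eval_fps (gamma_fps \<alpha>) z"
proof -
  note R = fps_conv_radius_gamma_fps[OF assms]
  have RX: "fps_conv_radius (fps_X * gamma_fps \<alpha>) = \<infinity>"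
    using fps_conv_radius_mult[of fps_X "gamma_fps \<alpha>"] by (simp add: R)
  show "eval_fps (gamma_fps (\<alpha> + 1)) z = Gamma (\<alpha> + 1) + z * eval_fps (gamma_fps \<alpha>) z"
    unfolding gamma_fps_add_1 by (simp add: eval_fps_add eval_fps_mult R RX)
  have RD: "fps_conv_radius (fps_deriv (gamma_fps \<alpha>)) = \<infinity>"
    using fps_conv_radius_deriv[of "gamma_fps \<alpha>"] by (simp add: R)
  have R1: "fps_conv_radius (gamma_fps \<alpha> - fps_const (Gamma \<alpha>)) = \<infinity>"
    using fps_conv_radius_diff[of "gamma_fps \<alpha>" "fps_const (Gamma \<alpha>)"] by (simp add: R)
  have R2: "fps_conv_radius (fps_const \<alpha> * (gamma_fps \<alpha> - fps_const (Gamma \<alpha>))) = \<infinity>"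
    using fps_conv_radius_mult[of "fps_const \<alpha>" "gamma_fps \<alpha> - fps_const (Gamma \<alpha>)"] by (simp add: R1)
  have "z * eval_fps (fps_deriv (gamma_fps \<alpha>)) z = eval_fps (fps_X * fps_deriv (gamma_fps \<alpha>)) z"
    by (simp add: eval_fps_mult RD)
  also have "\<dots> = \<alpha> * (eval_fps (gamma_fps \<alpha>) z - Gamma \<alpha>) - z * eval_fps (gamma_fps \<alpha>) z"
    unfolding gamma_fps_ode[OF assms] by (simp add: eval_fps_diff eval_fps_mult R RX R1 R2)
  finally show "\<exists>g'. (eval_fps (gamma_fps \<alpha>) has_field_derivative g') (at z) \<and>
      z * g' = \<alpha> * (eval_fps (gamma_fps \<alpha>) z - Gamma \<alpha>) - z * eval_fps (gamma_fps \<alpha>) z"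
    using has_field_derivative_eval_fps[of z "gamma_fps \<alpha>" UNIV] R by auto
qed

lemma connected_slit_plane: "connected slit_plane"
proof -
  have "(\<real>\<^sub>\<ge>\<^sub>0 :: complex set) = complex_of_real ` {0..}"
    by (auto simp: complex_nonneg_Reals_iff complex_eq_iff image_iff intro!: bexI[of _ "Re _"])
  then show ?thesis
    using starlike_imp_connected[OF starlike_slotted_complex_plane_right[of 0]] by simp
qed

text \<open>
  Both \<open>fp_stieltjes \<alpha>\<close> and the entire series solve \<open>z * J' = \<alpha> * (J - Gamma \<alpha>) - z * J\<close>; the
  homogeneous solutions are the multiples of \<open>slit_power \<alpha> z * exp (- z)\<close>.
\<close>

lemma fp_stieltjes_representation:
  assumes "regular_exponent \<alpha>" "\<alpha> \<notin> \<int>"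
  shows "\<exists>c. \<forall>z\<in>slit_plane. fp_stieltjes \<alpha> z = c * exp (- z) * slit_power \<alpha> z + eval_fps (gamma_fps \<alpha>) z"
  using assms
proof (induction \<alpha> rule: regular_exponent_induct[where r = 2])
  case (base \<alpha>)
  \<comment> \<open>The difference of the two solutions times the integrating factor exp(z)
    z^(-\<alpha>); its derivative vanishes on the connected slit plane.\<close>
  define h where "h z = (fp_stieltjes \<alpha> z - eval_fps (gamma_fps \<alpha>) z) * exp z * slit_power (- \<alpha>) z" for z
  have deriv: "(h has_field_derivative 0) (at z)" if z: "z \<in> slit_plane" for z
  proof -
    have z': "z \<notin> \<real>\<^sub>\<ge>\<^sub>0" "z \<noteq> 0" using z by auto
    obtain J' where J: "(fp_stieltjes \<alpha> has_field_derivative J') (at z)"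
      "z * J' = \<alpha> * (fp_stieltjes \<alpha> z - Gamma \<alpha>) - z * fp_stieltjes \<alpha> z"
      using fp_stieltjes_ode[OF base(2) z'(1)] by blast
    obtain g' where g: "(eval_fps (gamma_fps \<alpha>) has_field_derivative g') (at z)"
      "z * g' = \<alpha> * (eval_fps (gamma_fps \<alpha>) z - Gamma \<alpha>) - z * eval_fps (gamma_fps \<alpha>) z"
      using eval_gamma_fps(2)[OF base(3)] by blast
    define u where "u = fp_stieltjes \<alpha> z - eval_fps (gamma_fps \<alpha>) z"
    define u' where "u' = J' - g'"
    have u: "z * u' = \<alpha> * u - z * u"
      unfolding u'_def right_diff_distrib J(2) g(2) by (simp add: u_def algebra_simps)
    have "(h has_field_derivative (u' * exp z + u * exp z) * slit_power (- \<alpha>) z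
        + u * exp z * (- \<alpha> / z * slit_power (- \<alpha>) z)) (at z)"
      unfolding h_def u_def u'_def
      by (rule DERIV_cong[OF DERIV_mult[OF DERIV_mult[OF DERIV_diff[OF J(1) g(1)] DERIV_exp]
          has_field_derivative_slit_power[OF z'(1), of "- \<alpha>"]]]) (simp add: algebra_simps)
    moreover have "(u' * exp z + u * exp z) * slit_power (- \<alpha>) z + u * exp z * (- \<alpha> / z * slit_power (- \<alpha>) z)
        = (z * u' + z * u - \<alpha> * u) / z * (exp z * slit_power (- \<alpha>) z)"
      using z'(2) by (simp add: field_simps)
    ultimately show ?thesis using u by simp
  qed
  have cont: "continuous_on slit_plane h"
    using deriv DERIV_isCont continuous_at_imp_continuous_on by blast
  obtain c where c: "\<And>z. z \<in> slit_plane \<Longrightarrow> h z = c"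
    using DERIV_zero_connected_constant[OF connected_slit_plane open_slit_plane finite.emptyI cont] deriv by auto
  have "fp_stieltjes \<alpha> z = c * exp (- z) * slit_power \<alpha> z + eval_fps (gamma_fps \<alpha>) z" if "z \<in> slit_plane" for z
    using c[OF that] slit_power_nonzero[of \<alpha> z]
    by (simp add: h_def slit_power_minus exp_minus field_simps)
  then show ?case by blast
next
  case (step \<alpha>)
  have "\<alpha> + 1 \<notin> \<int>" using step(3) Ints_diff[of "\<alpha> + 1" 1] by auto
  then obtain c where c: "\<And>z. z \<in> slit_plane \<Longrightarrow>
      fp_stieltjes (\<alpha> + 1) z = c * exp (- z) * slit_power (\<alpha> + 1) z + eval_fps (gamma_fps (\<alpha> + 1)) z"
    using step(2) by blast
  \<comment> \<open>The constant c is the same for \<alpha> and \<alpha> + 1, because all terms of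
    the shift relation carry the common factor z.\<close>
  have "fp_stieltjes \<alpha> z = c * exp (- z) * slit_power \<alpha> z + eval_fps (gamma_fps \<alpha>) z" if z: "z \<in> slit_plane" for z
  proof -
    have z': "z \<notin> \<real>\<^sub>\<ge>\<^sub>0" "z \<noteq> 0" using z by auto
    have "fp_stieltjes (\<alpha> + 1) z - Gamma (\<alpha> + 1) =
        z * (c * exp (- z) * slit_power \<alpha> z + eval_fps (gamma_fps \<alpha>) z)"
      unfolding c[OF z] slit_power_add_1[OF z'(1)] eval_gamma_fps(1)[OF step(3)] by (simp add: algebra_simps)
    then show ?thesis
      using fp_stieltjes_unshift[OF step(1) z'(1)] z'(2) by (simp add: mult.assoc[symmetric])
  qed
  then show ?case by blast
qed

section \<open>Behaviour at the origin\<close>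

lemma bounded_at_0_isCont:
  assumes "isCont f 0"
  shows "bounded_at_0 f"
proof -
  have "(f \<longlongrightarrow> f 0) (at 0 within slit_plane)"
    using assms continuous_at_imp_continuous_at_within continuous_within by blast
  then show ?thesis unfolding bounded_at_0_def
    by (intro bigoI_tendsto[where c = "f 0"]) auto
qed

lemma bounded_at_0_cong:
  assumes "bounded_at_0 f" "\<And>z. z \<in> slit_plane \<Longrightarrow> f z = g z"
  shows "bounded_at_0 g"
proof -
  have "\<forall>\<^sub>F z in at 0 within slit_plane. f z = g z"
    using assms(2) by (auto simp: eventually_at_filter)
  from landau_o.big.in_cong[OF this] show ?thesis using assms(1) by (simp add: bounded_at_0_def)
qed

lemma power_germ_bounded_cong:
  assumes "power_germ_bounded \<alpha> f" "\<And>z. z \<in> slit_plane \<Longrightarrow> f z = g z"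
  shows "power_germ_bounded \<alpha> g"
proof -
  obtain f0 where 1: "f0 analytic_on {0}" "bounded_at_0 (\<lambda>z. f z - slit_power \<alpha> z * f0 z)"
    using assms by (auto simp: power_germ_bounded_def)
  have "bounded_at_0 (\<lambda>z. g z - slit_power \<alpha> z * f0 z)"
    by (rule bounded_at_0_cong[OF 1(2)]) (use assms(2) in simp)
  then show ?thesis using 1(1) by (auto simp: power_germ_bounded_def)
qed

lemma bounded_at_0_add: "bounded_at_0 f \<Longrightarrow> bounded_at_0 g \<Longrightarrow> bounded_at_0 (\<lambda>z. f z + g z)"
  unfolding bounded_at_0_def by (rule sum_in_bigo)

lemma bounded_at_0_cmult: "bounded_at_0 f \<Longrightarrow> bounded_at_0 (\<lambda>z. c * f z)"
  unfolding bounded_at_0_def by simp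

lemma power_germ_bounded_add:
  assumes "power_germ_bounded \<alpha> f" "power_germ_bounded \<alpha> g"
  shows "power_germ_bounded \<alpha> (\<lambda>z. f z + g z)"
proof -
  obtain f0 g0 where 1: "f0 analytic_on {0}" "bounded_at_0 (\<lambda>z. f z - slit_power \<alpha> z * f0 z)"
    "g0 analytic_on {0}" "bounded_at_0 (\<lambda>z. g z - slit_power \<alpha> z * g0 z)"
    using assms by (auto simp: power_germ_bounded_def)
  have "bounded_at_0 (\<lambda>z. f z + g z - slit_power \<alpha> z * (f0 z + g0 z))"
    using bounded_at_0_add[OF 1(2,4)] by (simp add: algebra_simps)
  then show ?thesis
    unfolding power_germ_bounded_def using 1 by (intro exI[of _ "\<lambda>z. f0 z + g0 z"]) (auto intro!: analytic_intros)
qed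

lemma power_germ_bounded_cmult:
  assumes "power_germ_bounded \<alpha> f"
  shows "power_germ_bounded \<alpha> (\<lambda>z. c * f z)"
proof -
  obtain f0 where 1: "f0 analytic_on {0}" "bounded_at_0 (\<lambda>z. f z - slit_power \<alpha> z * f0 z)"
    using assms by (auto simp: power_germ_bounded_def)
  have "bounded_at_0 (\<lambda>z. c * f z - slit_power \<alpha> z * (c * f0 z))"
    using bounded_at_0_cmult[OF 1(2), of c] by (simp add: algebra_simps)
  then show ?thesis
    unfolding power_germ_bounded_def using 1 by (intro exI[of _ "\<lambda>z. c * f0 z"]) (auto intro!: analytic_intros)
qed

text \<open>The surplus factor z is absorbed by the germ. This lets the higher powers of t in a
  polynomial density satisfy the condition at exponent \<alpha>.\<close>

lemma power_germ_bounded_lower_exponent: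
  assumes "power_germ_bounded (\<alpha> + 1) f"
  shows "power_germ_bounded \<alpha> f"
proof -
  obtain f0 where 1: "f0 analytic_on {0}" "bounded_at_0 (\<lambda>z. f z - slit_power (\<alpha> + 1) z * f0 z)"
    using assms by (auto simp: power_germ_bounded_def)
  have "bounded_at_0 (\<lambda>z. f z - slit_power \<alpha> z * (z * f0 z))"
    by (rule bounded_at_0_cong[OF 1(2)]) (use slit_power_add_1 in auto)
  then show ?thesis
    unfolding power_germ_bounded_def using 1 by (intro exI[of _ "\<lambda>z. z * f0 z"]) (auto intro!: analytic_intros)
qed

lemma regular_exponent_Ints:
  assumes "regular_exponent \<alpha>" "\<alpha> \<noteq> 0" "\<alpha> \<in> \<int>"
  shows "Re \<alpha> \<ge> 1"
proof -
  obtain k :: int where k: "\<alpha> = of_int k" using assms(3) by (elim Ints_cases)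
  have "k > 0"
  proof (rule ccontr)
    assume "\<not> k > 0"
    then have "\<alpha> = - of_nat (nat (- k))" "nat (- k) \<ge> 1" using assms(2) k by auto
    then show False using assms(1) by blast
  qed
  then show ?thesis using k by simp
qed

lemma power_germ_bounded_fp_stieltjes:
  assumes "regular_exponent \<alpha>" "\<alpha> \<noteq> 0"
  shows "power_germ_bounded \<alpha> (fp_stieltjes \<alpha>)"
proof (cases "\<alpha> \<in> \<int>")
  case True
  then obtain C where C: "\<And>z. z \<in> slit_plane \<Longrightarrow> norm (fp_stieltjes \<alpha> z) \<le> C"
    using fp_stieltjes_bounded[OF regular_exponent_Ints[OF assms]] by blast
  have "bounded_at_0 (\<lambda>z. fp_stieltjes \<alpha> z - slit_power \<alpha> z * 0)"
    unfolding bounded_at_0_def by (intro bigoI[where c = C]) (auto simp: eventually_at_filter C)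
  then show ?thesis unfolding power_germ_bounded_def by (intro exI[of _ "\<lambda>_. 0"]) auto
next
  case False
  obtain c where c: "\<And>z. z \<in> slit_plane \<Longrightarrow>
      fp_stieltjes \<alpha> z = c * exp (- z) * slit_power \<alpha> z + eval_fps (gamma_fps \<alpha>) z"
    using fp_stieltjes_representation[OF assms(1) False] by blast
  have "bounded_at_0 (eval_fps (gamma_fps \<alpha>))"
    using fps_conv_radius_gamma_fps[OF False] by (intro bounded_at_0_isCont continuous_eval_fps) simp
  then have "bounded_at_0 (\<lambda>z. fp_stieltjes \<alpha> z - slit_power \<alpha> z * (c * exp (- z)))"
    by (rule bounded_at_0_cong) (use c in simp)
  then show ?thesis
    unfolding power_germ_bounded_def by (intro exI[of _ "\<lambda>z. c * exp (- z)"]) (auto intro!: analytic_intros)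
qed

section \<open>Laguerre polynomials and orthogonality\<close>

abbreviation cauchy_factor :: complex where
  "cauchy_factor \<equiv> 1 / (2 * of_real pi * \<i>)"

text \<open>The transform without the factor 1 / (2 \<pi> \<i>), in a form open to induction over
  \<open>pCons\<close>; it agrees with \<open>fp_cauchy\<close> up to that factor on the slit
  plane.\<close>

definition poly_stieltjes :: "complex \<Rightarrow> complex poly \<Rightarrow> complex \<Rightarrow> complex" where
  "poly_stieltjes \<alpha> p z = coeff_pairing (\<lambda>j. fp_stieltjes (\<alpha> + of_nat j) z) p"

lemma poly_stieltjes_0 [simp]: "poly_stieltjes \<alpha> 0 = (\<lambda>_. 0)"
  by (auto simp: poly_stieltjes_def)

lemma poly_stieltjes_pCons:
  "poly_stieltjes \<alpha> (pCons a p) = (\<lambda>z. a * fp_stieltjes \<alpha> z + poly_stieltjes (\<alpha> + 1) p z)"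
  by (auto simp: poly_stieltjes_def coeff_pairing_pCons add_ac)

lemma fp_cauchy_eq_poly_stieltjes:
  "regular_exponent \<alpha> \<Longrightarrow> z \<in> slit_plane \<Longrightarrow> fp_cauchy \<alpha> p z = cauchy_factor * poly_stieltjes \<alpha> p z"
  by (simp add: fp_cauchy_eq poly_stieltjes_def)

lemma holomorphic_poly_stieltjes:
  "regular_exponent \<alpha> \<Longrightarrow> poly_stieltjes \<alpha> p holomorphic_on slit_plane"
proof (induction p arbitrary: \<alpha>)
  case (pCons a p)
  show ?case
    unfolding poly_stieltjes_pCons
    by (intro holomorphic_intros holomorphic_fp_stieltjes pCons.IH regular_exponent_add_1 pCons.prems)
qed simp

lemma has_jump_poly_stieltjes:
  assumes "regular_exponent \<alpha>" "x > 0"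
  shows "has_jump (poly_stieltjes \<alpha> p) x (2 * of_real pi * \<i> * (poly p (of_real x) * (real_weight \<alpha> x)))"
  using assms(1)
proof (induction p arbitrary: \<alpha>)
  case 0
  then show ?case by (simp add: has_jump_isCont)
next
  case (pCons a p)
  have jump: "has_jump (poly_stieltjes \<alpha> (pCons a p)) x (a * (2 * of_real pi * \<i> * (real_weight \<alpha> x)) +
      2 * of_real pi * \<i> * (poly p (of_real x) * (real_weight (\<alpha> + 1) x)))"
    unfolding poly_stieltjes_pCons
    using has_jump_mult[OF has_jump_fp_stieltjes[OF pCons.prems assms(2)], of "\<lambda>_. a"]
    by (intro has_jump_add pCons.IH regular_exponent_add_1 pCons.prems) simp
  have eq: "a * (2 * of_real pi * \<i> * (real_weight \<alpha> x)) +
      2 * of_real pi * \<i> * (poly p (of_real x) * (real_weight (\<alpha> + 1) x))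
    = 2 * of_real pi * \<i> * (poly (pCons a p) (of_real x) * (real_weight \<alpha> x))"
    by (simp add: powr_add ring_distribs mult_ac)
  show ?case using jump unfolding eq .
qed

lemma poly_stieltjes_bigo_inverse:
  "regular_exponent \<alpha> \<Longrightarrow> poly_stieltjes \<alpha> p \<in> O[slit_at_infinity](inverse)"
proof (induction p arbitrary: \<alpha>)
  case (pCons a p)
  have "(\<lambda>z. a * fp_stieltjes \<alpha> z) \<in> O[slit_at_infinity](inverse)"
    using fp_stieltjes_bigo_inverse[OF pCons.prems] by simp
  then show ?case
    unfolding poly_stieltjes_pCons
    by (intro sum_in_bigo pCons.IH regular_exponent_add_1 pCons.prems)
qed simp

lemma regular_exponent_add_1_nonzero: "regular_exponent \<alpha> \<Longrightarrow> \<alpha> + 1 \<noteq> 0"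
  using regular_exponent_nonzero[of \<alpha> 0] by simp

text \<open>The induction passes to \<alpha> + 1, which is again nonzero because -1 is not a regular
  exponent.\<close>

lemma power_germ_bounded_poly_stieltjes:
  "regular_exponent \<alpha> \<Longrightarrow> \<alpha> \<noteq> 0 \<Longrightarrow> power_germ_bounded \<alpha> (poly_stieltjes \<alpha> p)"
proof (induction p arbitrary: \<alpha>)
  case 0
  have "bounded_at_0 (\<lambda>z. 0 - slit_power \<alpha> z * 0)" by (simp add: bounded_at_0_isCont)
  then show ?case unfolding power_germ_bounded_def by (intro exI[of _ "\<lambda>_. 0"]) auto
next
  case (pCons a p)
  have "power_germ_bounded (\<alpha> + 1) (poly_stieltjes (\<alpha> + 1) p)"
    by (intro pCons.IH regular_exponent_add_1 regular_exponent_add_1_nonzero pCons.prems)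
  from power_germ_bounded_lower_exponent[OF this] show ?case
    unfolding poly_stieltjes_pCons
    by (intro power_germ_bounded_add power_germ_bounded_cmult power_germ_bounded_fp_stieltjes pCons.prems)
qed

lemma poly_stieltjes_shift:
  assumes "regular_exponent \<alpha>" and z: "z \<in> slit_plane"
  shows "poly_stieltjes \<alpha> (pCons 0 p) z = z * poly_stieltjes \<alpha> p z + gamma_functional \<alpha> p"
  using assms(1)
proof (induction p arbitrary: \<alpha>)
  case 0
  then show ?case by (simp add: gamma_functional_def poly_stieltjes_pCons)
next
  case (pCons a p)
  have "poly_stieltjes (\<alpha> + 1) (pCons 0 p) z = z * poly_stieltjes (\<alpha> + 1) p z + gamma_functional (\<alpha> + 1) p"
    by (intro pCons.IH regular_exponent_add_1 pCons.prems)
  moreover have "fp_stieltjes (\<alpha> + 1) z = z * fp_stieltjes \<alpha> z + Gamma (\<alpha> + 1)"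
    using z pCons.prems by (intro fp_stieltjes_shift) auto
  ultimately show ?case
    by (simp add: poly_stieltjes_pCons gamma_functional_pCons ring_distribs mult_ac)
qed

text \<open>Translates orthogonality into decay: each vanishing moment lets one more factor t leave
  the integral as a factor z, while the left side stays O(1/z).\<close>

lemma poly_stieltjes_monom_mult:
  assumes "regular_exponent \<alpha>" "z \<in> slit_plane" "\<And>i. i < k \<Longrightarrow> gamma_functional \<alpha> (monom 1 i * p) = 0"
  shows "poly_stieltjes \<alpha> (monom 1 k * p) z = z ^ k * poly_stieltjes \<alpha> p z"
  using assms(3)
proof (induction k)
  case (Suc k)
  have "monom 1 (Suc k) * p = pCons 0 (monom 1 k * p)" by (simp add: monom_Suc)
  then show ?case
    using Suc poly_stieltjes_shift[OF assms(1,2), of "monom 1 k * p"] by (simp add: mult_ac)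
qed simp

text \<open>
  The derivative of \<open>t powr \<beta> * poly q t * exp (- t)\<close> is
  \<open>t powr (\<beta> - 1) * poly (rodrigues_step \<beta> q) t * exp (- t)\<close>.
\<close>

definition rodrigues_step :: "complex \<Rightarrow> complex poly \<Rightarrow> complex poly" where
  "rodrigues_step \<beta> q = smult \<beta> q + pCons 0 (pderiv q) - pCons 0 q"

text \<open>The polynomial factor of the j-th derivative of t^\<gamma> exp(-t), which is
  t^(\<gamma>-j) times this polynomial times exp(-t).\<close>

primrec rodrigues :: "complex \<Rightarrow> nat \<Rightarrow> complex poly" where
  "rodrigues \<gamma> 0 = 1"
| "rodrigues \<gamma> (Suc j) = rodrigues_step (\<gamma> - of_nat j) (rodrigues \<gamma> j)"

lemma degree_rodrigues_le: "degree (rodrigues \<gamma> j) \<le> j"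
proof (induction j)
  case (Suc j)
  have "degree (pderiv (rodrigues \<gamma> j)) \<le> j" using Suc by (simp add: degree_pderiv)
  then show ?case
    using Suc by (auto simp: rodrigues_step_def intro!: degree_diff_le degree_add_le
        order_trans[OF degree_smult_le] order_trans[OF degree_pCons_le])
qed simp

lemma coeff_rodrigues: "coeff (rodrigues \<gamma> j) j = (- 1) ^ j"
proof (induction j)
  case (Suc j)
  have "coeff (rodrigues \<gamma> j) (Suc j) = 0"
    using degree_rodrigues_le[of \<gamma> j] by (intro coeff_eq_0) simp
  then show ?case using Suc by (simp add: rodrigues_step_def coeff_pderiv)
qed simp

text \<open>Sharpens \<open>laguerre_deriv_iter\<close> by naming the polynomial, so that its
  leading coefficient and orthogonality become accessible.\<close>

lemma higher_deriv_laguerre_weight: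
  assumes "j \<le> m" "Re z > 0"
  shows "(deriv ^^ j) (\<lambda>z. z ^ m * laguerre_weight \<alpha> z) z
    = z ^ (m - j) * poly (rodrigues (\<alpha> + of_nat m) j) z * laguerre_weight \<alpha> z"
  using assms
proof (induction j arbitrary: z)
  case (Suc j)
  obtain k where k: "m - j = Suc k" "m - Suc j = k" "m = j + Suc k"
    using Suc.prems by (metis Suc_diff_Suc Suc_le_lessD le_add_diff_inverse less_imp_le)
  define q where "q = rodrigues (\<alpha> + of_nat m) j"
  define r where "r = rodrigues (\<alpha> + of_nat m) (Suc j)"
  have r: "r = smult (of_nat (Suc k) + \<alpha>) q + pCons 0 (pderiv q) - pCons 0 q"
    unfolding r_def q_def by (simp add: rodrigues_step_def k(3) add_ac)
  have "\<forall>\<^sub>F z in nhds z. Re z > 0"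
    using Suc.prems eventually_nhds_in_open[OF open_halfspace_Re_gt, of z 0] by simp
  then have ev: "\<forall>\<^sub>F z in nhds z. (deriv ^^ j) (\<lambda>z. z ^ m * laguerre_weight \<alpha> z) z
      = z ^ Suc k * poly q z * laguerre_weight \<alpha> z"
    by eventually_elim (use Suc k(1) q_def in auto)
  have nz: "z \<noteq> 0" "z \<notin> \<real>\<^sub>\<le>\<^sub>0" using Suc.prems by (auto simp: complex_nonpos_Reals_iff)
  have pw: "z powr \<alpha> = z * z powr (\<alpha> - 1)" using nz by (simp add: powr_diff)
  have "((\<lambda>z. z ^ Suc k * poly q z * laguerre_weight \<alpha> z) has_field_derivative
      z ^ k * poly r z * laguerre_weight \<alpha> z) (at z)"
    unfolding laguerre_weight_def r using nz
    by (auto intro!: derivative_eq_intros simp del: power_Suc) (simp add: pw algebra_simps)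
  then have "deriv (\<lambda>z. z ^ Suc k * poly q z * laguerre_weight \<alpha> z) z
      = z ^ k * poly r z * laguerre_weight \<alpha> z" by (rule DERIV_imp_deriv)
  with deriv_cong_ev[OF ev refl] k show ?case by (simp add: r_def)
qed simp

lemma laguerre_eq: "laguerre \<alpha> m = rodrigues (\<alpha> + of_nat m) m"
  unfolding laguerre_def
proof (rule the1_equality[OF laguerre_ex1])
  show "\<forall>x::real. x > 0 \<longrightarrow> poly (rodrigues (\<alpha> + of_nat m) m) (of_real x) =
      inverse (laguerre_weight \<alpha> (of_real x)) * (deriv ^^ m) (\<lambda>z. z ^ m * laguerre_weight \<alpha> z) (of_real x)"
    using higher_deriv_laguerre_weight[of m m] by (auto simp: laguerre_weight_def field_simps)
qed

lemma degree_monic_laguerre_le: "degree (monic_laguerre \<alpha> m) \<le> m"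
  unfolding monic_laguerre_def laguerre_eq
  using degree_rodrigues_le by (rule order_trans[OF degree_smult_le])

lemma coeff_monic_laguerre: "coeff (monic_laguerre \<alpha> m) m = 1"
  by (simp add: monic_laguerre_def laguerre_eq coeff_rodrigues flip: power_mult_distrib)

section \<open>Integration by parts for the moment functional\<close>

lemma gamma_functional_add: "gamma_functional \<alpha> (p + q) = gamma_functional \<alpha> p + gamma_functional \<alpha> q"
  by (simp add: gamma_functional_def coeff_pairing_add)

lemma gamma_functional_smult: "gamma_functional \<alpha> (smult a p) = a * gamma_functional \<alpha> p"
  by (simp add: gamma_functional_def coeff_pairing_smult)

lemma gamma_functional_0 [simp]: "gamma_functional \<alpha> 0 = 0"
  by (simp add: gamma_functional_def)

text \<open>The finite part of a total derivative vanishes: with weight t^\<alpha> exp(-t), the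
  argument is the derivative of t^(\<alpha>+1) q exp(-t). On coefficients this is the recurrence of
  Gamma.\<close>

lemma gamma_functional_rodrigues_step:
  "regular_exponent \<alpha> \<Longrightarrow> gamma_functional \<alpha> (rodrigues_step (\<alpha> + 1) q) = 0"
proof (induction q arbitrary: \<alpha>)
  case (pCons a q)
  have "rodrigues_step (\<alpha> + 1) (pCons a q) =
      [: (\<alpha> + 1) * a, - a :] + pCons 0 (rodrigues_step (\<alpha> + 1 + 1) q)"
    unfolding poly_eq_poly_eq_iff[symmetric]
    by (rule ext) (simp add: rodrigues_step_def pderiv_pCons algebra_simps)
  then show ?case
    using pCons.IH[OF regular_exponent_add_1[OF pCons.prems]] Gamma_regular_exponent[OF pCons.prems]
    by (simp add: gamma_functional_add gamma_functional_pCons)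
qed (simp add: rodrigues_step_def)

text \<open>Integration by parts: the preceding lemma applied to r q, whose Rodrigues step obeys the
  product rule.\<close>

lemma gamma_functional_mult_rodrigues_step:
  assumes "regular_exponent \<alpha>"
  shows "gamma_functional \<alpha> (r * rodrigues_step (\<alpha> + 1) q) = - gamma_functional (\<alpha> + 1) (pderiv r * q)"
proof -
  have "rodrigues_step (\<alpha> + 1) (r * q) = r * rodrigues_step (\<alpha> + 1) q + pCons 0 (pderiv r * q)"
    by (simp add: rodrigues_step_def pderiv_mult ring_distribs mult_ac)
  then have "gamma_functional \<alpha> (r * rodrigues_step (\<alpha> + 1) q) + gamma_functional (\<alpha> + 1) (pderiv r * q) = 0"
    using gamma_functional_rodrigues_step[OF assms, of "r * q"]
    by (simp add: gamma_functional_add gamma_functional_pCons)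
  then show ?thesis by (simp add: eq_neg_iff_add_eq_0)
qed

text \<open>Each integration by parts moves one derivative onto r and raises the exponent by 1;
  after j of them the exponent is \<alpha> + m, whatever j was.\<close>

lemma gamma_functional_mult_rodrigues:
  assumes "regular_exponent \<alpha>" "j \<le> m"
  shows "gamma_functional (\<alpha> + of_nat (m - j)) (r * rodrigues (\<alpha> + of_nat m) j) =
    (- 1) ^ j * gamma_functional (\<alpha> + of_nat m) ((pderiv ^^ j) r)"
  using assms(2)
proof (induction j arbitrary: r)
  case (Suc j)
  have reg: "regular_exponent (\<alpha> + of_nat k)" for k
  proof (induction k)
    case (Suc k)
    from regular_exponent_add_1[OF this] show ?case by (simp add: add_ac)
  qed (use assms in simp)
  have eq: "\<alpha> + of_nat m - of_nat j = \<alpha> + of_nat (m - Suc j) + 1" "\<alpha> + of_nat (m - Suc j) + 1 = \<alpha> + of_nat (m - j)"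
    using Suc.prems by (auto simp: of_nat_diff)
  have "gamma_functional (\<alpha> + of_nat (m - Suc j)) (r * rodrigues (\<alpha> + of_nat m) (Suc j)) =
      - gamma_functional (\<alpha> + of_nat (m - Suc j) + 1) (pderiv r * rodrigues (\<alpha> + of_nat m) j)"
    unfolding rodrigues.simps eq(1) by (rule gamma_functional_mult_rodrigues_step[OF reg])
  also have "\<dots> = (- 1) ^ Suc j * gamma_functional (\<alpha> + of_nat m) ((pderiv ^^ Suc j) r)"
    unfolding eq(2) using Suc by (simp add: funpow_Suc_right del: funpow.simps)
  finally show ?case .
qed simp

lemma gamma_functional_mult_monic_laguerre:
  assumes "regular_exponent \<alpha>"
  shows "gamma_functional \<alpha> (r * monic_laguerre \<alpha> m) = gamma_functional (\<alpha> + of_nat m) ((pderiv ^^ m) r)"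
  using gamma_functional_mult_rodrigues[OF assms order_refl, of m r]
  by (simp add: monic_laguerre_def laguerre_eq gamma_functional_smult flip: mult.assoc power_mult_distrib)

lemma higher_pderiv_degree_le:
  assumes "degree r \<le> m"
  shows "(pderiv ^^ m) r = [:fact m * coeff r m:]"
proof (rule poly_eqI)
  fix k
  show "coeff ((pderiv ^^ m) r) k = coeff [:fact m * coeff r m:] k"
  proof (cases k)
    case 0
    then show ?thesis by (simp add: coeff_higher_pderiv pochhammer_fact)
  next
    case (Suc i)
    then have "coeff r (k + m) = 0" using assms by (intro coeff_eq_0) simp
    then show ?thesis using Suc by (simp add: coeff_higher_pderiv)
  qed
qed

text \<open>Only the top coefficient of r survives m derivatives. For r monic of degree m this is
  the norm m! Gamma(\<alpha> + m + 1), whose value at m = n - 1 enters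
  \<open>laguerre_c\<close>.\<close>

lemma gamma_functional_orthogonality:
  assumes "regular_exponent \<alpha>" "degree r \<le> m"
  shows "gamma_functional \<alpha> (r * monic_laguerre \<alpha> m) = fact m * coeff r m * Gamma (\<alpha> + 1 + of_nat m)"
  using gamma_functional_mult_monic_laguerre[OF assms(1)] higher_pderiv_degree_le[OF assms(2)]
  by (simp add: gamma_functional_pCons add_ac)

section \<open>The rows of the Riemann-Hilbert problem\<close>

lemma upper_at_nontrivial: "upper_at x \<noteq> bot"
  unfolding at_within_eq_bot_iff not_not closure_approachable
proof (intro allI impI)
  fix e :: real assume "e > 0"
  then show "\<exists>y\<in>{z. Im z > 0} - {of_real x}. dist y (of_real x) < e"
    by (intro bexI[of _ "Complex x (e / 2)"]) (auto simp: dist_complex_def cmod_def)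
qed

lemma lower_at_nontrivial: "lower_at x \<noteq> bot"
  unfolding at_within_eq_bot_iff not_not closure_approachable
proof (intro allI impI)
  fix e :: real assume "e > 0"
  then show "\<exists>y\<in>{z. Im z < 0} - {of_real x}. dist y (of_real x) < e"
    by (intro bexI[of _ "Complex x (- e / 2)"]) (auto simp: dist_complex_def cmod_def)
qed

lemma slit_at_infinity_nontrivial: "slit_at_infinity \<noteq> bot"
proof
  assume "slit_at_infinity = bot"
  then have "\<forall>\<^sub>F z in slit_at_infinity. False" by simp
  then obtain R where R: "\<And>z. z \<in> slit_plane \<Longrightarrow> R \<le> norm z \<Longrightarrow> False"
    unfolding eventually_slit_at_infinity by blast
  show False
    by (rule R[of "- of_real (\<bar>R\<bar> + 1)"]) (auto simp: complex_nonneg_Reals_iff simp del: of_real_add)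
qed

lemma const_bigo_inverse_imp_0:
  fixes c :: complex
  assumes "(\<lambda>_. c) \<in> O[slit_at_infinity](inverse)"
  shows "c = 0"
proof -
  have "(inverse \<longlongrightarrow> (0::complex)) slit_at_infinity"
    using tendsto_inverse_0 by (rule tendsto_mono[rotated]) simp
  then have lim: "((\<lambda>z. C * norm (inverse z :: complex)) \<longlongrightarrow> 0) slit_at_infinity" for C :: real
    by (intro tendsto_mult_right_zero tendsto_norm_zero)
  obtain C where "\<forall>\<^sub>F z in slit_at_infinity. norm c \<le> C * norm (inverse z)"
    using assms by (auto elim: landau_o.bigE)
  then have "((\<lambda>_. c) \<longlongrightarrow> 0) slit_at_infinity"
    using lim by (rule Lim_null_comparison)
  then show ?thesis
    using tendsto_unique[OF slit_at_infinity_nontrivial] tendsto_const by blast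
qed

lemma mat2_mult:
  fixes A :: "complex^2^2"
  shows "(A ** mat2 a b c d) $ i $ 1 = A $ i $ 1 * a + A $ i $ 2 * c"
    and "(A ** mat2 a b c d) $ i $ 2 = A $ i $ 1 * b + A $ i $ 2 * d"
  by (simp_all add: matrix_matrix_mult_def sum_2)

text \<open>The jump matrix and the diagonal matrix at infinity multiply from the right, so each row
  satisfies its own problem; a and b are the entries of that row of the identity. The conditions are
  linear, and a difference of two solutions has a = b = 0.\<close>

definition laguerre_row ::
  "complex \<Rightarrow> nat \<Rightarrow> complex \<Rightarrow> complex \<Rightarrow> (complex \<Rightarrow> complex) \<Rightarrow> (complex \<Rightarrow> complex) \<Rightarrow> bool" where
  "laguerre_row \<alpha> n a b u v \<longleftrightarrow>
    u holomorphic_on slit_plane \<and> v holomorphic_on slit_plane \<and>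
    (\<forall>x>0. \<exists>l. (u \<longlongrightarrow> l) (upper_at x) \<and> (u \<longlongrightarrow> l) (lower_at x) \<and>
      has_jump v x (l * (real_weight \<alpha> x))) \<and>
    (\<lambda>z. u z * inverse (z ^ n) - a) \<in> O[slit_at_infinity](inverse) \<and>
    (\<lambda>z. v z * z ^ n - b) \<in> O[slit_at_infinity](inverse) \<and>
    bounded_at_0 u \<and> power_germ_bounded \<alpha> v"

lemma laguerre_RHP_imp_row:
  fixes Y :: "complex \<Rightarrow> complex^2^2"
  assumes "laguerre_RHP \<alpha> n Y"
  shows "laguerre_row \<alpha> n ((mat 1 :: complex^2^2) $ i $ 1) ((mat 1 :: complex^2^2) $ i $ 2) (\<lambda>z. Y z $ i $ 1) (\<lambda>z. Y z $ i $ 2)"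
  unfolding laguerre_row_def
proof (intro conjI allI impI)
  show "(\<lambda>z. Y z $ i $ 1) holomorphic_on slit_plane" "(\<lambda>z. Y z $ i $ 2) holomorphic_on slit_plane"
    using assms by (auto simp: laguerre_RHP_def analytic_imp_holomorphic)
  show "bounded_at_0 (\<lambda>z. Y z $ i $ 1)" "power_germ_bounded \<alpha> (\<lambda>z. Y z $ i $ 2)"
    using assms by (auto simp: laguerre_RHP_def)
  show "\<exists>l. ((\<lambda>z. Y z $ i $ 1) \<longlongrightarrow> l) (upper_at x) \<and> ((\<lambda>z. Y z $ i $ 1) \<longlongrightarrow> l) (lower_at x) \<and>
      has_jump (\<lambda>z. Y z $ i $ 2) x (l * (real_weight \<alpha> x))" if x: "x > 0" for x
  proof -
    obtain U L where lim: "(Y \<longlongrightarrow> U) (upper_at x)" "(Y \<longlongrightarrow> L) (lower_at x)"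
      using assms x unfolding laguerre_RHP_def by blast
    have "Lim (upper_at x) Y = Lim (lower_at x) Y ** mat2 1 (real_weight \<alpha> x) 0 1"
      using assms x unfolding laguerre_RHP_def by blast
    then have UL: "U = L ** mat2 1 (real_weight \<alpha> x) 0 1"
      using tendsto_Lim[OF upper_at_nontrivial lim(1)] tendsto_Lim[OF lower_at_nontrivial lim(2)] by simp
    note ent = tendsto_vec_nth[OF tendsto_vec_nth[OF lim(1)]] tendsto_vec_nth[OF tendsto_vec_nth[OF lim(2)]]
    have "U $ i $ 1 = L $ i $ 1" "U $ i $ 2 - L $ i $ 2 = L $ i $ 1 * (real_weight \<alpha> x)"
      unfolding UL mat2_mult by simp_all
    then show ?thesis
      using ent(1)[of i 1] ent(2)[of i 1] has_jumpI[OF ent(1)[of i 2] ent(2)[of i 2]] by metis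
  qed
  obtain E :: "complex \<Rightarrow> complex^2^2" where E: "\<And>i j. (\<lambda>z. E z $ i $ j) \<in> O[slit_at_infinity](\<lambda>z. inverse z)"
    "\<forall>\<^sub>F z in slit_at_infinity. Y z = (mat 1 + E z) ** mat2 (z ^ n) 0 0 (z powi (- int n))"
    using assms unfolding laguerre_RHP_def by blast
  have 1: "\<forall>\<^sub>F z in slit_at_infinity. Y z $ i $ 1 * inverse (z ^ n) - (mat 1 :: complex^2^2) $ i $ 1 = E z $ i $ 1"
    using E(2) eventually_in_slit
  proof eventually_elim
    case (elim z)
    have "z \<noteq> 0" using elim(2) by auto
    then show ?case unfolding elim(1) mat2_mult by (simp add: mult.assoc)
  qed
  show "(\<lambda>z. Y z $ i $ 1 * inverse (z ^ n) - (mat 1 :: complex^2^2) $ i $ 1) \<in> O[slit_at_infinity](inverse)"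
    using landau_o.big.in_cong[OF 1, of inverse] E(1) by blast
  have 2: "\<forall>\<^sub>F z in slit_at_infinity. Y z $ i $ 2 * z ^ n - (mat 1 :: complex^2^2) $ i $ 2 = E z $ i $ 2"
    using E(2) eventually_in_slit
  proof eventually_elim
    case (elim z)
    have "z \<noteq> 0" using elim(2) by auto
    then show ?case unfolding elim(1) mat2_mult by (simp add: mult.assoc power_int_minus)
  qed
  show "(\<lambda>z. Y z $ i $ 2 * z ^ n - (mat 1 :: complex^2^2) $ i $ 2) \<in> O[slit_at_infinity](inverse)"
    using landau_o.big.in_cong[OF 2, of inverse] E(1) by blast
qed

lemma tendsto_mat2I:
  fixes Y :: "complex \<Rightarrow> complex^2^2" and L :: "complex^2^2"
  assumes "\<And>i. ((\<lambda>z. Y z $ i $ 1) \<longlongrightarrow> L $ i $ 1) F" "\<And>i. ((\<lambda>z. Y z $ i $ 2) \<longlongrightarrow> L $ i $ 2) F"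
  shows "(Y \<longlongrightarrow> L) F"
proof (intro vec_tendstoI)
  fix i j :: 2
  show "((\<lambda>z. Y z $ i $ j) \<longlongrightarrow> L $ i $ j) F"
    using assms exhaust_2[of j] by auto
qed

lemma laguerre_RHP_if_rows:
  fixes Y :: "complex \<Rightarrow> complex^2^2"
  assumes row: "\<And>i. laguerre_row \<alpha> n ((mat 1 :: complex^2^2) $ i $ 1) ((mat 1 :: complex^2^2) $ i $ 2) (\<lambda>z. Y z $ i $ 1) (\<lambda>z. Y z $ i $ 2)"
  shows "laguerre_RHP \<alpha> n Y"
  unfolding laguerre_RHP_def
proof (intro conjI allI)
  show "(\<lambda>z. Y z $ i $ j) analytic_on slit_plane" for i j
    using row exhaust_2[of j] by (auto simp: laguerre_row_def analytic_on_open[OF open_slit_plane])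
  show "bounded_at_0 (\<lambda>z. Y z $ i $ 1)" "power_germ_bounded \<alpha> (\<lambda>z. Y z $ i $ 2)" for i
    using row by (auto simp: laguerre_row_def)
  have lim: "\<exists>U L. (Y \<longlongrightarrow> U) (upper_at x) \<and> (Y \<longlongrightarrow> L) (lower_at x) \<and>
      U = L ** mat2 1 (real_weight \<alpha> x) 0 1" if "x > 0" for x
  proof -
    have "\<forall>i. \<exists>l. ((\<lambda>z. Y z $ i $ 1) \<longlongrightarrow> l) (upper_at x) \<and> ((\<lambda>z. Y z $ i $ 1) \<longlongrightarrow> l) (lower_at x) \<and>
        has_jump (\<lambda>z. Y z $ i $ 2) x (l * (real_weight \<alpha> x))"
      using row that by (simp add: laguerre_row_def)
    then obtain l where l: "\<And>i. ((\<lambda>z. Y z $ i $ 1) \<longlongrightarrow> l i) (upper_at x)"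
        "\<And>i. ((\<lambda>z. Y z $ i $ 1) \<longlongrightarrow> l i) (lower_at x)"
        "\<And>i. has_jump (\<lambda>z. Y z $ i $ 2) x (l i * (real_weight \<alpha> x))"
      by metis
    obtain r s where rs: "\<And>i. ((\<lambda>z. Y z $ i $ 2) \<longlongrightarrow> r i) (upper_at x)"
        "\<And>i. ((\<lambda>z. Y z $ i $ 2) \<longlongrightarrow> s i) (lower_at x)"
        "\<And>i. r i - s i = l i * (real_weight \<alpha> x)"
      using l(3) unfolding has_jump_def by metis
    define U L :: "complex^2^2" where "U = (\<chi> i j. if j = 1 then l i else r i)" and "L = (\<chi> i j. if j = 1 then l i else s i)"
    have "(Y \<longlongrightarrow> U) (upper_at x)" "(Y \<longlongrightarrow> L) (lower_at x)"
      using l rs by (auto intro!: tendsto_mat2I simp: U_def L_def)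
    moreover have "U $ i $ j = (L ** mat2 1 (real_weight \<alpha> x) 0 1) $ i $ j" for i j
      using exhaust_2[of j] rs(3)[of i] by (auto simp: mat2_mult U_def L_def algebra_simps)
    ultimately show ?thesis by (metis vec_eq_iff)
  qed
  show "0 < x \<longrightarrow> (\<exists>L. (Y \<longlongrightarrow> L) (upper_at x)) \<and> (\<exists>L. (Y \<longlongrightarrow> L) (lower_at x))" for x
    using lim by blast
  show "0 < x \<longrightarrow> Lim (upper_at x) Y = Lim (lower_at x) Y ** mat2 1 (real_weight \<alpha> x) 0 1" for x
    using lim[of x] tendsto_Lim[OF upper_at_nontrivial] tendsto_Lim[OF lower_at_nontrivial] by blast
  \<comment> \<open>The normalisation at infinity solved for the error matrix entry by entry; the
    diagonal factor is invertible off the cut since z is nonzero there.\<close>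
  define E :: "complex \<Rightarrow> complex^2^2" where
    "E z = (\<chi> i j. if j = 1 then Y z $ i $ 1 * inverse (z ^ n) - (mat 1 :: complex^2^2) $ i $ 1 else Y z $ i $ 2 * z ^ n - (mat 1 :: complex^2^2) $ i $ 2)" for z
  have E: "(\<lambda>z. E z $ i $ j) \<in> O[slit_at_infinity](\<lambda>z. inverse z)" for i j
    using row[of i] exhaust_2[of j] by (auto simp: laguerre_row_def E_def)
  have "\<forall>\<^sub>F z in slit_at_infinity. Y z = (mat 1 + E z) ** mat2 (z ^ n) 0 0 (z powi (- int n))"
    using eventually_in_slit
  proof eventually_elim
    case (elim z)
    then have "z \<noteq> 0" by auto
    then have "Y z $ i $ j = ((mat 1 + E z) ** mat2 (z ^ n) 0 0 (z powi (- int n))) $ i $ j" for i j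
      using exhaust_2[of j] by (auto simp: mat2_mult E_def power_int_minus)
    then show ?case by (metis vec_eq_iff)
  qed
  then show "\<exists>E :: complex \<Rightarrow> complex^2^2. (\<forall>i j. (\<lambda>z. E z $ i $ j) \<in> O[slit_at_infinity](\<lambda>z. inverse z)) \<and>
      (\<forall>\<^sub>F z in slit_at_infinity. Y z = (mat 1 + E z) ** mat2 (z ^ n) 0 0 (z powi (- int n)))"
    using E by blast
qed

lemma laguerre_row_diff:
  assumes "laguerre_row \<alpha> n a b u v" "laguerre_row \<alpha> n a b u' v'"
  shows "laguerre_row \<alpha> n 0 0 (\<lambda>z. u z - u' z) (\<lambda>z. v z - v' z)"
  unfolding laguerre_row_def
proof (intro conjI allI impI)
  show "(\<lambda>z. u z - u' z) holomorphic_on slit_plane" "(\<lambda>z. v z - v' z) holomorphic_on slit_plane"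
    using assms by (auto simp: laguerre_row_def intro!: holomorphic_intros)
  show "bounded_at_0 (\<lambda>z. u z - u' z)"
    using assms bounded_at_0_add[of u "\<lambda>z. (- 1) * u' z"] bounded_at_0_cmult[of u' "- 1"]
    by (simp add: laguerre_row_def)
  show "power_germ_bounded \<alpha> (\<lambda>z. v z - v' z)"
    using assms power_germ_bounded_add[of \<alpha> v "\<lambda>z. (- 1) * v' z"] power_germ_bounded_cmult[of \<alpha> v' "- 1"]
    by (simp add: laguerre_row_def)
  have "(\<lambda>z. (u z * inverse (z ^ n) - a) - (u' z * inverse (z ^ n) - a)) \<in> O[slit_at_infinity](inverse)"
    by (rule sum_in_bigo(2)) (use assms in \<open>simp_all add: laguerre_row_def\<close>)
  then show "(\<lambda>z. (u z - u' z) * inverse (z ^ n) - 0) \<in> O[slit_at_infinity](inverse)"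
    by (simp add: left_diff_distrib)
  have "(\<lambda>z. (v z * z ^ n - b) - (v' z * z ^ n - b)) \<in> O[slit_at_infinity](inverse)"
    by (rule sum_in_bigo(2)) (use assms in \<open>simp_all add: laguerre_row_def\<close>)
  then show "(\<lambda>z. (v z - v' z) * z ^ n - 0) \<in> O[slit_at_infinity](inverse)"
    by (simp add: left_diff_distrib)
  fix x :: real assume "x > 0"
  let ?w = "real_weight \<alpha> x"
  obtain l where l: "(u \<longlongrightarrow> l) (upper_at x)" "(u \<longlongrightarrow> l) (lower_at x)" "has_jump v x (l * ?w)"
    using assms \<open>x > 0\<close> by (auto simp: laguerre_row_def)
  obtain l' where l': "(u' \<longlongrightarrow> l') (upper_at x)" "(u' \<longlongrightarrow> l') (lower_at x)" "has_jump v' x (l' * ?w)"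
    using assms \<open>x > 0\<close> by (auto simp: laguerre_row_def)
  have "has_jump (\<lambda>z. v z + (- 1) * v' z) x (l * ?w + (- 1) * (l' * ?w))"
    using l(3) l'(3) by (intro has_jump_add has_jump_mult continuous_intros)
  then have "has_jump (\<lambda>z. v z - v' z) x ((l - l') * ?w)" by (simp add: left_diff_distrib)
  then show "\<exists>l. ((\<lambda>z. u z - u' z) \<longlongrightarrow> l) (upper_at x) \<and> ((\<lambda>z. u z - u' z) \<longlongrightarrow> l) (lower_at x) \<and>
      has_jump (\<lambda>z. v z - v' z) x (l * ?w)"
    using tendsto_diff[OF l(1) l'(1)] tendsto_diff[OF l(2) l'(2)] by blast
qed

section \<open>The explicit solution\<close>

lemma poly_bigo_power:
  assumes "degree p \<le> k"
  shows "poly p \<in> O[slit_at_infinity](\<lambda>z. z ^ k)"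
proof -
  have "(\<lambda>z. \<Sum>i\<le>degree p. coeff p i * z ^ i) \<in> O[slit_at_infinity](\<lambda>z. z ^ k)"
  proof (rule big_sum_in_bigo)
    fix i assume i: "i \<in> {..degree p}"
    show "(\<lambda>z. coeff p i * z ^ i) \<in> O[slit_at_infinity](\<lambda>z. z ^ k)"
    proof (rule bigoI[where c = "norm (coeff p i)"])
      show "\<forall>\<^sub>F z in slit_at_infinity. norm (coeff p i * z ^ i) \<le> norm (coeff p i) * norm (z ^ k)"
        unfolding eventually_slit_at_infinity using i assms
        by (intro exI[of _ 1]) (auto simp: norm_mult norm_power intro!: mult_left_mono power_increasing)
    qed
  qed
  then show ?thesis by (simp add: poly_altdef[abs_def])
qed

lemma poly_times_inverse_power_bigo:
  assumes "degree p \<le> n - 1" "n \<ge> 1"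
  shows "(\<lambda>z. poly p z * inverse (z ^ n)) \<in> O[slit_at_infinity](inverse)"
proof -
  have "(\<lambda>z. poly p z * inverse (z ^ n)) \<in> O[slit_at_infinity](\<lambda>z. z ^ (n - 1) * inverse (z ^ n))"
    by (intro landau_o.big.mult_right poly_bigo_power assms)
  moreover have ev: "\<forall>\<^sub>F z in slit_at_infinity. z ^ (n - 1) * inverse (z ^ n) = inverse z"
    using eventually_in_slit
  proof eventually_elim
    case (elim z)
    then have "z \<noteq> 0" by auto
    then show ?case using assms(2) by (cases n) (auto simp: field_simps)
  qed
  ultimately show ?thesis unfolding landau_o.big.cong[OF ev] by simp
qed

text \<open>Every polynomial p together with its Cauchy transform has the right jump and behaviour
  at the origin; only the two conditions at infinity, left as hypotheses, select p.\<close>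

lemma laguerre_row_solution:
  assumes \<alpha>: "regular_exponent \<alpha>" "\<alpha> \<noteq> 0"
    and p: "(\<lambda>z. poly p z * inverse (z ^ n) - a) \<in> O[slit_at_infinity](inverse)"
    and S: "(\<lambda>z. cauchy_factor * poly_stieltjes \<alpha> p z * z ^ n - b) \<in> O[slit_at_infinity](inverse)"
  shows "laguerre_row \<alpha> n a b (poly p) (\<lambda>z. cauchy_factor * poly_stieltjes \<alpha> p z)"
  unfolding laguerre_row_def
proof (intro conjI allI impI p S)
  show "poly p holomorphic_on slit_plane" by (intro holomorphic_intros)
  show "(\<lambda>z. cauchy_factor * poly_stieltjes \<alpha> p z) holomorphic_on slit_plane"
    by (intro holomorphic_intros holomorphic_poly_stieltjes \<alpha>) simp
  show "bounded_at_0 (poly p)" by (intro bounded_at_0_isCont) auto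
  show "power_germ_bounded \<alpha> (\<lambda>z. cauchy_factor * poly_stieltjes \<alpha> p z)"
    by (intro power_germ_bounded_cmult power_germ_bounded_poly_stieltjes \<alpha>)
  fix x :: real assume x: "x > 0"
  have "(poly p \<longlongrightarrow> poly p (of_real x)) (at (of_real x) within T)" for T
    by (intro tendsto_intros)
  moreover have "has_jump (\<lambda>z. cauchy_factor * poly_stieltjes \<alpha> p z) x
      (poly p (of_real x) * (real_weight \<alpha> x))"
    using has_jump_mult[OF has_jump_poly_stieltjes[OF \<alpha>(1) x], of "\<lambda>_. cauchy_factor" p] by simp
  ultimately show "\<exists>l. (poly p \<longlongrightarrow> l) (upper_at x) \<and> (poly p \<longlongrightarrow> l) (lower_at x) \<and>
      has_jump (\<lambda>z. cauchy_factor * poly_stieltjes \<alpha> p z) x (l * (real_weight \<alpha> x))"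
    by blast
qed

lemma gamma_functional_monom_laguerre:
  assumes "regular_exponent \<alpha>" "i \<le> m"
  shows "gamma_functional \<alpha> (monom 1 i * monic_laguerre \<alpha> m) = (if i = m then fact m * Gamma (\<alpha> + 1 + of_nat m) else 0)"
  using gamma_functional_orthogonality[OF assms(1), of "monom 1 i" m] assms(2) by (simp add: degree_monom_eq)

text \<open>Monicity leaves a remainder of degree at most n - 1 in the first entry. Orthogonality to
  1, ..., t^(n-1) makes z^n times the transform equal to the transform of t^n times the polynomial,
  which is O(1/z).\<close>

lemma laguerre_row_1:
  assumes \<alpha>: "regular_exponent \<alpha>" "\<alpha> \<noteq> 0" and n: "n \<ge> 1"
  shows "laguerre_row \<alpha> n 1 0 (poly (monic_laguerre \<alpha> n))
    (\<lambda>z. cauchy_factor * poly_stieltjes \<alpha> (monic_laguerre \<alpha> n) z)"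
proof (rule laguerre_row_solution[OF \<alpha>])
  let ?p = "monic_laguerre \<alpha> n"
  have "degree (?p - monom 1 n) \<le> n - 1"
  proof (rule degree_le, intro allI impI)
    fix i assume "n - 1 < i"
    then consider "i = n" | "i > n" using n by linarith
    then show "coeff (?p - monom 1 n) i = 0"
    proof cases
      case 2
      then have "coeff ?p i = 0" using degree_monic_laguerre_le[of \<alpha> n] by (intro coeff_eq_0) simp
      then show ?thesis using 2 by simp
    qed (simp add: coeff_monic_laguerre)
  qed
  from poly_times_inverse_power_bigo[OF this n]
  have "(\<lambda>z. poly (?p - monom 1 n) z * inverse (z ^ n)) \<in> O[slit_at_infinity](inverse)" .
  moreover have ev: "\<forall>\<^sub>F z in slit_at_infinity. poly (?p - monom 1 n) z * inverse (z ^ n) = poly ?p z * inverse (z ^ n) - 1"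
    using eventually_in_slit
  proof eventually_elim
    case (elim z)
    then have "z \<noteq> 0" by auto
    then show ?case by (simp add: left_diff_distrib poly_monom)
  qed
  ultimately show "(\<lambda>z. poly ?p z * inverse (z ^ n) - 1) \<in> O[slit_at_infinity](inverse)"
    using landau_o.big.in_cong[OF ev, of inverse] by blast
  have "(\<lambda>z. cauchy_factor * poly_stieltjes \<alpha> (monom 1 n * ?p) z) \<in> O[slit_at_infinity](inverse)"
    using poly_stieltjes_bigo_inverse[OF \<alpha>(1)] by simp
  moreover have ev: "\<forall>\<^sub>F z in slit_at_infinity. cauchy_factor * poly_stieltjes \<alpha> (monom 1 n * ?p) z
      = cauchy_factor * poly_stieltjes \<alpha> ?p z * z ^ n - 0"
    using eventually_in_slit
    by eventually_elim (use gamma_functional_monom_laguerre[OF \<alpha>(1)] poly_stieltjes_monom_mult[OF \<alpha>(1)] in simp)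
  ultimately show "(\<lambda>z. cauchy_factor * poly_stieltjes \<alpha> ?p z * z ^ n - 0) \<in> O[slit_at_infinity](inverse)"
    using landau_o.big.in_cong[OF ev, of inverse] by blast
qed

lemma poly_stieltjes_smult: "poly_stieltjes \<alpha> (smult c p) z = c * poly_stieltjes \<alpha> p z"
  by (simp add: poly_stieltjes_def coeff_pairing_smult)

text \<open>Only n - 1 factors of t can be extracted freely; the last one leaves the nonzero moment
  (n-1)! Gamma(\<alpha> + n), which supplies the limit 1 of the second entry.\<close>

lemma laguerre_row_2:
  assumes \<alpha>: "regular_exponent \<alpha>" "\<alpha> \<noteq> 0" and n: "n \<ge> 1"
  shows "laguerre_row \<alpha> n 0 1 (poly (smult (laguerre_c \<alpha> n) (monic_laguerre \<alpha> (n - 1))))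
    (\<lambda>z. cauchy_factor * poly_stieltjes \<alpha> (smult (laguerre_c \<alpha> n) (monic_laguerre \<alpha> (n - 1))) z)"
proof (rule laguerre_row_solution[OF \<alpha>])
  let ?p = "monic_laguerre \<alpha> (n - 1)" and ?c = "laguerre_c \<alpha> n"
  have "degree (smult ?c ?p) \<le> n - 1"
    using degree_monic_laguerre_le by (rule order_trans[OF degree_smult_le])
  from poly_times_inverse_power_bigo[OF this n]
  show "(\<lambda>z. poly (smult ?c ?p) z * inverse (z ^ n) - 0) \<in> O[slit_at_infinity](inverse)" by simp
  have n': "n = Suc (n - 1)" using n by simp
  have e: "\<alpha> + 1 + of_nat (n - 1) = \<alpha> + of_nat n" using n by (simp add: of_nat_diff)
  have val: "gamma_functional \<alpha> (monom 1 (n - 1) * ?p) = fact (n - 1) * Gamma (\<alpha> + of_nat n)"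
    using gamma_functional_monom_laguerre[OF \<alpha>(1) order_refl, of "n - 1"] unfolding e by simp
  have "Gamma (\<alpha> + of_nat n) \<noteq> 0"
    using regular_exponent_nonpos_Ints[OF \<alpha>(1), of "n - 1"] unfolding e
    by (simp add: Gamma_eq_zero_iff)
  \<comment> \<open>The requirement that determines c_n: the moment must contribute -1, so that z^n
    times the second entry tends to 1.\<close>
  then have c: "cauchy_factor * ?c * (fact (n - 1) * Gamma (\<alpha> + of_nat n)) = - 1"
    by (simp add: laguerre_c_def field_simps)
  have "(\<lambda>z. cauchy_factor * ?c * poly_stieltjes \<alpha> (monom 1 n * ?p) z) \<in> O[slit_at_infinity](inverse)"
    using poly_stieltjes_bigo_inverse[OF \<alpha>(1)] by simp
  moreover have ev: "\<forall>\<^sub>F z in slit_at_infinity. cauchy_factor * ?c * poly_stieltjes \<alpha> (monom 1 n * ?p) z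
      = cauchy_factor * poly_stieltjes \<alpha> (smult ?c ?p) z * z ^ n - 1"
    using eventually_in_slit
  proof eventually_elim
    case (elim z)
    have "monom 1 n * ?p = pCons 0 (monom 1 (n - 1) * ?p)" by (subst n') (simp add: monom_Suc del: Suc_pred)
    then have "poly_stieltjes \<alpha> (monom 1 n * ?p) z = z * poly_stieltjes \<alpha> (monom 1 (n - 1) * ?p) z + gamma_functional \<alpha> (monom 1 (n - 1) * ?p)"
      using poly_stieltjes_shift[OF \<alpha>(1) elim] by simp
    also have "poly_stieltjes \<alpha> (monom 1 (n - 1) * ?p) z = z ^ (n - 1) * poly_stieltjes \<alpha> ?p z"
      using gamma_functional_monom_laguerre[OF \<alpha>(1), of _ "n - 1"] by (intro poly_stieltjes_monom_mult[OF \<alpha>(1) elim]) simp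
    also have "z * (z ^ (n - 1) * poly_stieltjes \<alpha> ?p z) = z ^ n * poly_stieltjes \<alpha> ?p z"
      by (subst (2) n') (simp add: mult.assoc del: Suc_pred)
    finally have S: "poly_stieltjes \<alpha> (monom 1 n * ?p) z =
        z ^ n * poly_stieltjes \<alpha> ?p z + fact (n - 1) * Gamma (\<alpha> + of_nat n)"
      unfolding val .
    show ?case
      unfolding S distrib_left c by (simp add: poly_stieltjes_smult)
  qed
  ultimately show "(\<lambda>z. cauchy_factor * poly_stieltjes \<alpha> (smult ?c ?p) z * z ^ n - 1) \<in> O[slit_at_infinity](inverse)"
    using landau_o.big.in_cong[OF ev, of inverse] by blast
qed

section \<open>Removing the cut\<close>

text \<open>Carries estimates known only off the cut to points of the cut by continuity, approaching
  from above.\<close>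

lemma le_at_positive_real:
  fixes F :: "complex \<Rightarrow> complex" and g :: "complex \<Rightarrow> real"
  assumes "isCont F (of_real x)" "isCont g (of_real x)" "\<forall>\<^sub>F z in upper_at x. norm (F z) \<le> g z"
  shows "norm (F (of_real x)) \<le> g (of_real x)"
proof (rule tendsto_le[OF upper_at_nontrivial])
  show "(g \<longlongrightarrow> g (of_real x)) (upper_at x)"
    using assms(2) continuous_at_imp_continuous_at_within continuous_within by blast
  show "((\<lambda>z. norm (F z)) \<longlongrightarrow> norm (F (of_real x))) (upper_at x)"
    using assms(1) continuous_at_imp_continuous_at_within continuous_within by (blast intro: tendsto_norm)
qed (rule assms(3))

lemma slit_plane_complement:
  assumes "z \<notin> slit_plane" "z \<noteq> 0"
  obtains x where "x > 0" "z = of_real x"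
  using assms by (auto simp: nonneg_Reals_def le_less)

text \<open>Painleve's principle: a function continuous on the right half plane and holomorphic on
  both sides of the real line is holomorphic there. The work lies in the continuity of the
  extension.\<close>

lemma holomorphic_extension_across_cut:
  assumes hol: "f holomorphic_on slit_plane"
    and lim: "\<And>x. x > 0 \<Longrightarrow> \<exists>l. (f \<longlongrightarrow> l) (upper_at x) \<and> (f \<longlongrightarrow> l) (lower_at x)"
  obtains F where "F holomorphic_on - {0}" "\<And>z. z \<in> slit_plane \<Longrightarrow> F z = f z"
proof -
  obtain l where l: "\<And>x. x > 0 \<Longrightarrow> (f \<longlongrightarrow> l x) (upper_at x)" "\<And>x. x > 0 \<Longrightarrow> (f \<longlongrightarrow> l x) (lower_at x)"
    using lim by metis
  define F where "F z = (if z \<in> slit_plane then f z else l (Re z))" for z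
  define H where "H = {z::complex. Re z > 0}"
  have openH: "open H" unfolding H_def by (rule open_halfspace_Re_gt)
  have F: "F z = f z" if "z \<in> slit_plane" for z using that by (simp add: F_def)
  have Freal: "F (of_real x) = l x" if "x > 0" for x using that by (simp add: F_def)
  have holF: "F holomorphic_on slit_plane"
    using hol by (rule holomorphic_transform) (simp add: F)
  have Fcont: "isCont F (of_real x)" if x: "x > 0" for x
    unfolding isCont_def
  proof (rule tendstoI)
    fix e :: real assume e: "e > 0"
    have "\<forall>\<^sub>F z in at (of_real x). (Im z > 0 \<longrightarrow> dist (f z) (l x) < e / 2) \<and> (Im z < 0 \<longrightarrow> dist (f z) (l x) < e / 2)"
      using tendstoD[OF l(1)[OF x], of "e / 2"] tendstoD[OF l(2)[OF x], of "e / 2"] e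
      by (auto simp: eventually_at_filter elim: eventually_elim2)
    then obtain d where d: "d > 0" "\<And>z. z \<noteq> of_real x \<Longrightarrow> dist z (of_real x) < d \<Longrightarrow> Im z \<noteq> 0 \<Longrightarrow> dist (f z) (l x) < e / 2"
      unfolding eventually_at by (metis UNIV_I linorder_neqE_linordered_idom)
    have "dist (F z) (F (of_real x)) < e" if z: "z \<noteq> of_real x" "dist z (of_real x) < min d x" for z
    proof (cases "Im z = 0")
      case False
      then show ?thesis
        using d(2)[OF z(1)] z e nonreal_in_slit_plane[OF False] by (simp add: F Freal[OF x])
    next
      case True
      \<comment> \<open>Continuity along the cut itself: the boundary value at y is a limit of
        nonreal values close to y, all within e/2 of the boundary value at x.\<close>
      define y where "y = Re z"
      have zy: "z = of_real y" using True by (simp add: y_def complex_eq_iff)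
      have y: "y > 0" "\<bar>y - x\<bar> < d"
        using z(2) by (auto simp: zy dist_norm simp flip: of_real_diff)
      have "\<forall>\<^sub>F w in upper_at y. dist w (of_real y) < d - \<bar>y - x\<bar>"
        using y by (intro eventually_at[THEN iffD2] exI[of _ "d - \<bar>y - x\<bar>"]) auto
      moreover have "\<forall>\<^sub>F w in upper_at y. Im w > 0" by (simp add: eventually_at_filter)
      ultimately have "\<forall>\<^sub>F w in upper_at y. dist (f w) (l x) \<le> e / 2"
      proof eventually_elim
        case (elim w)
        have "dist w (of_real x) \<le> dist w (of_real y) + dist (of_real y :: complex) (of_real x)"
          by (rule dist_triangle)
        also have "dist (of_real y :: complex) (of_real x) = \<bar>y - x\<bar>"
          by (simp add: dist_norm flip: of_real_diff)
        finally have "dist w (of_real x) < d" using elim by simp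
        moreover have "w \<noteq> of_real x" "Im w \<noteq> 0" using elim by auto
        ultimately show ?case using d(2)[of w] by simp
      qed
      then have "dist (l y) (l x) \<le> e / 2"
        by (intro tendsto_upperbound[OF tendsto_dist[OF l(1)[OF y(1)] tendsto_const] _ upper_at_nontrivial])
      then show ?thesis using e by (simp add: zy Freal x y)
    qed
    then show "\<forall>\<^sub>F z in at (of_real x). dist (F z) (F (of_real x)) < e"
      using d(1) x unfolding eventually_at by (intro exI[of _ "min d x"]) auto
  qed
  have "F holomorphic_on H"
  \<comment> \<open>With normal vector \<open>\<i>\<close>, the inner product with z is Im z, so the
    pasting line is the real axis.\<close>
  proof (rule holomorphic_on_paste_across_line[OF openH])
    show "\<i> \<noteq> 0" by simp
    show "F holomorphic_on (H \<inter> {z. \<i> \<bullet> z < 0})" "F holomorphic_on (H \<inter> {z. 0 < \<i> \<bullet> z})"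
      by (rule holomorphic_on_subset[OF holF]; auto simp: inner_complex_def complex_nonneg_Reals_iff)+
    have "isCont F z" if "z \<in> H" for z
    proof (cases "z \<in> slit_plane")
      case True
      then show ?thesis
        using holF open_slit_plane holomorphic_on_imp_continuous_on continuous_on_eq_continuous_at by blast
    next
      case False
      moreover have "z \<noteq> 0" using that by (auto simp: H_def)
      ultimately obtain x where "x > 0" "z = of_real x" using slit_plane_complement by blast
      then show ?thesis using Fcont by simp
    qed
    then show "continuous_on H F" by (simp add: continuous_at_imp_continuous_on)
  qed
  then have "F holomorphic_on slit_plane \<union> H"
    using holF openH open_slit_plane by (intro holomorphic_on_Un) auto
  moreover have "slit_plane \<union> H = - {0}"
    by (auto simp: H_def complex_nonneg_Reals_iff complex_eq_iff)
  ultimately show ?thesis using F by (intro that[of F]) auto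
qed

text \<open>After the cut is removed only 0 is left. The bound on the slit plane extends to the cut
  by continuity, and Riemann's theorem removes the singularity.\<close>

lemma entire_extension:
  assumes hol: "f holomorphic_on slit_plane"
    and lim: "\<And>x. x > 0 \<Longrightarrow> \<exists>l. (f \<longlongrightarrow> l) (upper_at x) \<and> (f \<longlongrightarrow> l) (lower_at x)"
    and bdd: "bounded_at_0 f"
  obtains G where "G holomorphic_on UNIV" "\<And>z. z \<in> slit_plane \<Longrightarrow> G z = f z"
proof -
  obtain F where F: "F holomorphic_on - {0}" "\<And>z. z \<in> slit_plane \<Longrightarrow> F z = f z"
    using holomorphic_extension_across_cut[OF hol lim] by blast
  obtain C where "\<forall>\<^sub>F z in at 0 within slit_plane. norm (f z) \<le> C * norm (1 :: complex)"
    using bdd unfolding bounded_at_0_def by (elim landau_o.bigE)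
  then obtain d where d: "d > 0" "\<And>z. z \<in> slit_plane \<Longrightarrow> z \<noteq> 0 \<Longrightarrow> norm z < d \<Longrightarrow> norm (f z) \<le> C"
    unfolding eventually_at by (auto simp: dist_norm)
  have contF: "isCont F z" if "z \<noteq> 0" for z
    using that F(1) holomorphic_on_imp_continuous_on continuous_on_eq_continuous_at[of "- {0}"] by fastforce
  have bound: "norm (F z) \<le> C" if z: "z \<noteq> 0" "norm z < d" for z
  proof (cases "z \<in> slit_plane")
    case True
    then show ?thesis using d(2)[of z] z F(2) by simp
  next
    case False
    then obtain x where x: "x > 0" "z = of_real x" using z slit_plane_complement by blast
    have "\<forall>\<^sub>F w in upper_at x. dist w (of_real x) < d - x"
      using x z by (intro eventually_at[THEN iffD2] exI[of _ "d - x"]) auto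
    moreover have "\<forall>\<^sub>F w in upper_at x. Im w > 0" by (simp add: eventually_at_filter)
    ultimately have "\<forall>\<^sub>F w in upper_at x. norm (F w) \<le> C"
    proof eventually_elim
      case (elim w)
      have w: "w \<in> slit_plane" "w \<noteq> 0" using elim by (auto simp: complex_nonneg_Reals_iff)
      have "norm w \<le> dist w (of_real x) + norm (complex_of_real x)"
        using norm_triangle_ineq[of "w - of_real x" "of_real x"] by (simp add: dist_norm)
      then have "norm w < d" using elim x by simp
      then show ?case using d(2)[OF w] F(2)[OF w(1)] by simp
    qed
    then show ?thesis
      unfolding x(2) using x(1) by (intro le_at_positive_real contF) auto
  qed
  have "\<exists>G. G holomorphic_on UNIV \<and> (\<forall>z\<in>UNIV - {0}. G z = F z)"
  proof (subst holomorphic_on_extend_bounded)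
    show "\<exists>B. \<forall>\<^sub>F z in at 0. norm (F z) \<le> B"
      using d(1) bound by (intro exI[of _ C]) (auto simp: eventually_at dist_norm)
  qed (use F(1) in \<open>auto simp: Compl_eq_Diff_UNIV\<close>)
  then obtain G where G: "G holomorphic_on UNIV" "\<And>z. z \<noteq> 0 \<Longrightarrow> G z = F z" by auto
  have "G z = f z" if "z \<in> slit_plane" for z
  proof -
    have "z \<noteq> 0" using that by auto
    then show ?thesis using G(2) F(2)[OF that] by simp
  qed
  with G(1) show ?thesis by (rule that)
qed

lemma entire_growth_at_infinity:
  assumes hol: "G holomorphic_on UNIV" and O: "G \<in> O[slit_at_infinity](g)"
    and g: "\<And>z. z \<noteq> 0 \<Longrightarrow> isCont g z"
  obtains R C where "\<And>z. R \<le> norm z \<Longrightarrow> norm (G z) \<le> C * norm (g z)"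
proof -
  obtain C where "\<forall>\<^sub>F z in slit_at_infinity. norm (G z) \<le> C * norm (g z)"
    using O by (elim landau_o.bigE)
  then obtain R where R: "\<And>z. z \<in> slit_plane \<Longrightarrow> R \<le> norm z \<Longrightarrow> norm (G z) \<le> C * norm (g z)"
    unfolding eventually_slit_at_infinity by blast
  \<comment> \<open>The margin 1 keeps the unit disc around a point of the cut outside radius R; max
    1 R ensures that z is nonzero.\<close>
  have "norm (G z) \<le> C * norm (g z)" if z: "max 1 R + 1 \<le> norm z" for z
  proof (cases "z \<in> slit_plane")
    case True
    then show ?thesis using R z by simp
  next
    case False
    moreover have "z \<noteq> 0" using z by auto
    ultimately obtain x where x: "x > 0" "z = of_real x" using slit_plane_complement by blast
    have "\<forall>\<^sub>F w in upper_at x. dist w (of_real x) < 1"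
      by (intro eventually_at[THEN iffD2] exI[of _ 1]) auto
    moreover have "\<forall>\<^sub>F w in upper_at x. Im w > 0" by (simp add: eventually_at_filter)
    ultimately have "\<forall>\<^sub>F w in upper_at x. norm (G w) \<le> C * norm (g w)"
    proof eventually_elim
      case (elim w)
      have "norm (complex_of_real x) \<le> norm w + dist w (of_real x)"
        using norm_triangle_ineq4[of w "w - of_real x"] by (simp add: dist_norm)
      then have "R \<le> norm w" using elim z x by simp
      then show ?case using R elim by (simp add: complex_nonneg_Reals_iff)
    qed
    moreover have "isCont G (of_real x)"
      using hol holomorphic_on_imp_continuous_on continuous_on_eq_continuous_at[of UNIV] by blast
    ultimately show ?thesis
      unfolding x(2) using x(1) by (intro le_at_positive_real continuous_intros g) auto
  qed
  then show ?thesis by (rule that)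
qed

text \<open>A bound along one ray controls the order of vanishing of an analytic germ, and the order
  controls the germ in a full neighbourhood.\<close>

lemma power_germ_order:
  assumes an: "f analytic_on {0}" and bound: "\<forall>\<^sub>F x in at_right 0. norm (f (of_real x)) \<le> C * x powr r"
  obtains D d where "d > 0" "\<And>z. z \<noteq> 0 \<Longrightarrow> norm z < d \<Longrightarrow> norm (f z) \<le> D * norm z powr r"
proof -
  obtain s where s: "s > 0" "f holomorphic_on ball 0 s"
    using an by (auto simp: analytic_on_def)
  \<comment> \<open>The factor z forces a zero at 0, as the factorisation theorem requires; the
    order of f itself is then k - 1.\<close>
  define F where "F z = z * f z" for z
  have holF: "F holomorphic_on ball 0 s" unfolding F_def by (intro holomorphic_intros s)
  show ?thesis
  proof (cases "F constant_on ball 0 s")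
    case True
    then have "F z = F 0" if "norm z < s" for z
      using that s(1) unfolding constant_on_def by (metis centre_in_ball mem_ball_0)
    then have "f z = 0" if "z \<noteq> 0" "norm z < s" for z using that by (auto simp: F_def)
    then show ?thesis using s(1) by (intro that[of s 0]) auto
  next
    case False
    obtain g e k where k: "0 < k" "0 < e" "g holomorphic_on ball 0 e"
      "\<And>w. w \<in> ball 0 e \<Longrightarrow> F w = (w - 0) ^ k * g w" "\<And>w. w \<in> ball 0 e \<Longrightarrow> g w \<noteq> 0"
      using holomorphic_factor_zero_nonconstant[OF holF open_ball _ _ _ False, of 0] s(1)
      by (metis F_def centre_in_ball connected_ball mult_zero_left)
    have fg: "f z = z ^ (k - 1) * g z" if "z \<noteq> 0" "norm z < e" for z
    proof -
      have "z * f z = z * (z ^ (k - 1) * g z)"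
        using k(4)[of z] k(1) that(2) by (cases k) (auto simp: F_def)
      then show ?thesis using that(1) by simp
    qed
    have contg: "isCont g 0"
      using k(2,3) holomorphic_on_imp_continuous_on continuous_on_eq_continuous_at[of "ball 0 e"] by fastforce
    have g0: "norm (g 0) > 0" using k(2) k(5)[of 0] by simp
    have "\<forall>\<^sub>F z in nhds 0. dist (g z) (g 0) < norm (g 0) / 2"
      using contg g0 by (intro tendstoD) (auto simp: isCont_def tendsto_nhds_iff)
    then obtain d where d: "d > 0" "\<And>z. norm z < d \<Longrightarrow> dist (g z) (g 0) < norm (g 0) / 2"
      unfolding eventually_nhds_metric by (auto simp: dist_norm)
    have glo: "norm (g 0) / 2 \<le> norm (g z)" and gup: "norm (g z) \<le> 2 * norm (g 0)" if "norm z < d" for z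
      using d(2)[OF that] norm_triangle_ineq2[of "g 0" "g z"] norm_triangle_ineq2[of "g z" "g 0"] g0
      by (auto simp: dist_norm norm_minus_commute)
    have kr: "r \<le> real (k - 1)"
    proof (rule ccontr)
      assume "\<not> r \<le> real (k - 1)"
      then have pos: "r - real (k - 1) > 0" by simp
      have "\<forall>\<^sub>F x::real in at_right 0. 0 < x \<and> x < min d e"
        using d(1) k(2) by (intro eventually_at_right_real[of 0 "min d e", THEN eventually_mono]) auto
      then have "\<forall>\<^sub>F x in at_right 0. norm (g 0) / 2 \<le> C * x powr (r - real (k - 1))"
        using bound
      proof eventually_elim
        case (elim x)
        then have "x ^ (k - 1) * (norm (g 0) / 2) \<le> x ^ (k - 1) * norm (g (of_real x))"
          using glo[of "of_real x"] by (intro mult_left_mono) auto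
        also have "\<dots> = norm (f (of_real x))"
          using elim fg[of "of_real x"] by (simp add: norm_mult norm_power)
        also have "\<dots> \<le> C * x powr r" by (rule elim)
        also have "\<dots> = x ^ (k - 1) * (C * x powr (r - real (k - 1)))"
          using elim by (simp add: powr_diff powr_realpow)
        finally show ?case using elim by simp
      qed
      moreover have "((\<lambda>x. C * x powr (r - real (k - 1))) \<longlongrightarrow> 0) (at_right 0)"
        using pos by (intro tendsto_mult_right_zero tendsto_zero_powrI[OF _ tendsto_const])
          (auto intro!: tendsto_eq_intros simp: eventually_at_filter)
      ultimately have "norm (g 0) / 2 \<le> 0"
        by (intro tendsto_lowerbound) auto
      then show False using g0 by simp
    qed
    have "norm (f z) \<le> 2 * norm (g 0) * norm z powr r" if z: "z \<noteq> 0" "norm z < min 1 (min d e)" for z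
    proof -
      have "norm (f z) = norm z powr real (k - 1) * norm (g z)"
        using fg[of z] z by (simp add: norm_mult norm_power powr_realpow)
      also have "\<dots> \<le> norm z powr r * (2 * norm (g 0))"
        using z kr gup[of z] by (intro mult_mono powr_mono') auto
      finally show ?thesis by (simp add: mult_ac)
    qed
    then show ?thesis using d(1) k(2) by (intro that[of "min 1 (min d e)"]) auto
  qed
qed

text \<open>
  For \<open>Re \<alpha> < 0\<close>, comparing the two boundary values of \<open>f\<close> at small \<open>x > 0\<close> bounds
  \<open>(1 - exp (2 * pi * \<i> * \<alpha>)) * x powr \<alpha> * f0 x\<close>, and the factor does not vanish as \<open>\<alpha>\<close> is not an integer.
\<close>

lemma power_germ_without_jump_bounded:
  assumes \<alpha>: "regular_exponent \<alpha>" "\<alpha> \<noteq> 0" and germ: "power_germ_bounded \<alpha> f"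
    and lim: "\<And>x. x > 0 \<Longrightarrow> \<exists>l. (f \<longlongrightarrow> l) (upper_at x) \<and> (f \<longlongrightarrow> l) (lower_at x)"
  shows "bounded_at_0 f"
proof -
  obtain f0 where f0: "f0 analytic_on {0}" "bounded_at_0 (\<lambda>z. f z - slit_power \<alpha> z * f0 z)"
    using germ by (auto simp: power_germ_bounded_def)
  obtain s where s: "s > 0" "f0 holomorphic_on ball 0 s"
    using f0(1) by (auto simp: analytic_on_def)
  have cont0: "isCont f0 z" if "norm z < s" for z
    using that s(2) holomorphic_on_imp_continuous_on continuous_on_eq_continuous_at[of "ball 0 s"] by fastforce
  obtain A where A: "A > 0" "\<And>z. z \<noteq> 0 \<Longrightarrow> norm (slit_power \<alpha> z) \<le> A * norm z powr Re \<alpha>"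
    using norm_slit_power_le by blast
  \<comment> \<open>This estimate exactly compensates the growth |z|^(Re \<alpha>) of the branch.
    For Re \<alpha> >= 0 it holds because f0 is bounded and |z|^(-Re \<alpha>) >= 1 near 0;
    otherwise it uses the absence of a jump.\<close>
  have "\<exists>D d. d > 0 \<and> (\<forall>z. z \<noteq> 0 \<longrightarrow> norm z < d \<longrightarrow> norm (f0 z) \<le> D * norm z powr (- Re \<alpha>))"
  proof (cases "Re \<alpha> \<ge> 0")
    case True
    have "\<forall>\<^sub>F z in nhds 0. dist (f0 z) (f0 0) < 1"
      using cont0[of 0] s(1) by (intro tendstoD) (auto simp: isCont_def tendsto_nhds_iff)
    then obtain d where d: "d > 0" "\<And>z. norm z < d \<Longrightarrow> dist (f0 z) (f0 0) < 1"
      unfolding eventually_nhds_metric by (auto simp: dist_norm)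
    have "norm (f0 z) \<le> (norm (f0 0) + 1) * norm z powr (- Re \<alpha>)" if "z \<noteq> 0" "norm z < min d 1" for z
    proof -
      have "norm (f0 z) \<le> norm (f0 0) + 1"
        using d(2)[of z] that norm_triangle_ineq2[of "f0 z" "f0 0"] by (simp add: dist_norm)
      moreover have "norm z powr 0 \<le> norm z powr (- Re \<alpha>)"
        using that True by (intro powr_mono') auto
      ultimately have "norm (f0 z) * 1 \<le> (norm (f0 0) + 1) * norm z powr (- Re \<alpha>)"
        using that(1) by (intro mult_mono) auto
      then show ?thesis by simp
    qed
    then show ?thesis using d(1) by (intro exI[of _ "norm (f0 0) + 1"] exI[of _ "min d 1"]) auto
  next
    case False
    have nonint: "\<alpha> \<notin> \<int>" using regular_exponent_Ints[OF \<alpha>] False by auto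
    define q where "q = exp (2 * of_real pi * \<i> * \<alpha>)"
    have q: "q \<noteq> 1"
    proof
      assume "q = 1"
      then obtain k :: int where "Re (2 * of_real pi * \<i> * \<alpha>) = 0" "Im (2 * of_real pi * \<i> * \<alpha>) = of_int (2 * k) * pi"
        unfolding q_def exp_eq_1 by blast
      then have "\<alpha> = of_int k" by (simp add: complex_eq_iff)
      then show False using nonint by simp
    qed
    obtain C where "\<forall>\<^sub>F z in at 0 within slit_plane. norm (f z - slit_power \<alpha> z * f0 z) \<le> C * norm (1 :: complex)"
      using f0(2) unfolding bounded_at_0_def by (elim landau_o.bigE)
    then obtain d where d: "d > 0"
        "\<And>z. z \<in> slit_plane \<Longrightarrow> z \<noteq> 0 \<Longrightarrow> norm z < d \<Longrightarrow> norm (f z - slit_power \<alpha> z * f0 z) \<le> C"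
      unfolding eventually_at by (auto simp: dist_norm)
    have "norm (f0 (of_real x)) \<le> 2 * C / norm (1 - q) * x powr (- Re \<alpha>)" if x: "0 < x" "x < min d s" for x
    proof -
      obtain l where l: "(f \<longlongrightarrow> l) (upper_at x)" "(f \<longlongrightarrow> l) (lower_at x)"
        using lim x by blast
      let ?b = "of_real x powr \<alpha> * f0 (of_real x)"
      have f0x: "(f0 \<longlongrightarrow> f0 (of_real x)) (at (of_real x) within T)" for T
        using cont0[of "of_real x"] x continuous_at_imp_continuous_at_within[of "of_real x" f0 T]
        by (simp add: continuous_within)
      have "isCont (\<lambda>z. z powr \<alpha>) (of_real x)" using x by (intro continuous_intros) auto
      then have px: "((\<lambda>z. z powr \<alpha>) \<longlongrightarrow> of_real x powr \<alpha>) (at (of_real x) within T)" for T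
        using continuous_at_imp_continuous_at_within continuous_within by blast
      have near: "\<forall>\<^sub>F w in at (of_real x) within T. norm w < d" for T :: "complex set"
      proof -
        have "\<forall>\<^sub>F w in at (of_real x) within T. dist w (of_real x) < d - x"
          using x by (intro eventually_at[THEN iffD2] exI[of _ "d - x"]) auto
        then show ?thesis
        proof eventually_elim
          case (elim w)
          have "norm w \<le> dist w (of_real x) + norm (complex_of_real x)"
            using norm_triangle_ineq[of "w - of_real x" "of_real x"] by (simp add: dist_norm)
          then show ?case using elim x by simp
        qed
      qed
      \<comment> \<open>The common boundary value l of f lies within C of both \<open>?b\<close> and
        \<open>q * ?b\<close>; subtracting the two bounds eliminates l.\<close>
      have "norm (l - ?b) \<le> C"
      proof (rule tendsto_upperbound[OF tendsto_norm[OF tendsto_diff[OF l(1) tendsto_mult[OF px f0x]]] _ upper_at_nontrivial])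
        have "\<forall>\<^sub>F w in upper_at x. Im w > 0" by (simp add: eventually_at_filter)
        with near show "\<forall>\<^sub>F w in upper_at x. norm (f w - w powr \<alpha> * f0 w) \<le> C"
        proof eventually_elim
          case (elim w)
          then have "w \<noteq> 0" by auto
          with elim show ?case using d(2)[of w] slit_power_upper[of w \<alpha>] by (auto simp: complex_nonneg_Reals_iff)
        qed
      qed
      moreover have "norm (l - q * ?b) \<le> C"
      proof (rule tendsto_upperbound[OF tendsto_norm[OF tendsto_diff[OF l(2) tendsto_mult[OF tendsto_const tendsto_mult[OF px f0x]]]] _ lower_at_nontrivial])
        have "\<forall>\<^sub>F w in lower_at x. Im w < 0" by (simp add: eventually_at_filter)
        with near show "\<forall>\<^sub>F w in lower_at x. norm (f w - q * (w powr \<alpha> * f0 w)) \<le> C"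
        proof eventually_elim
          case (elim w)
          then have "w \<noteq> 0" by auto
          with elim show ?case using d(2)[of w] slit_power_lower[of w \<alpha>]
            by (auto simp: complex_nonneg_Reals_iff q_def mult.assoc)
        qed
      qed
      ultimately have "norm ((l - q * ?b) - (l - ?b)) \<le> 2 * C"
        using norm_triangle_ineq4[of "l - q * ?b" "l - ?b"] by linarith
      moreover have "(l - q * ?b) - (l - ?b) =
          (1 - q) * ?b" by (simp add: algebra_simps)
      ultimately have "norm (1 - q) * (x powr Re \<alpha> * norm (f0 (of_real x))) \<le> 2 * C"
        using x by (simp add: norm_mult norm_powr_real_powr)
      then show ?thesis
        using q x by (simp add: powr_minus field_simps)
    qed
    then have "\<forall>\<^sub>F x in at_right 0. norm (f0 (of_real x)) \<le> 2 * C / norm (1 - q) * x powr (- Re \<alpha>)"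
      using eventually_at_right_real[of 0 "min d s"] d(1) s(1) by (auto elim!: eventually_mono)
    from power_germ_order[OF f0(1) this] show ?thesis by metis
  qed
  then obtain D d where D: "d > 0" "\<And>z. z \<noteq> 0 \<Longrightarrow> norm z < d \<Longrightarrow> norm (f0 z) \<le> D * norm z powr (- Re \<alpha>)"
    by blast
  have "bounded_at_0 (\<lambda>z. slit_power \<alpha> z * f0 z)"
    unfolding bounded_at_0_def
  proof (rule bigoI[where c = "A * D"])
    have "norm (slit_power \<alpha> z * f0 z) \<le> A * D" if "z \<noteq> 0" "norm z < d" for z
    proof -
      have "norm (slit_power \<alpha> z * f0 z) \<le> (A * norm z powr Re \<alpha>) * (D * norm z powr (- Re \<alpha>))"
        unfolding norm_mult using A that D(2)[OF that] by (intro mult_mono) auto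
      also have "\<dots> = A * D" using that by (simp add: powr_minus field_simps)
      finally show ?thesis .
    qed
    then show "\<forall>\<^sub>F z in at 0 within slit_plane. norm (slit_power \<alpha> z * f0 z) \<le> A * D * norm (1 :: complex)"
      using D(1) unfolding eventually_at by (intro exI[of _ d]) (auto simp: dist_norm)
  qed
  from bounded_at_0_add[OF f0(2) this] show ?thesis by simp
qed

section \<open>Uniqueness\<close>

text \<open>Without positivity, pairing d with itself proves nothing. The Laguerre polynomial of the
  degree of d isolates the leading coefficient of d, with a nonzero factor.\<close>

lemma gamma_functional_eq_0_imp_0:
  assumes \<alpha>: "regular_exponent \<alpha>" and deg: "degree d < n"
    and orth: "\<And>i. i < n \<Longrightarrow> gamma_functional \<alpha> (monom 1 i * d) = 0"
  shows "d = 0"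
proof (rule ccontr)
  assume "d \<noteq> 0"
  define m where "m = degree d"
  let ?p = "monic_laguerre \<alpha> m"
  have sum: "gamma_functional \<alpha> ((\<Sum>i\<le>k. smult (coeff ?p i) (monom 1 i)) * d) = 0" if "k < n" for k
    using that
  proof (induction k)
    case (Suc k)
    then show ?case
      using orth[of "Suc k"] by (simp add: distrib_right gamma_functional_add gamma_functional_smult)
  qed (use orth[of 0] in \<open>simp add: gamma_functional_smult\<close>)
  have "(\<Sum>i\<le>m. smult (coeff ?p i) (monom 1 i)) = ?p"
    using poly_as_sum_of_monoms'[OF degree_monic_laguerre_le, of \<alpha> m] by (simp add: smult_monom)
  then have "gamma_functional \<alpha> (d * ?p) = 0"
    using sum[of m] deg by (simp add: m_def mult.commute)
  moreover have "gamma_functional \<alpha> (d * ?p) = fact m * coeff d m * Gamma (\<alpha> + 1 + of_nat m)"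
    by (rule gamma_functional_orthogonality[OF \<alpha>]) (simp add: m_def)
  moreover have "Gamma (\<alpha> + 1 + of_nat m) \<noteq> 0"
    using regular_exponent_nonpos_Ints[OF \<alpha>] by (simp add: Gamma_eq_zero_iff)
  ultimately show False using \<open>d \<noteq> 0\<close> by (simp add: m_def)
qed

lemma laguerre_row_0:
  assumes \<alpha>: "regular_exponent \<alpha>" "\<alpha> \<noteq> 0" and n: "n \<ge> 1" and row: "laguerre_row \<alpha> n 0 0 u v"
    and z: "z \<in> slit_plane"
  shows "u z = 0" "v z = 0"
proof -
  let ?k = "cauchy_factor :: complex"
  have hol: "u holomorphic_on slit_plane" "v holomorphic_on slit_plane"
    and bdd: "bounded_at_0 u" "power_germ_bounded \<alpha> v"
    and Ou: "(\<lambda>z. u z * inverse (z ^ n)) \<in> O[slit_at_infinity](inverse)"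
    and Ov: "(\<lambda>z. v z * z ^ n) \<in> O[slit_at_infinity](inverse)"
    and lim: "\<And>x. x > 0 \<Longrightarrow> \<exists>l. (u \<longlongrightarrow> l) (upper_at x) \<and> (u \<longlongrightarrow> l) (lower_at x) \<and>
      has_jump v x (l * (real_weight \<alpha> x))"
    using row by (simp_all add: laguerre_row_def)
  obtain G where G: "G holomorphic_on UNIV" "\<And>z. z \<in> slit_plane \<Longrightarrow> G z = u z"
    using entire_extension[OF hol(1) _ bdd(1)] lim by metis
  have "(\<lambda>z. u z * inverse (z ^ n) * z ^ n) \<in> O[slit_at_infinity](\<lambda>z. inverse z * z ^ n)"
    by (intro landau_o.big.mult_right Ou)
  moreover have ev: "\<forall>\<^sub>F z in slit_at_infinity. G z = u z * inverse (z ^ n) * z ^ n"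
    "\<forall>\<^sub>F z in slit_at_infinity. inverse z * z ^ n = z ^ (n - 1)"
  proof -
    show "\<forall>\<^sub>F z in slit_at_infinity. G z = u z * inverse (z ^ n) * z ^ n"
      using eventually_in_slit
    proof eventually_elim
      case (elim z)
      then have "z \<noteq> 0" by auto
      then show ?case using G(2)[OF elim] by simp
    qed
    show "\<forall>\<^sub>F z in slit_at_infinity. inverse z * z ^ n = z ^ (n - 1)"
      using eventually_in_slit
    proof eventually_elim
      case (elim z)
      then have "z \<noteq> 0" by auto
      then show ?case using n by (cases n) auto
    qed
  qed
  ultimately have "G \<in> O[slit_at_infinity](\<lambda>z. z ^ (n - 1))"
    unfolding landau_o.big.in_cong[OF ev(1)] landau_o.big.cong[OF ev(2)] by simp
  then obtain R C where "\<And>z. R \<le> norm z \<Longrightarrow> norm (G z) \<le> C * norm (z ^ (n - 1))"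
  proof (rule entire_growth_at_infinity[OF G(1)])
    show "isCont (\<lambda>z. z ^ (n - 1)) z" for z :: complex by (intro continuous_intros)
  qed blast
  then have "G z = (\<Sum>k\<le>n - 1. (deriv ^^ k) G 0 / fact k * z ^ k)" for z
    by (intro Liouville_polynomial[OF G(1), of R C]) (simp add: norm_power)
  then obtain d where d: "\<And>z. G z = poly d z" "degree d \<le> n - 1"
    by (intro that[of "\<Sum>k\<le>n - 1. monom ((deriv ^^ k) G 0 / fact k) k"])
       (auto simp: poly_sum poly_monom intro!: degree_sum_le order_trans[OF degree_monom_le])
  have ud: "u z = poly d z" if "z \<in> slit_plane" for z using d(1) G(2)[OF that] by simp
  \<comment> \<open>The transform of d has the same jump as v, and both meet the condition at 0. The
    difference is jump-free, so the z^\<alpha> part of its behaviour at 0 is bounded as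
    well.\<close>
  define D where "D z = v z + - ?k * poly_stieltjes \<alpha> d z" for z
  have holD: "D holomorphic_on slit_plane"
    unfolding D_def by (intro holomorphic_intros hol holomorphic_poly_stieltjes \<alpha>)
  have limD: "\<exists>l. (D \<longlongrightarrow> l) (upper_at x) \<and> (D \<longlongrightarrow> l) (lower_at x)" if x: "x > 0" for x
  proof -
    let ?w = "real_weight \<alpha> x"
    obtain l where l: "(u \<longlongrightarrow> l) (upper_at x)" "has_jump v x (l * ?w)" using lim[OF x] by blast
    have "(poly d \<longlongrightarrow> poly d (of_real x)) (upper_at x)" by (intro tendsto_intros)
    moreover have "\<forall>\<^sub>F z in upper_at x. poly d z = u z"
      using ud by (auto simp: eventually_at_filter complex_nonneg_Reals_iff)
    ultimately have "(u \<longlongrightarrow> poly d (of_real x)) (upper_at x)" by (rule Lim_transform_eventually)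
    then have "l = poly d (of_real x)" using l(1) tendsto_unique[OF upper_at_nontrivial] by blast
    then have "has_jump D x (poly d (of_real x) * ?w + - ?k * (2 * of_real pi * \<i> * (poly d (of_real x) * ?w)))"
      unfolding D_def using l(2) by (intro has_jump_add has_jump_mult has_jump_poly_stieltjes \<alpha> x continuous_intros) simp
    then have "has_jump D x 0" by simp
    then show ?thesis by (auto simp: has_jump_def)
  qed
  have "power_germ_bounded \<alpha> D"
    unfolding D_def by (intro power_germ_bounded_add bdd power_germ_bounded_cmult power_germ_bounded_poly_stieltjes \<alpha>)
  then have "bounded_at_0 D" using limD by (rule power_germ_without_jump_bounded[OF \<alpha>])
  then obtain H where H: "H holomorphic_on UNIV" "\<And>z. z \<in> slit_plane \<Longrightarrow> H z = D z"
    using entire_extension[OF holD limD] by metis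
  have "(\<lambda>z. v z * z ^ n * (inverse z) ^ n) \<in> O[slit_at_infinity](\<lambda>z. inverse z * 1 ^ n)"
    by (intro landau_o.big.mult Ov landau_o.big_power inverse_bigo_1)
  moreover have evv: "\<forall>\<^sub>F z in slit_at_infinity. v z * z ^ n * (inverse z) ^ n = v z"
    using eventually_in_slit
  proof eventually_elim
    case (elim z)
    then have "z \<noteq> 0" by auto
    then show ?case by (simp add: power_inverse)
  qed
  ultimately have "v \<in> O[slit_at_infinity](inverse)"
    unfolding landau_o.big.in_cong[OF evv] by simp
  then have "D \<in> O[slit_at_infinity](inverse)"
    unfolding D_def using poly_stieltjes_bigo_inverse[OF \<alpha>(1), of d] by (intro sum_in_bigo(1)) simp_all
  moreover have evD: "\<forall>\<^sub>F z in slit_at_infinity. H z = D z"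
    using eventually_in_slit by eventually_elim (rule H(2))
  ultimately have "H \<in> O[slit_at_infinity](inverse)"
    unfolding landau_o.big.in_cong[OF evD] by blast
  then obtain R C where RC: "\<And>z. R \<le> norm z \<Longrightarrow> norm (H z) \<le> C * norm (inverse z)"
  proof (rule entire_growth_at_infinity[OF H(1)])
    show "isCont inverse z" if "z \<noteq> 0" for z :: complex using that by (intro continuous_intros)
  qed blast
  have "(H \<longlongrightarrow> 0) at_infinity"
  proof (rule Lim_null_comparison)
    show "\<forall>\<^sub>F z in at_infinity. norm (H z) \<le> C * norm (inverse z)"
      unfolding eventually_at_infinity using RC by blast
    show "((\<lambda>z::complex. C * norm (inverse z)) \<longlongrightarrow> 0) at_infinity"
      by (intro tendsto_mult_right_zero tendsto_norm_zero tendsto_inverse_0)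
  qed
  then have "H z = 0" for z by (rule Liouville_weak_0[OF H(1)])
  then have vd: "v z = ?k * poly_stieltjes \<alpha> d z" if "z \<in> slit_plane" for z
    using H(2)[OF that] by (simp add: D_def)
  \<comment> \<open>With all earlier moments zero, the transform of t^(i+1) d is z^(i+1) times that
    of d, plus the i-th moment. Both functions are O(1/z) for i < n, hence so is the constant
    moment, and it vanishes.\<close>
  have orth: "gamma_functional \<alpha> (monom 1 i * d) = 0" if "i < n" for i
    using that
  proof (induction i rule: less_induct)
    case (less i)
    have S: "poly_stieltjes \<alpha> (monom 1 i * d) z = z ^ i * poly_stieltjes \<alpha> d z" if "z \<in> slit_plane" for z
      using less by (intro poly_stieltjes_monom_mult \<alpha> that) auto
    have "poly_stieltjes \<alpha> (pCons 0 (monom 1 i * d)) \<in> O[slit_at_infinity](inverse)"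
      by (rule poly_stieltjes_bigo_inverse[OF \<alpha>(1)])
    moreover have "(\<lambda>z. inverse ?k * (v z * z ^ n * inverse z ^ (n - Suc i))) \<in> O[slit_at_infinity](inverse)"
    proof -
      have "(\<lambda>z. v z * z ^ n * inverse z ^ (n - Suc i)) \<in> O[slit_at_infinity](\<lambda>z. inverse z * 1 ^ (n - Suc i))"
        by (intro landau_o.big.mult Ov landau_o.big_power inverse_bigo_1)
      then show ?thesis by simp
    qed
    ultimately have "(\<lambda>z. poly_stieltjes \<alpha> (pCons 0 (monom 1 i * d)) z - inverse ?k * (v z * z ^ n * inverse z ^ (n - Suc i)))
        \<in> O[slit_at_infinity](inverse)" by (rule sum_in_bigo(2))
    moreover have ev: "\<forall>\<^sub>F z in slit_at_infinity.
        poly_stieltjes \<alpha> (pCons 0 (monom 1 i * d)) z - inverse ?k * (v z * z ^ n * inverse z ^ (n - Suc i))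
        = gamma_functional \<alpha> (monom 1 i * d)"
      using eventually_in_slit
    proof eventually_elim
      case (elim z)
      then have "z \<noteq> 0" by auto
      have "z ^ n = z ^ Suc i * z ^ (n - Suc i)"
        using less.prems by (simp flip: power_add del: power_Suc)
      then have "z ^ n * inverse z ^ (n - Suc i) = z ^ Suc i"
        using \<open>z \<noteq> 0\<close> by (simp add: power_inverse del: power_Suc)
      then have "inverse ?k * (v z * z ^ n * inverse z ^ (n - Suc i)) = z * (z ^ i * poly_stieltjes \<alpha> d z)"
        unfolding mult.assoc vd[OF elim] by (simp add: mult_ac)
      then show ?case using poly_stieltjes_shift[OF \<alpha>(1) elim, of "monom 1 i * d"] S[OF elim] by simp
    qed
    ultimately have "(\<lambda>_. gamma_functional \<alpha> (monom 1 i * d)) \<in> O[slit_at_infinity](inverse)"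
      unfolding landau_o.big.in_cong[OF ev] by blast
    then show ?case by (rule const_bigo_inverse_imp_0)
  qed
  have "d = 0"
    using d(2) n orth by (intro gamma_functional_eq_0_imp_0[OF \<alpha>(1), of d n]) auto
  then show "u z = 0" "v z = 0" using ud[OF z] vd[OF z] by simp_all
qed

text \<open>The problem depends only on values off the cut, where \<open>fp_cauchy\<close> and
  \<open>poly_stieltjes\<close> agree up to their factor; on the cut they need not.\<close>

lemma laguerre_row_cong:
  assumes "laguerre_row \<alpha> n a b u v"
    and eq: "\<And>z. z \<in> slit_plane \<Longrightarrow> u z = u' z" "\<And>z. z \<in> slit_plane \<Longrightarrow> v z = v' z"
  shows "laguerre_row \<alpha> n a b u' v'"
  unfolding laguerre_row_def
proof (intro conjI allI impI)
  have u: "u holomorphic_on slit_plane" "bounded_at_0 u" and v: "v holomorphic_on slit_plane" "power_germ_bounded \<alpha> v"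
    using assms(1) by (simp_all add: laguerre_row_def)
  show "u' holomorphic_on slit_plane" by (rule holomorphic_transform[OF u(1)]) (rule eq)
  show "v' holomorphic_on slit_plane" by (rule holomorphic_transform[OF v(1)]) (rule eq)
  show "bounded_at_0 u'" by (rule bounded_at_0_cong[OF u(2)]) (rule eq)
  show "power_germ_bounded \<alpha> v'" by (rule power_germ_bounded_cong[OF v(2)]) (rule eq)
  have ev: "\<forall>\<^sub>F z in slit_at_infinity. u' z * inverse (z ^ n) - a = u z * inverse (z ^ n) - a"
    "\<forall>\<^sub>F z in slit_at_infinity. v' z * z ^ n - b = v z * z ^ n - b"
    using eventually_in_slit by (eventually_elim, simp add: eq)+
  show "(\<lambda>z. u' z * inverse (z ^ n) - a) \<in> O[slit_at_infinity](inverse)"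
    "(\<lambda>z. v' z * z ^ n - b) \<in> O[slit_at_infinity](inverse)"
    unfolding landau_o.big.in_cong[OF ev(1)] landau_o.big.in_cong[OF ev(2)]
    using assms(1) by (simp_all add: laguerre_row_def)
  fix x :: real assume "x > 0"
  then obtain l where l: "(u \<longlongrightarrow> l) (upper_at x)" "(u \<longlongrightarrow> l) (lower_at x)"
      "has_jump v x (l * (real_weight \<alpha> x))"
    using assms(1) by (auto simp: laguerre_row_def)
  have "\<forall>\<^sub>F z in upper_at x. u z = u' z" "\<forall>\<^sub>F z in lower_at x. u z = u' z"
    using eq(1) by (auto simp: eventually_at_filter complex_nonneg_Reals_iff)
  with l(1,2) have "(u' \<longlongrightarrow> l) (upper_at x)" "(u' \<longlongrightarrow> l) (lower_at x)"
    by (auto intro: Lim_transform_eventually)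
  moreover have "has_jump v' x (l * (real_weight \<alpha> x))"
    using l(3) by (rule has_jump_cong) (use eq(2) nonreal_in_slit_plane in auto)
  ultimately show "\<exists>l. (u' \<longlongrightarrow> l) (upper_at x) \<and> (u' \<longlongrightarrow> l) (lower_at x) \<and>
      has_jump v' x (l * (real_weight \<alpha> x))" by blast
qed

theorem theorem10:
  fixes \<alpha> :: complex and n :: nat
  assumes "\<alpha> \<notin> {- of_nat k | k::nat. k \<ge> 1}"
    and "\<alpha> \<noteq> 0"
    and "n \<ge> 1"
  shows "laguerre_RHP \<alpha> n (laguerre_Y \<alpha> n) \<and>
    (\<forall>Y. laguerre_RHP \<alpha> n Y \<longrightarrow> (\<forall>z\<in>slit_plane. Y z = laguerre_Y \<alpha> n z))"
proof -
  have sol: "laguerre_row \<alpha> n ((mat 1 :: complex^2^2) $ i $ 1) ((mat 1 :: complex^2^2) $ i $ 2)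
      (\<lambda>z. laguerre_Y \<alpha> n z $ i $ 1) (\<lambda>z. laguerre_Y \<alpha> n z $ i $ 2)" for i :: 2
  proof -
    consider "i = 1" | "i = 2" using exhaust_2 by blast
    then show ?thesis
    proof cases
      case 1
      have "laguerre_row \<alpha> n 1 0 (\<lambda>z. laguerre_Y \<alpha> n z $ 1 $ 1) (\<lambda>z. laguerre_Y \<alpha> n z $ 1 $ 2)"
        by (rule laguerre_row_cong[OF laguerre_row_1[OF assms]])
           (use fp_cauchy_eq_poly_stieltjes[OF assms(1)] in \<open>simp_all add: laguerre_Y_def\<close>)
      then show ?thesis using 1 by (simp add: mat_def)
    next
      case 2
      have "laguerre_row \<alpha> n 0 1 (\<lambda>z. laguerre_Y \<alpha> n z $ 2 $ 1) (\<lambda>z. laguerre_Y \<alpha> n z $ 2 $ 2)"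
        by (rule laguerre_row_cong[OF laguerre_row_2[OF assms]])
           (use fp_cauchy_eq_poly_stieltjes[OF assms(1)] in \<open>simp_all add: laguerre_Y_def poly_stieltjes_smult\<close>)
      then show ?thesis using 2 by (simp add: mat_def)
    qed
  qed
  have "Y z = laguerre_Y \<alpha> n z" if Y: "laguerre_RHP \<alpha> n Y" and z: "z \<in> slit_plane" for Y z
  proof -
    \<comment> \<open>The identity rows cancel in the difference, so each row of it falls under the
      homogeneous case \<open>laguerre_row_0\<close>.\<close>
    have "Y z $ i $ j = laguerre_Y \<alpha> n z $ i $ j" for i j
      using laguerre_row_0[OF assms laguerre_row_diff[OF laguerre_RHP_imp_row[OF Y, of i] sol[of i]] z] exhaust_2[of j]
      by auto
    then show ?thesis by (simp add: vec_eq_iff)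
  qed
  then show ?thesis using laguerre_RHP_if_rows[OF sol] by blast
qed

end
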